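(* Let $G=(V,E)$ be an $n$-vertex graph of maximum degree $\Delta\ge3$ that has polynomially bounded local treewidth with constant parameters $a,d>0$, and suppose the hardcore model on $G$ with fugacity $\lambda>0$ satisfies strong spatial mixing with constant parameters $C>0$, $\delta\in(0,1)$. Then the mixing time of the Glauber dynamics for the hardcore Gibbs distribution on $G$ is $O(n\log^4 n)$, where the implied constant depends only on $a,d,\Delta,\lambda,C,\delta$.
   Context: $G$ has polynomially bounded local treewidth with parameters $a,d$ if every subgraph $H$ of $G$ satisfies $\mathrm{tw}(H)\le a\cdot(\mathrm{diam}(H))^d$. The hardcore model: $\mu$ on indicator vectors $\sigma\in\{0,1\}^V$ of independent sets $I$ with $\mu(I)\propto\lambda^{|I|}$. A pinning on $\Lambda\subseteq V$ is a configuration $\eta$ on $\Lambda$ with positive marginal probability; $\mu^\eta_v(c\mid\tau)$ is the probability that $\sigma_v=c$ under $\mu$ conditioned on $\sigma_\Lambda=\eta$ and $\sigma_W=\tau$. Strong spatial mixing with parameters $C,\delta$: for every pinning $\eta$ on any $\Lambda\subseteq V$, every $v\in V\setminus\Lambda$ and feasible spin $c$, every $W\subseteq V\setminus(\Lambda\cup\{v\})$ and every two feasible configurations $\tau,\xi$ on $W$, $\left|\frac{\mu^\eta_v(c\mid\tau)}{\mu^\eta_v(c\mid\xi)}-1\right|\le C(1-\delta)^{\mathrm{dist}_G(v,W)}$. The Glauber dynamics picks a uniformly random vertex each step and resamples its spin from the conditional distribution given the rest; its mixing time is the smallest $t$ such that from every initial configuration in the support, the distribution after $t$ steps is within total variation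 distance $1/4$ of $\mu$. *)

theory Defs
  imports "HOL-Probability.Probability" "Graph_Theory.Graph_Theory"
begin

text \<open>
  Finite simple graphs are the symmetric loop-free digraphs \<open>pair_graph\<close> of the entry
  \<open>Graph_Theory\<close>: an undirected edge \<open>uv\<close> is the pair of arcs \<open>(u, v)\<close> and \<open>(v, u)\<close>. The constant
  \<open>connected\<close> is always written qualified, as HOL-Analysis has a topological one of that name.

  The vertex type is arbitrary. A bound that holds uniformly for all graphs over the instance
  \<open>nat\<close> is uniform for all finite graphs, as each of them is isomorphic to one over \<open>nat\<close>.
\<close>

section \<open>Degree, distance, diameter\<close>

definition max_degree :: "'a pair_pre_digraph \<Rightarrow> nat" where
  "max_degree G = (SUP v\<in>pverts G. out_degree (with_proj G) v)"

definition graph_dist :: "'a pair_pre_digraph \<Rightarrow> 'a \<Rightarrow> 'a \<Rightarrow> enat" where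
  "graph_dist G u v = (INF p\<in>{p. pre_digraph.awalk (with_proj G) u p v}. enat (length p))"

definition set_dist :: "'a pair_pre_digraph \<Rightarrow> 'a \<Rightarrow> 'a set \<Rightarrow> enat" where
  "set_dist G v W = (INF w\<in>W. graph_dist G v w)"

text \<open>The diameter of a disconnected graph is infinite.\<close>

definition graph_diam :: "'a pair_pre_digraph \<Rightarrow> enat" where
  "graph_diam G = (SUP u\<in>pverts G. SUP v\<in>pverts G. graph_dist G u v)"

lemma graph_dist_eq_shortest_path:
  assumes "pair_wf_digraph G"
  shows "ereal_of_enat (graph_dist G u v) = wf_digraph.\<mu> (with_proj G) (\<lambda>_. 1) u v"
proof -
  interpret pair_wf_digraph G by fact
  have cost: "awalk_cost (\<lambda>_. 1) p = real (length p)" for p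
    by (induction p) auto
  let ?S = "{p. awalk u p v}"
  show ?thesis
  proof (cases "?S = {}")
    case True
    then show ?thesis
      unfolding graph_dist_def \<mu>_def True by (simp add: top_ereal_def top_enat_def)
  next
    case False
    have "(INF p\<in>?S. enat (length p)) \<in> (\<lambda>p. enat (length p)) ` ?S"
      using False wellorder_InfI[of _ "(\<lambda>p. enat (length p)) ` ?S"] by blast
    then obtain q where q: "q \<in> ?S" "(INF p\<in>?S. enat (length p)) = enat (length q)"
      by auto
    have "length q \<le> length p" if "p \<in> ?S" for p
    proof -
      have "(INF p\<in>?S. enat (length p)) \<le> enat (length p)"
        using that by (rule INF_lower)
      then show ?thesis using q(2) by simp
    qed
    then have "(INF p\<in>?S. ereal (real (length p))) = ereal (real (length q))"
      using q(1) by (intro INF_eqI) auto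
    then show ?thesis
      unfolding graph_dist_def \<mu>_def cost using q(2) by simp
  qed
qed

section \<open>Treewidth\<close>

text \<open>
  A symmetric digraph has the closed walk \<open>u, v, u\<close> along every edge, which the library counts
  as a cycle; cycles of the undirected graph are those of length at least three. (For the same
  reason the library's \<open>tree\<close> does not describe undirected trees.)
\<close>

definition undirected_tree :: "'a pair_pre_digraph \<Rightarrow> bool" where
  "undirected_tree T \<longleftrightarrow> pair_graph T \<and> Digraph_Component.connected (with_proj T) \<and>
     \<not> (\<exists>p. pre_digraph.cycle (with_proj T) p \<and> 3 \<le> length p)"

text \<open>
  Taking the nodes of the tree to be natural numbers is no restriction, since trees are finite.
  As \<open>connected\<close> excludes the null graph, the last condition also says that every vertex lies in
  some bag.
\<close>

definition tree_decomposition ::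
    "'a pair_pre_digraph \<Rightarrow> nat pair_pre_digraph \<Rightarrow> (nat \<Rightarrow> 'a set) \<Rightarrow> bool" where
  "tree_decomposition G T B \<longleftrightarrow> undirected_tree T \<and>
     (\<forall>t\<in>pverts T. B t \<subseteq> pverts G) \<and>
     (\<forall>(u, v)\<in>parcs G. \<exists>t\<in>pverts T. u \<in> B t \<and> v \<in> B t) \<and>
     (\<forall>v\<in>pverts G. Digraph_Component.connected
        (induce_subgraph (with_proj T) {t \<in> pverts T. v \<in> B t}))"

text \<open>By truncated subtraction the null graph gets treewidth 0 instead of \<open>-1\<close>.\<close>

definition decomposition_width :: "nat pair_pre_digraph \<Rightarrow> (nat \<Rightarrow> 'a set) \<Rightarrow> nat" where
  "decomposition_width T B = Max ((\<lambda>t. card (B t)) ` pverts T) - 1"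

definition treewidth :: "'a pair_pre_digraph \<Rightarrow> nat" where
  "treewidth G = (LEAST k. \<exists>T B. tree_decomposition G T B \<and> decomposition_width T B = k)"

lemma ex_tree_decomposition:
  assumes "pair_graph G"
  shows "\<exists>T B. tree_decomposition G T B"
proof -
  interpret G: pair_graph G by fact
  define T :: "nat pair_pre_digraph" where "T = \<lparr> pverts = {0}, parcs = {} \<rparr>"
  have T: "pair_graph T"
    by unfold_locales (auto simp: T_def symmetric_def sym_def)
  interpret T: pair_graph T by fact
  have conn: "Digraph_Component.connected H"
    if "verts H = {0}" "arcs H = {}" for H :: "(nat, nat \<times> nat) pre_digraph"
    using that by (auto simp: connected_def strongly_connected_def mk_symmetric_def
        reachable_def intro: rtrancl_on.intros)
  have "\<not> pre_digraph.cycle (with_proj T) p" for p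
    by (auto simp: pre_digraph.cycle_def pre_digraph.awalk_def T_def)
  moreover have "Digraph_Component.connected (with_proj T)"
    by (rule conn) (auto simp: T_def)
  ultimately have "undirected_tree T"
    using T by (auto simp: undirected_tree_def)
  moreover have "Digraph_Component.connected (induce_subgraph (with_proj T) {t \<in> pverts T. v \<in> pverts G})"
    if "v \<in> pverts G" for v
    using that by (intro conn) (auto simp: T_def)
  ultimately have "tree_decomposition G T (\<lambda>_. pverts G)"
    using G.in_arcsD1 G.in_arcsD2 by (auto simp: tree_decomposition_def T_def)
  then show ?thesis by blast
qed

definition poly_bounded_local_treewidth :: "'a pair_pre_digraph \<Rightarrow> real \<Rightarrow> real \<Rightarrow> bool" where
  "poly_bounded_local_treewidth G a d \<longleftrightarrow>
     (\<forall>H. pair_graph H \<and> subgraph (with_proj H) (with_proj G) \<longrightarrow>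
        (case graph_diam H of
           enat k \<Rightarrow> real (treewidth H) \<le> a * real k powr d
         | \<infinity> \<Rightarrow> True))"

section \<open>The hardcore model\<close>

text \<open>
  A configuration is the indicator vector of a vertex set, with spin 1 encoded as \<open>True\<close> and
  extended by \<open>False\<close> outside the graph, so that it is determined by its values on the vertices.
\<close>

definition independent_set :: "'a pair_pre_digraph \<Rightarrow> 'a set \<Rightarrow> bool" where
  "independent_set G I \<longleftrightarrow> I \<subseteq> pverts G \<and> (\<forall>u\<in>I. \<forall>v\<in>I. (u, v) \<notin> parcs G)"

definition hardcore_partition :: "'a pair_pre_digraph \<Rightarrow> real \<Rightarrow> real" where
  "hardcore_partition G lam = (\<Sum>I | independent_set G I. lam ^ card I)"

definition hardcore :: "'a pair_pre_digraph \<Rightarrow> real \<Rightarrow> ('a \<Rightarrow> bool) pmf" where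
  "hardcore G lam = embed_pmf (\<lambda>\<sigma>.
     if independent_set G {v. \<sigma> v} then lam ^ card {v. \<sigma> v} / hardcore_partition G lam else 0)"

lemma pmf_hardcore:
  assumes "pair_graph G" "lam > 0"
  shows "pmf (hardcore G lam) \<sigma> =
    (if independent_set G {v. \<sigma> v} then lam ^ card {v. \<sigma> v} / hardcore_partition G lam else 0)"
proof -
  interpret pair_graph G by fact
  define F where "F = {I. independent_set G I}"
  define Z where "Z = hardcore_partition G lam"
  define f where "f = (\<lambda>\<sigma>. if independent_set G {v. \<sigma> v} then lam ^ card {v. \<sigma> v} / Z else 0)"
  have fin: "finite F"
    by (rule finite_subset[of _ "Pow (pverts G)"]) (auto simp: F_def independent_set_def pair_finite_verts)
  have "{} \<in> F" by (auto simp: F_def independent_set_def)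
  have Z: "Z = (\<Sum>I\<in>F. lam ^ card I)" by (simp add: Z_def hardcore_partition_def F_def)
  have "Z > 0"
    unfolding Z using fin \<open>{} \<in> F\<close> assms(2) by (intro sum_pos) auto
  have nonneg: "f \<sigma> \<ge> 0" for \<sigma>
    using assms(2) \<open>Z > 0\<close> by (simp add: f_def)
  define S where "S = (\<lambda>I v. v \<in> I) ` F"
  have S: "f \<sigma> = 0" if "\<sigma> \<notin> S" for \<sigma>
    using that by (auto simp: f_def S_def F_def image_iff dest: spec[of _ "{v. \<sigma> v}"])
  have "(\<integral>\<^sup>+\<sigma>. ennreal (f \<sigma>) \<partial>count_space UNIV) = (\<Sum>\<sigma>\<in>S. ennreal (f \<sigma>))"
    using fin S by (intro nn_integral_count_space'[of S]) (auto simp: S_def)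
  also have "\<dots> = ennreal (\<Sum>\<sigma>\<in>S. f \<sigma>)"
    using nonneg by (simp add: sum_ennreal)
  also have "(\<Sum>\<sigma>\<in>S. f \<sigma>) = (\<Sum>I\<in>F. f (\<lambda>v. v \<in> I))"
    unfolding S_def by (subst sum.reindex) (auto simp: inj_on_def fun_eq_iff)
  also have "\<dots> = (\<Sum>I\<in>F. lam ^ card I / Z)"
    by (rule sum.cong) (auto simp: f_def F_def)
  also have "\<dots> = 1"
    using \<open>Z > 0\<close> by (simp add: sum_divide_distrib[symmetric] Z[symmetric])
  finally have "pmf (embed_pmf f) \<sigma> = f \<sigma>"
    using nonneg by (intro pmf_embed_pmf) auto
  then show ?thesis
    unfolding hardcore_def f_def Z_def .
qed

section \<open>Strong spatial mixing\<close>

text \<open>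
  A configuration on a set \<open>\<Lambda>\<close> of vertices is given by a function of which only the values on
  \<open>\<Lambda>\<close> are used.
\<close>

definition agrees :: "'a set \<Rightarrow> ('a \<Rightarrow> bool) \<Rightarrow> ('a \<Rightarrow> bool) \<Rightarrow> bool" where
  "agrees \<Lambda> \<eta> \<sigma> \<longleftrightarrow> (\<forall>v\<in>\<Lambda>. \<sigma> v = \<eta> v)"

definition feasible :: "('a \<Rightarrow> bool) pmf \<Rightarrow> (('a \<Rightarrow> bool) \<Rightarrow> bool) \<Rightarrow> bool" where
  "feasible \<mu> P \<longleftrightarrow> measure_pmf.prob \<mu> {\<sigma>. P \<sigma>} > 0"

definition cond_marginal ::
    "('a \<Rightarrow> bool) pmf \<Rightarrow> 'a set \<Rightarrow> ('a \<Rightarrow> bool) \<Rightarrow> 'a \<Rightarrow> bool \<Rightarrow> 'a set \<Rightarrow> ('a \<Rightarrow> bool) \<Rightarrow> real" where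
  "cond_marginal \<mu> \<Lambda> \<eta> v c W \<tau> =
     cond_prob (measure_pmf \<mu>) (\<lambda>\<sigma>. \<sigma> v = c) (\<lambda>\<sigma>. agrees \<Lambda> \<eta> \<sigma> \<and> agrees W \<tau> \<sigma>)"

definition decay :: "real \<Rightarrow> enat \<Rightarrow> real" where
  "decay r D = (case D of enat k \<Rightarrow> r ^ k | \<infinity> \<Rightarrow> 0)"

text \<open>
  The spin \<open>c\<close> is feasible if it has positive probability under both conditional distributions.
  Without this the ratio can be \<open>p / 0\<close>: an occupied neighbour of \<open>v\<close> in \<open>\<xi>\<close> forces spin 0 at \<open>v\<close>.
\<close>

definition strong_spatial_mixing ::
    "'a pair_pre_digraph \<Rightarrow> ('a \<Rightarrow> bool) pmf \<Rightarrow> real \<Rightarrow> real \<Rightarrow> bool" where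
  "strong_spatial_mixing G \<mu> C \<delta> \<longleftrightarrow>
     (\<forall>\<Lambda> \<eta> v c W \<tau> \<xi>.
        \<Lambda> \<subseteq> pverts G \<and> feasible \<mu> (agrees \<Lambda> \<eta>) \<and>
        v \<in> pverts G - \<Lambda> \<and> W \<subseteq> pverts G - (\<Lambda> \<union> {v}) \<and>
        feasible \<mu> (\<lambda>\<sigma>. agrees \<Lambda> \<eta> \<sigma> \<and> agrees W \<tau> \<sigma>) \<and>
        feasible \<mu> (\<lambda>\<sigma>. agrees \<Lambda> \<eta> \<sigma> \<and> agrees W \<xi> \<sigma>) \<and>
        cond_marginal \<mu> \<Lambda> \<eta> v c W \<tau> > 0 \<and> cond_marginal \<mu> \<Lambda> \<eta> v c W \<xi> > 0 \<longrightarrow>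
        \<bar>cond_marginal \<mu> \<Lambda> \<eta> v c W \<tau> / cond_marginal \<mu> \<Lambda> \<eta> v c W \<xi> - 1\<bar>
          \<le> C * decay (1 - \<delta>) (set_dist G v W))"

section \<open>Glauber dynamics and mixing time\<close>

definition glauber_step :: "'a set \<Rightarrow> ('a \<Rightarrow> bool) pmf \<Rightarrow> ('a \<Rightarrow> bool) \<Rightarrow> ('a \<Rightarrow> bool) pmf" where
  "glauber_step V \<mu> \<sigma> =
     bind_pmf (pmf_of_set V) (\<lambda>v.
       map_pmf (\<lambda>\<rho>. \<sigma>(v := \<rho> v)) (cond_pmf \<mu> {\<rho>. agrees (V - {v}) \<sigma> \<rho>}))"

primrec glauber_dist ::
    "'a set \<Rightarrow> ('a \<Rightarrow> bool) pmf \<Rightarrow> nat \<Rightarrow> ('a \<Rightarrow> bool) \<Rightarrow> ('a \<Rightarrow> bool) pmf" where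
  "glauber_dist V \<mu> 0 \<sigma> = return_pmf \<sigma>"
| "glauber_dist V \<mu> (Suc t) \<sigma> = bind_pmf (glauber_dist V \<mu> t \<sigma>) (glauber_step V \<mu>)"

definition tv_dist :: "'b pmf \<Rightarrow> 'b pmf \<Rightarrow> real" where
  "tv_dist p q = (SUP A. \<bar>measure_pmf.prob p A - measure_pmf.prob q A\<bar>)"

text \<open>The mixing time is infinite if the dynamics never gets within \<open>1 / 4\<close> of \<open>\<mu>\<close>.\<close>

definition glauber_mixing_time :: "'a set \<Rightarrow> ('a \<Rightarrow> bool) pmf \<Rightarrow> enat" where
  "glauber_mixing_time V \<mu> =
     (INF t\<in>{t. \<forall>\<sigma>\<in>set_pmf \<mu>. tv_dist (glauber_dist V \<mu> t \<sigma>) \<mu> \<le> 1 / 4}. enat t)"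

end

theory Submission
  imports Defs "HOL-Real_Asymp.Real_Asymp"
begin

text \<open>
  Write \<open>Ent\<^sub>U\<close> for the expected entropy conditional on the configuration outside \<open>U\<close>. If \<open>S \<subseteq> U\<close> and
  \<open>B\<close> is the \<open>l\<close>-neighbourhood of \<open>S\<close> in \<open>U\<close>, strong spatial mixing makes the configurations on \<open>S\<close> and
  on \<open>U - B\<close> almost independent, which gives \<open>Ent\<^sub>U \<le> (1 + O(|S| (1 - \<delta>)^l)) (Ent\<^bsub>U - S\<^esub> + Ent\<^sub>B)\<close>.

  This is used in two ways to bound \<open>Ent\<^sub>U\<close> by \<open>K\<close> times the sum of the single-site entropies. First
  \<open>S\<close> is a sphere and \<open>l = O(log |U|)\<close>: region growing cuts \<open>U\<close> into pieces of polylogarithmic radius,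
  every vertex being in \<open>O(log |U|)\<close> of the neighbourhoods \<open>B\<close>. The pieces have polylogarithmic
  treewidth, so next \<open>S\<close> is a balanced separator contained in a bag, and \<open>l = O(log log |U|)\<close>. Hence
  \<open>K(m) = O(log\<^sup>2 m) K(polylog m)\<close>, so \<open>K(m) = O(log\<^sup>3 m)\<close>.

  The relative entropy to the Gibbs distribution thus contracts by \<open>1 - 1 / (n K(n))\<close> in each step of
  the dynamics; it is \<open>O(n)\<close> initially, and by a Pinsker type inequality it suffices to make it small.
\<close>

section \<open>Conditional entropy on finite configuration spaces\<close>

text \<open>The error of a cut multiplies the constant, whereas a further neighbourhood containing a
  vertex only adds to it. So \<open>l\<close> has to be just large enough for all error factors
  together to stay below 2. Up to \<open>2 ^ T\<close> successive cuts by spheres of up to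
  \<open>2 ^ T\<close> vertices ask for an error of order \<open>4 ^ (- T)\<close>, while
  \<open>T\<close> levels of separators with \<open>s\<close> vertices ask only for
  \<open>1 / (s * T)\<close>; this is the reason for the two scales of \<open>l\<close>. Spheres
  alone do not reduce the problem: at their scale of \<open>l\<close> a neighbourhood need not be
  smaller than \<open>U\<close>, and all that is gained is a small radius, which the hypothesis on
  local treewidth turns into small bags. The neighbourhoods of separators do become small, with
  polylogarithmically many vertices, and are left to the recursion. One logarithm counts the annuli
  containing a vertex, one the levels of separators. The third one pays for the recursive call,
  whose cost is only a power of log log. The fourth one, in the mixing time, is the time to bring an
  entropy linear in \<open>n\<close> down to a constant.\<close>

lemma mult_ln_div_ge:
  fixes x y :: real
  assumes "x > 0" "y > 0"
  shows "x - y \<le> x * ln (x / y)"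
proof -
  have "ln (y / x) \<le> y / x - 1"
    using assms by (intro ln_le_minus_one) auto
  then have "x * ln (y / x) \<le> x * (y / x - 1)"
    using assms by (intro mult_left_mono) auto
  also have "\<dots> = y - x" using assms by (simp add: field_simps)
  finally show ?thesis using assms by (simp add: ln_div algebra_simps)
qed

text \<open>This is \<open>mult_ln_div_ge\<close> for the square roots, multiplied by
  \<open>2 * sqrt x\<close>. If \<open>x\<close> has mean \<open>y\<close>, the left side has the
  mean of \<open>(sqrt x - sqrt y)\<^sup>2\<close>, so entropy dominates the squared Hellinger
  distance.\<close>

lemma sqrt_diff_power2_le_mult_ln:
  fixes x y :: real
  assumes "x > 0" "y > 0"
  shows "2 * x - 2 * sqrt (x * y) \<le> x * ln (x / y)"
proof -
  have "sqrt x - sqrt y \<le> sqrt x * ln (sqrt x / sqrt y)"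
    using assms by (intro mult_ln_div_ge) auto
  then have "2 * sqrt x * (sqrt x - sqrt y) \<le> 2 * sqrt x * (sqrt x * ln (sqrt x / sqrt y))"
    using assms by (intro mult_left_mono) auto
  moreover have "ln (sqrt x / sqrt y) = ln (x / y) / 2"
    using assms by (simp add: real_sqrt_divide[symmetric] ln_sqrt)
  moreover have "sqrt x * (sqrt x * z) = x * z" for z
    using assms by (simp flip: mult.assoc)
  ultimately show ?thesis
    using assms by (simp add: algebra_simps real_sqrt_mult)
qed

section \<open>Conditional averages and conditional entropy\<close>

locale weighted_configs =
  fixes \<Omega> :: "('a \<Rightarrow> 'b) set" and w :: "('a \<Rightarrow> 'b) \<Rightarrow> real"
  assumes finite_configs: "finite \<Omega>"
    and weight_pos: "\<sigma> \<in> \<Omega> \<Longrightarrow> w \<sigma> > 0"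
begin

definition cl :: "'a set \<Rightarrow> ('a \<Rightarrow> 'b) \<Rightarrow> ('a \<Rightarrow> 'b) set" where
  "cl U \<sigma> = {\<rho> \<in> \<Omega>. \<forall>x. x \<notin> U \<longrightarrow> \<rho> x = \<sigma> x}"

definition mass :: "'a set \<Rightarrow> ('a \<Rightarrow> 'b) \<Rightarrow> real" where
  "mass U \<sigma> = (\<Sum>\<rho>\<in>cl U \<sigma>. w \<rho>)"

text \<open>Conditional expectation given the spins outside \<open>U\<close>: the index names the
  block that is left free, so a larger \<open>U\<close> means a coarser average.\<close>

definition av :: "'a set \<Rightarrow> (('a \<Rightarrow> 'b) \<Rightarrow> real) \<Rightarrow> ('a \<Rightarrow> 'b) \<Rightarrow> real" where
  "av U f \<sigma> = (\<Sum>\<rho>\<in>cl U \<sigma>. w \<rho> * f \<rho>) / mass U \<sigma>"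

definition cond_ent :: "'a set \<Rightarrow> (('a \<Rightarrow> 'b) \<Rightarrow> real) \<Rightarrow> real" where
  "cond_ent U f = (\<Sum>\<sigma>\<in>\<Omega>. w \<sigma> * (f \<sigma> * ln (f \<sigma> / av U f \<sigma>)))"

lemma finite_cl [simp]: "finite (cl U \<sigma>)"
  using finite_configs by (simp add: cl_def)

lemma cl_subset: "cl U \<sigma> \<subseteq> \<Omega>"
  by (auto simp: cl_def)

lemma cl_refl: "\<sigma> \<in> \<Omega> \<Longrightarrow> \<sigma> \<in> cl U \<sigma>"
  by (simp add: cl_def)

lemma cl_sym: "\<rho> \<in> cl U \<sigma> \<Longrightarrow> \<sigma> \<in> \<Omega> \<Longrightarrow> \<sigma> \<in> cl U \<rho>"
  by (auto simp: cl_def)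

lemma cl_mono: "A \<subseteq> U \<Longrightarrow> cl A \<sigma> \<subseteq> cl U \<sigma>"
  by (auto simp: cl_def)

lemma cl_eq: "\<rho> \<in> cl U \<sigma> \<Longrightarrow> cl U \<rho> = cl U \<sigma>"
  by (auto simp: cl_def)

lemma av_eq: "\<rho> \<in> cl U \<sigma> \<Longrightarrow> av U f \<rho> = av U f \<sigma>"
  by (simp add: av_def mass_def cl_eq)

lemma mass_eq: "\<rho> \<in> cl U \<sigma> \<Longrightarrow> mass U \<rho> = mass U \<sigma>"
  by (simp add: mass_def cl_eq)

lemma mass_pos: "\<sigma> \<in> \<Omega> \<Longrightarrow> mass U \<sigma> > 0"
  unfolding mass_def using weight_pos cl_subset cl_refl[of \<sigma> U] by (intro sum_pos) auto

lemma av_pos: "\<sigma> \<in> \<Omega> \<Longrightarrow> (\<And>\<rho>. \<rho> \<in> \<Omega> \<Longrightarrow> f \<rho> > 0) \<Longrightarrow> av U f \<sigma> > 0"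
  unfolding av_def using weight_pos cl_subset[of U \<sigma>] cl_refl[of \<sigma> U] mass_pos[of \<sigma> U]
  by (intro divide_pos_pos sum_pos) (auto intro!: mult_pos_pos)

lemma av_nonneg: "\<sigma> \<in> \<Omega> \<Longrightarrow> (\<And>\<rho>. \<rho> \<in> \<Omega> \<Longrightarrow> f \<rho> \<ge> 0) \<Longrightarrow> av U f \<sigma> \<ge> 0"
  unfolding av_def using weight_pos cl_subset[of U \<sigma>] mass_pos[of \<sigma> U]
  by (intro divide_nonneg_nonneg sum_nonneg mult_nonneg_nonneg) (auto intro: less_imp_le)

lemma av_mono:
  "\<sigma> \<in> \<Omega> \<Longrightarrow> (\<And>\<rho>. \<rho> \<in> cl U \<sigma> \<Longrightarrow> f \<rho> \<le> g \<rho>) \<Longrightarrow> av U f \<sigma> \<le> av U g \<sigma>"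
  unfolding av_def using weight_pos cl_subset[of U \<sigma>] mass_pos[of \<sigma> U]
  by (intro divide_right_mono sum_mono mult_left_mono) (auto intro!: less_imp_le)

lemma av_cong:
  "(\<And>\<rho>. \<rho> \<in> cl U \<sigma> \<Longrightarrow> f \<rho> = g \<rho>) \<Longrightarrow> av U f \<sigma> = av U g \<sigma>"
  unfolding av_def by (intro arg_cong2[where f = "(/)"] sum.cong) auto

lemma av_add: "av U (\<lambda>\<rho>. f \<rho> + g \<rho>) \<sigma> = av U f \<sigma> + av U g \<sigma>"
  by (simp add: av_def algebra_simps sum.distrib add_divide_distrib)

lemma av_diff: "av U (\<lambda>\<rho>. f \<rho> - g \<rho>) \<sigma> = av U f \<sigma> - av U g \<sigma>"
  by (simp add: av_def algebra_simps sum_subtractf diff_divide_distrib)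

lemma av_cmult: "av U (\<lambda>\<rho>. c * f \<rho>) \<sigma> = c * av U f \<sigma>"
  by (simp add: av_def sum_distrib_left algebra_simps)

lemma av_const: "\<sigma> \<in> \<Omega> \<Longrightarrow> av U (\<lambda>_. c) \<sigma> = c"
  using mass_pos[of \<sigma> U] by (simp add: av_def mass_def flip: sum_distrib_right)

lemma av_local_mult:
  assumes "\<And>\<rho>. \<rho> \<in> cl U \<sigma> \<Longrightarrow> g \<rho> = g \<sigma>"
  shows "av U (\<lambda>\<rho>. g \<rho> * f \<rho>) \<sigma> = g \<sigma> * av U f \<sigma>"
  by (subst av_cmult[symmetric], rule av_cong) (simp add: assms)

lemma av_local:
  assumes "\<sigma> \<in> \<Omega>" "\<And>\<rho>. \<rho> \<in> cl U \<sigma> \<Longrightarrow> g \<rho> = g \<sigma>"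
  shows "av U g \<sigma> = g \<sigma>"
  using av_local_mult[of U \<sigma> g "\<lambda>_. 1"] assms by (simp add: av_const)

text \<open>Both sides are sums over pairs of configurations in a common class with the kernel
  \<open>w \<sigma> * w \<rho> / mass U \<sigma>\<close>, which is symmetric because the mass is the
  same throughout a class.\<close>

lemma sum_av_adjoint:
  "(\<Sum>\<sigma>\<in>\<Omega>. w \<sigma> * (av U f \<sigma> * g \<sigma>)) = (\<Sum>\<sigma>\<in>\<Omega>. w \<sigma> * (f \<sigma> * av U g \<sigma>))"
proof -
  have lhs: "(\<Sum>\<sigma>\<in>\<Omega>. w \<sigma> * (av U f \<sigma> * g \<sigma>)) =
     (\<Sum>\<sigma>\<in>\<Omega>. \<Sum>\<rho>\<in>\<Omega>. if \<rho> \<in> cl U \<sigma> then w \<sigma> * w \<rho> * f \<rho> * g \<sigma> / mass U \<sigma> else 0)"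
    for f g
  proof (rule sum.cong[OF refl])
    fix \<sigma> assume "\<sigma> \<in> \<Omega>"
    have "(\<Sum>\<rho>\<in>\<Omega>. if \<rho> \<in> cl U \<sigma> then w \<sigma> * w \<rho> * f \<rho> * g \<sigma> / mass U \<sigma> else 0) =
      (\<Sum>\<rho>\<in>cl U \<sigma>. w \<sigma> * w \<rho> * f \<rho> * g \<sigma> / mass U \<sigma>)"
      using finite_configs cl_subset[of U \<sigma>] by (simp add: sum.If_cases inf.absorb2)
    also have "\<dots> = w \<sigma> * (av U f \<sigma> * g \<sigma>)"
      by (simp add: av_def sum_distrib_left sum_distrib_right sum_divide_distrib mult_ac)
    finally show "w \<sigma> * (av U f \<sigma> * g \<sigma>) =
      (\<Sum>\<rho>\<in>\<Omega>. if \<rho> \<in> cl U \<sigma> then w \<sigma> * w \<rho> * f \<rho> * g \<sigma> / mass U \<sigma> else 0)" ..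
  qed
  have "(\<Sum>\<sigma>\<in>\<Omega>. w \<sigma> * (av U f \<sigma> * g \<sigma>)) =
     (\<Sum>\<rho>\<in>\<Omega>. \<Sum>\<sigma>\<in>\<Omega>. if \<rho> \<in> cl U \<sigma> then w \<sigma> * w \<rho> * f \<rho> * g \<sigma> / mass U \<sigma> else 0)"
    unfolding lhs by (rule sum.swap)
  also have "\<dots> = (\<Sum>\<rho>\<in>\<Omega>. \<Sum>\<sigma>\<in>\<Omega>. if \<sigma> \<in> cl U \<rho> then w \<rho> * w \<sigma> * g \<sigma> * f \<rho> / mass U \<rho> else 0)"
    by (intro sum.cong refl) (auto simp: mass_eq cl_sym dest: cl_sym)
  also have "\<dots> = (\<Sum>\<rho>\<in>\<Omega>. w \<rho> * (av U g \<rho> * f \<rho>))"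
    unfolding lhs ..
  finally show ?thesis by (simp add: mult_ac)
qed

lemma sum_av: "(\<Sum>\<sigma>\<in>\<Omega>. w \<sigma> * av U f \<sigma>) = (\<Sum>\<sigma>\<in>\<Omega>. w \<sigma> * f \<sigma>)"
proof -
  have "(\<Sum>\<sigma>\<in>\<Omega>. w \<sigma> * av U f \<sigma>) = (\<Sum>\<sigma>\<in>\<Omega>. w \<sigma> * (f \<sigma> * av U (\<lambda>_. 1) \<sigma>))"
    using sum_av_adjoint[of U f "\<lambda>_. 1"] by simp
  also have "\<dots> = (\<Sum>\<sigma>\<in>\<Omega>. w \<sigma> * f \<sigma>)"
    by (intro sum.cong) (auto simp: av_const)
  finally show ?thesis .
qed

lemma sum_av_mult_local:
  assumes "\<And>\<sigma> \<rho>. \<sigma> \<in> \<Omega> \<Longrightarrow> \<rho> \<in> cl U \<sigma> \<Longrightarrow> g \<rho> = g \<sigma>"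
  shows "(\<Sum>\<sigma>\<in>\<Omega>. w \<sigma> * (av U f \<sigma> * g \<sigma>)) = (\<Sum>\<sigma>\<in>\<Omega>. w \<sigma> * (f \<sigma> * g \<sigma>))"
  unfolding sum_av_adjoint using assms by (intro sum.cong refl) (simp add: av_local)

text \<open>The weights are not normalized, so each class is again a space of this kind. The tower
  property \<open>av_av\<close> is then \<open>sum_av\<close> inside one class of the larger
  block.\<close>

lemma weighted_configs_cl: "weighted_configs (cl U \<sigma>) w"
  by unfold_locales (use weight_pos cl_subset in auto)

lemma av_av:
  assumes "A \<subseteq> U" "\<sigma> \<in> \<Omega>"
  shows "av U (av A f) \<sigma> = av U f \<sigma>"
proof -
  interpret C: weighted_configs "cl U \<sigma>" w by (rule weighted_configs_cl)
  have cl: "C.cl A \<rho> = cl A \<rho>" if "\<rho> \<in> cl U \<sigma>" for \<rho>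
    using that assms(1) unfolding C.cl_def by (auto simp: cl_def)
  have av: "C.av A f \<rho> = av A f \<rho>" if "\<rho> \<in> cl U \<sigma>" for \<rho>
    using that by (simp add: C.av_def av_def C.mass_def mass_def cl)
  have "(\<Sum>\<rho>\<in>cl U \<sigma>. w \<rho> * av A f \<rho>) = (\<Sum>\<rho>\<in>cl U \<sigma>. w \<rho> * C.av A f \<rho>)"
    by (intro sum.cong) (auto simp: av)
  then show ?thesis
    unfolding av_def[of U] C.sum_av by simp
qed

text \<open>The logarithm splits at \<open>av A f\<close>. Its second part is constant on the
  classes of \<open>A\<close>, so there \<open>f\<close> may be exchanged for \<open>av A f\<close>,
  and the tower property identifies the means over \<open>U\<close>.\<close>

lemma cond_ent_chain:
  assumes f: "\<And>\<sigma>. \<sigma> \<in> \<Omega> \<Longrightarrow> f \<sigma> > 0" and "A \<subseteq> U"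
  shows "cond_ent U f = cond_ent A f + cond_ent U (av A f)"
proof -
  have pos: "av U f \<sigma> > 0" if "\<sigma> \<in> \<Omega>" for U \<sigma>
    using f that by (intro av_pos) auto
  have loc: "ln (av A f \<rho> / av U f \<rho>) = ln (av A f \<sigma> / av U f \<sigma>)" if "\<rho> \<in> cl A \<sigma>" for \<sigma> \<rho>
    using that cl_mono[OF \<open>A \<subseteq> U\<close>] av_eq by (metis subsetD)
  have "cond_ent U (av A f) = (\<Sum>\<sigma>\<in>\<Omega>. w \<sigma> * (av A f \<sigma> * ln (av A f \<sigma> / av U f \<sigma>)))"
    unfolding cond_ent_def using assms by (intro sum.cong refl) (simp add: av_av)
  also have "\<dots> = (\<Sum>\<sigma>\<in>\<Omega>. w \<sigma> * (f \<sigma> * ln (av A f \<sigma> / av U f \<sigma>)))"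
    by (rule sum_av_mult_local) (rule loc)
  finally have 1: "cond_ent U (av A f) = \<dots>" .
  show ?thesis
    unfolding 1 unfolding cond_ent_def sum.distrib[symmetric]
  proof (intro sum.cong refl)
    fix \<sigma> assume "\<sigma> \<in> \<Omega>"
    then have "ln (f \<sigma> / av U f \<sigma>) = ln (f \<sigma> / av A f \<sigma>) + ln (av A f \<sigma> / av U f \<sigma>)"
      using f pos by (simp add: ln_div less_imp_neq[symmetric])
    then show "w \<sigma> * (f \<sigma> * ln (f \<sigma> / av U f \<sigma>)) =
      w \<sigma> * (f \<sigma> * ln (f \<sigma> / av A f \<sigma>)) + w \<sigma> * (f \<sigma> * ln (av A f \<sigma> / av U f \<sigma>))"
      by (simp add: distrib_left)
  qed
qed

section \<open>Pinsker type inequalities\<close>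

lemma cond_ent_eq_sum_av:
  "cond_ent U f = (\<Sum>\<sigma>\<in>\<Omega>. w \<sigma> * av U (\<lambda>\<rho>. f \<rho> * ln (f \<rho> / av U f \<rho>)) \<sigma>)"
  by (simp add: sum_av cond_ent_def)

text \<open>Average \<open>sqrt_diff_power2_le_mult_ln\<close> with the mean of the class for
  \<open>y\<close>; the remaining term \<open>\<phi> - g \<rho>\<close> has mean zero.\<close>

lemma av_hellinger_le:
  assumes g: "\<And>\<sigma>. \<sigma> \<in> \<Omega> \<Longrightarrow> g \<sigma> > 0" and \<sigma>: "\<sigma> \<in> \<Omega>"
  shows "av U (\<lambda>\<rho>. (sqrt (g \<rho>) - sqrt (av U g \<sigma>))\<^sup>2) \<sigma>
    \<le> av U (\<lambda>\<rho>. g \<rho> * ln (g \<rho> / av U g \<rho>)) \<sigma>"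
proof -
  define \<phi> where "\<phi> = av U g \<sigma>"
  have \<phi>: "\<phi> > 0" unfolding \<phi>_def using g \<sigma> by (rule av_pos[rotated])
  have gp: "g \<rho> > 0" if "\<rho> \<in> cl U \<sigma>" for \<rho> using g that cl_subset by blast
  have "av U (\<lambda>\<rho>. (sqrt (g \<rho>) - sqrt \<phi>)\<^sup>2) \<sigma> =
      av U (\<lambda>\<rho>. (2 * g \<rho> - 2 * sqrt (g \<rho> * \<phi>)) + (\<phi> - g \<rho>)) \<sigma>"
    using gp \<phi> by (intro av_cong) (simp add: power2_diff real_sqrt_mult less_imp_le)
  also have "\<dots> = av U (\<lambda>\<rho>. 2 * g \<rho> - 2 * sqrt (g \<rho> * \<phi>)) \<sigma> + (\<phi> - \<phi>)"
    unfolding av_add av_diff using \<sigma> by (simp add: av_const \<phi>_def)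
  also have "\<dots> \<le> av U (\<lambda>\<rho>. g \<rho> * ln (g \<rho> / \<phi>)) \<sigma>"
    using gp \<phi> by (simp, intro av_mono \<sigma> sqrt_diff_power2_le_mult_ln) auto
  also have "\<dots> = av U (\<lambda>\<rho>. g \<rho> * ln (g \<rho> / av U g \<rho>)) \<sigma>"
    by (rule av_cong) (simp add: av_eq \<phi>_def)
  finally show ?thesis by (simp add: \<phi>_def)
qed

text \<open>Factor \<open>g - \<phi>\<close> into the difference and the sum of the square roots and
  use Cauchy-Schwarz. The difference gives the Hellinger term, and the sum has mean square at most
  \<open>4 * \<phi>\<close>.\<close>

lemma abs_dev_power2_le:
  assumes g: "\<And>\<sigma>. \<sigma> \<in> \<Omega> \<Longrightarrow> g \<sigma> > 0" and \<sigma>: "\<sigma> \<in> \<Omega>"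
  shows "(av U (\<lambda>\<rho>. \<bar>g \<rho> - av U g \<rho>\<bar>) \<sigma>)\<^sup>2
    \<le> 4 * av U g \<sigma> * av U (\<lambda>\<rho>. g \<rho> * ln (g \<rho> / av U g \<rho>)) \<sigma>"
proof -
  define \<phi> where "\<phi> = av U g \<sigma>"
  have \<phi>: "\<phi> > 0" unfolding \<phi>_def using g \<sigma> by (rule av_pos[rotated])
  define m where "m = mass U \<sigma>"
  have m: "m > 0" unfolding m_def using \<sigma> by (rule mass_pos)
  have sum_av: "(\<Sum>\<rho>\<in>cl U \<sigma>. w \<rho> * h \<rho>) = m * av U h \<sigma>" for h
    using m by (simp add: av_def m_def)
  have pos: "w \<rho> > 0" "g \<rho> > 0" if "\<rho> \<in> cl U \<sigma>" for \<rho>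
    using g[of \<rho>] weight_pos[of \<rho>] subsetD[OF cl_subset that] by auto
  have abs: "w \<rho> * \<bar>g \<rho> - \<phi>\<bar> = (sqrt (w \<rho>) * \<bar>sqrt (g \<rho>) - sqrt \<phi>\<bar>) * (sqrt (w \<rho>) * (sqrt (g \<rho>) + sqrt \<phi>))"
    if "\<rho> \<in> cl U \<sigma>" for \<rho>
  proof -
    have "g \<rho> - \<phi> = (sqrt (g \<rho>) - sqrt \<phi>) * (sqrt (g \<rho>) + sqrt \<phi>)"
      using pos[OF that] \<phi> by (simp add: algebra_simps)
    then have "\<bar>g \<rho> - \<phi>\<bar> = \<bar>sqrt (g \<rho>) - sqrt \<phi>\<bar> * (sqrt (g \<rho>) + sqrt \<phi>)"
      using pos[OF that] \<phi> by (simp add: abs_mult)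
    moreover have "w \<rho> = sqrt (w \<rho>) * sqrt (w \<rho>)" using pos[OF that] by simp
    ultimately show ?thesis by (metis mult.assoc mult.commute)
  qed
  have "(m * av U (\<lambda>\<rho>. \<bar>g \<rho> - \<phi>\<bar>) \<sigma>)\<^sup>2 =
      (\<Sum>\<rho>\<in>cl U \<sigma>. (sqrt (w \<rho>) * \<bar>sqrt (g \<rho>) - sqrt \<phi>\<bar>) * (sqrt (w \<rho>) * (sqrt (g \<rho>) + sqrt \<phi>)))\<^sup>2"
    unfolding sum_av[symmetric] by (simp add: abs)
  also have "\<dots> \<le> (\<Sum>\<rho>\<in>cl U \<sigma>. (sqrt (w \<rho>) * \<bar>sqrt (g \<rho>) - sqrt \<phi>\<bar>)\<^sup>2) *
      (\<Sum>\<rho>\<in>cl U \<sigma>. (sqrt (w \<rho>) * (sqrt (g \<rho>) + sqrt \<phi>))\<^sup>2)"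
    by (rule Cauchy_Schwarz_ineq_sum)
  also have "\<dots> = (m * av U (\<lambda>\<rho>. (sqrt (g \<rho>) - sqrt \<phi>)\<^sup>2) \<sigma>) * (m * av U (\<lambda>\<rho>. (sqrt (g \<rho>) + sqrt \<phi>)\<^sup>2) \<sigma>)"
    unfolding sum_av[symmetric] using pos
    by (intro arg_cong2[where f = "(*)"] sum.cong) (simp_all add: power_mult_distrib less_imp_le)
  also have "av U (\<lambda>\<rho>. (sqrt (g \<rho>) + sqrt \<phi>)\<^sup>2) \<sigma> \<le> av U (\<lambda>\<rho>. 2 * (g \<rho> + \<phi>)) \<sigma>"
  proof (rule av_mono[OF \<sigma>])
    fix \<rho> assume "\<rho> \<in> cl U \<sigma>"
    then show "(sqrt (g \<rho>) + sqrt \<phi>)\<^sup>2 \<le> 2 * (g \<rho> + \<phi>)"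
      using sum_squares_bound[of "sqrt (g \<rho>)" "sqrt \<phi>"] pos[of \<rho>] \<phi> by (simp add: power2_sum)
  qed
  also have "\<dots> = 4 * \<phi>" unfolding av_cmult av_add using \<sigma> by (simp add: av_const \<phi>_def)
  also have "av U (\<lambda>\<rho>. (sqrt (g \<rho>) - sqrt \<phi>)\<^sup>2) \<sigma> \<le> av U (\<lambda>\<rho>. g \<rho> * ln (g \<rho> / av U g \<rho>)) \<sigma>"
    unfolding \<phi>_def using g \<sigma> by (rule av_hellinger_le)
  finally have "(m * av U (\<lambda>\<rho>. \<bar>g \<rho> - \<phi>\<bar>) \<sigma>)\<^sup>2 \<le>
      (m * av U (\<lambda>\<rho>. g \<rho> * ln (g \<rho> / av U g \<rho>)) \<sigma>) * (m * (4 * \<phi>))"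
    using m \<phi> by (simp add: mult_left_mono mult_right_mono av_nonneg \<sigma>)
  then have "m\<^sup>2 * (av U (\<lambda>\<rho>. \<bar>g \<rho> - \<phi>\<bar>) \<sigma>)\<^sup>2 \<le> m\<^sup>2 * (4 * \<phi> * av U (\<lambda>\<rho>. g \<rho> * ln (g \<rho> / av U g \<rho>)) \<sigma>)"
    by (simp add: power_mult_distrib power2_eq_square mult_ac)
  moreover have "av U (\<lambda>\<rho>. \<bar>g \<rho> - av U g \<rho>\<bar>) \<sigma> = av U (\<lambda>\<rho>. \<bar>g \<rho> - \<phi>\<bar>) \<sigma>"
    by (rule av_cong) (simp add: av_eq \<phi>_def)
  ultimately show ?thesis using m by (simp add: \<phi>_def)
qed

lemma av_ent_nonneg:
  assumes g: "\<And>\<sigma>. \<sigma> \<in> \<Omega> \<Longrightarrow> g \<sigma> > 0" and \<sigma>: "\<sigma> \<in> \<Omega>"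
  shows "av U (\<lambda>\<rho>. g \<rho> * ln (g \<rho> / av U g \<rho>)) \<sigma> \<ge> 0"
proof -
  have "av U (\<lambda>\<rho>. g \<rho> - av U g \<rho>) \<sigma> \<le> av U (\<lambda>\<rho>. g \<rho> * ln (g \<rho> / av U g \<rho>)) \<sigma>"
    using g cl_subset by (intro av_mono \<sigma> mult_ln_div_ge av_pos) auto
  moreover have "av U (\<lambda>\<rho>. g \<rho> - av U g \<rho>) \<sigma> = 0"
    using \<sigma> by (simp add: av_diff av_av)
  ultimately show ?thesis by simp
qed

lemma cond_ent_nonneg: "(\<And>\<sigma>. \<sigma> \<in> \<Omega> \<Longrightarrow> f \<sigma> > 0) \<Longrightarrow> cond_ent U f \<ge> 0"
  unfolding cond_ent_eq_sum_av using weight_pos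
  by (intro sum_nonneg mult_nonneg_nonneg av_ent_nonneg) (auto intro: less_imp_le)

text \<open>The test functions \<open>u\<close> do not depend on the spins in \<open>A\<close> and
  are centred on every class of \<open>U\<close>; their conditional means given the spins outside
  \<open>B\<close> have to be uniformly small against their L1 norm. With \<open>A = U - S\<close>
  this compares the spins on \<open>S\<close> with those on \<open>U - B\<close>.\<close>

definition nearly_indep :: "'a set \<Rightarrow> 'a set \<Rightarrow> 'a set \<Rightarrow> real \<Rightarrow> bool" where
  "nearly_indep U A B \<epsilon> \<longleftrightarrow> (\<forall>u \<sigma>. \<sigma> \<in> \<Omega> \<longrightarrow> (\<forall>\<tau>\<in>\<Omega>. \<forall>\<rho>\<in>cl A \<tau>. u \<rho> = u \<tau>) \<longrightarrow>
     (\<forall>\<tau>\<in>\<Omega>. av U u \<tau> = 0) \<longrightarrow> \<bar>av B u \<sigma>\<bar> \<le> \<epsilon> * av U (\<lambda>\<rho>. \<bar>u \<rho>\<bar>) \<sigma>)"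

text \<open>
  With \<open>g = av A f\<close>, \<open>h = av B f\<close> and \<open>\<phi> = av U f\<close>, comparing \<open>f\<close> with \<open>g h / \<phi>\<close> loses only the
  covariance of \<open>g\<close> and \<open>h\<close>. Near independence bounds it by \<open>\<epsilon>\<close> times a product of \<open>L\<^sup>1\<close> deviations,
  and by a Pinsker type inequality that product is controlled by the entropies of \<open>g\<close> and \<open>h\<close>.
\<close>

lemma cond_ent_superadd:
  assumes f: "\<And>\<sigma>. \<sigma> \<in> \<Omega> \<Longrightarrow> f \<sigma> > 0" and "A \<subseteq> U" "B \<subseteq> U"
    and ni: "nearly_indep U A B \<epsilon>" and "\<epsilon> \<ge> 0"
  shows "(1 - 2 * \<epsilon>) * (cond_ent U (av A f) + cond_ent U (av B f)) \<le> cond_ent U f"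
proof -
  define g h \<phi> where "g = av A f" and "h = av B f" and "\<phi> = av U f"
  have pos: "g \<sigma> > 0" "h \<sigma> > 0" "\<phi> \<sigma> > 0" if "\<sigma> \<in> \<Omega>" for \<sigma>
    using that f by (simp_all add: g_def h_def \<phi>_def av_pos)
  have avg: "av U g \<sigma> = \<phi> \<sigma>" "av U h \<sigma> = \<phi> \<sigma>" "av U \<phi> \<sigma> = \<phi> \<sigma>" if "\<sigma> \<in> \<Omega>" for \<sigma>
    using that assms by (simp_all add: g_def h_def \<phi>_def av_av)
  have \<phi>loc: "\<phi> \<rho> = \<phi> \<sigma>" if "\<rho> \<in> cl U \<sigma>" for \<rho> \<sigma>
    using that by (simp add: \<phi>_def av_eq)
  have gloc: "g \<rho> = g \<sigma>" if "\<rho> \<in> cl A \<sigma>" for \<rho> \<sigma>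
    using that by (simp add: g_def av_eq)
  have hloc: "h \<rho> = h \<sigma>" if "\<rho> \<in> cl B \<sigma>" for \<rho> \<sigma>
    using that by (simp add: h_def av_eq)
  define eg eh where "eg = av U (\<lambda>\<rho>. g \<rho> * ln (g \<rho> / av U g \<rho>))"
    and "eh = av U (\<lambda>\<rho>. h \<rho> * ln (h \<rho> / av U h \<rho>))"
  define dg dh where "dg = av U (\<lambda>\<rho>. \<bar>g \<rho> - \<phi> \<rho>\<bar>)" and "dh = av U (\<lambda>\<rho>. \<bar>h \<rho> - \<phi> \<rho>\<bar>)"
  have e0: "eg \<sigma> \<ge> 0" "eh \<sigma> \<ge> 0" if "\<sigma> \<in> \<Omega>" for \<sigma>
    using that pos by (auto simp: eg_def eh_def intro!: av_ent_nonneg)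
  have d0: "dg \<sigma> \<ge> 0" "dh \<sigma> \<ge> 0" if "\<sigma> \<in> \<Omega>" for \<sigma>
    using that by (auto simp: dg_def dh_def intro!: av_nonneg)
  have d2: "(dg \<sigma>)\<^sup>2 \<le> 4 * \<phi> \<sigma> * eg \<sigma>" "(dh \<sigma>)\<^sup>2 \<le> 4 * \<phi> \<sigma> * eh \<sigma>" if \<sigma>: "\<sigma> \<in> \<Omega>" for \<sigma>
  proof -
    have "dg \<sigma> = av U (\<lambda>\<rho>. \<bar>g \<rho> - av U g \<rho>\<bar>) \<sigma>" "dh \<sigma> = av U (\<lambda>\<rho>. \<bar>h \<rho> - av U h \<rho>\<bar>) \<sigma>"
      unfolding dg_def dh_def using subsetD[OF cl_subset] by (auto intro!: av_cong simp: avg)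
    then show "(dg \<sigma>)\<^sup>2 \<le> 4 * \<phi> \<sigma> * eg \<sigma>" "(dh \<sigma>)\<^sup>2 \<le> 4 * \<phi> \<sigma> * eh \<sigma>"
      using abs_dev_power2_le[of g \<sigma> U] abs_dev_power2_le[of h \<sigma> U] pos \<sigma>
      by (simp_all add: avg eg_def eh_def)
  qed
  have prod: "dg \<sigma> * dh \<sigma> / \<phi> \<sigma> \<le> 2 * (eg \<sigma> + eh \<sigma>)" if \<sigma>: "\<sigma> \<in> \<Omega>" for \<sigma>
  proof -
    have "2 * (dg \<sigma> * dh \<sigma>) \<le> (dg \<sigma>)\<^sup>2 + (dh \<sigma>)\<^sup>2"
      using sum_squares_bound[of "dg \<sigma>" "dh \<sigma>"] by simp
    also have "\<dots> \<le> 4 * \<phi> \<sigma> * (eg \<sigma> + eh \<sigma>)"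
      using d2[OF \<sigma>] by (simp add: algebra_simps)
    finally show ?thesis using pos[OF \<sigma>] by (simp add: field_simps)
  qed
  have cov: "(\<Sum>\<sigma>\<in>\<Omega>. w \<sigma> * ((g \<sigma> - \<phi> \<sigma>) * ((h \<sigma> - \<phi> \<sigma>) / \<phi> \<sigma>)))
      \<le> \<epsilon> * (\<Sum>\<sigma>\<in>\<Omega>. w \<sigma> * (2 * (eg \<sigma> + eh \<sigma>)))"
  proof -
    \<comment> \<open>The quotient of \<open>h - \<phi>\<close> by \<open>\<phi>\<close> does not
      depend on the spins in \<open>B\<close>, so \<open>u\<close> may be averaged over
      \<open>B\<close>, where near independence applies. The deviation of \<open>h\<close> is
      averaged over \<open>U\<close> afterwards.\<close>
    define u where "u = (\<lambda>\<sigma>. g \<sigma> - \<phi> \<sigma>)"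
    have u1: "\<bar>av B u \<sigma>\<bar> \<le> \<epsilon> * dg \<sigma>" if "\<sigma> \<in> \<Omega>" for \<sigma>
    proof -
      have "\<forall>\<tau>\<in>\<Omega>. \<forall>\<rho>\<in>cl A \<tau>. u \<rho> = u \<tau>"
        using cl_mono[OF \<open>A \<subseteq> U\<close>] by (auto simp: u_def gloc intro: \<phi>loc)
      moreover have "\<forall>\<tau>\<in>\<Omega>. av U u \<tau> = 0"
        by (auto simp: u_def av_diff avg)
      ultimately have "\<bar>av B u \<sigma>\<bar> \<le> \<epsilon> * av U (\<lambda>\<rho>. \<bar>u \<rho>\<bar>) \<sigma>"
        using ni that unfolding nearly_indep_def by presburger
      then show ?thesis by (simp add: dg_def u_def)
    qed
    have hl: "(h \<rho> - \<phi> \<rho>) / \<phi> \<rho> = (h \<sigma> - \<phi> \<sigma>) / \<phi> \<sigma>" if "\<rho> \<in> cl B \<sigma>" for \<rho> \<sigma>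
      using that cl_mono[OF \<open>B \<subseteq> U\<close>] hloc \<phi>loc by (metis subsetD)
    have "(\<Sum>\<sigma>\<in>\<Omega>. w \<sigma> * (u \<sigma> * ((h \<sigma> - \<phi> \<sigma>) / \<phi> \<sigma>)))
        = (\<Sum>\<sigma>\<in>\<Omega>. w \<sigma> * (av B u \<sigma> * ((h \<sigma> - \<phi> \<sigma>) / \<phi> \<sigma>)))"
      by (rule sum_av_mult_local[symmetric]) (rule hl)
    also have "\<dots> \<le> (\<Sum>\<sigma>\<in>\<Omega>. w \<sigma> * ((\<epsilon> * dg \<sigma>) * (\<bar>h \<sigma> - \<phi> \<sigma>\<bar> / \<phi> \<sigma>)))"
    proof (intro sum_mono mult_left_mono)
      fix \<sigma> assume \<sigma>: "\<sigma> \<in> \<Omega>"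
      have "av B u \<sigma> * ((h \<sigma> - \<phi> \<sigma>) / \<phi> \<sigma>) \<le> \<bar>av B u \<sigma>\<bar> * (\<bar>h \<sigma> - \<phi> \<sigma>\<bar> / \<phi> \<sigma>)"
        using pos[OF \<sigma>] abs_ge_self[of "av B u \<sigma> * ((h \<sigma> - \<phi> \<sigma>) / \<phi> \<sigma>)"] by (simp add: abs_mult)
      also have "\<dots> \<le> (\<epsilon> * dg \<sigma>) * (\<bar>h \<sigma> - \<phi> \<sigma>\<bar> / \<phi> \<sigma>)"
        using pos[OF \<sigma>] u1[OF \<sigma>] by (intro mult_right_mono) auto
      finally show "av B u \<sigma> * ((h \<sigma> - \<phi> \<sigma>) / \<phi> \<sigma>) \<le> (\<epsilon> * dg \<sigma>) * (\<bar>h \<sigma> - \<phi> \<sigma>\<bar> / \<phi> \<sigma>)" .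
    qed (use weight_pos in \<open>auto intro: less_imp_le\<close>)
    also have "\<dots> = (\<Sum>\<sigma>\<in>\<Omega>. w \<sigma> * (\<bar>h \<sigma> - \<phi> \<sigma>\<bar> * (\<epsilon> * (dg \<sigma> / \<phi> \<sigma>))))"
      by (intro sum.cong) (auto simp: field_simps)
    also have "\<dots> = (\<Sum>\<sigma>\<in>\<Omega>. w \<sigma> * (dh \<sigma> * (\<epsilon> * (dg \<sigma> / \<phi> \<sigma>))))"
      unfolding dh_def
      by (rule sum_av_mult_local[symmetric]) (simp add: \<phi>loc dg_def av_eq)
    also have "\<dots> = (\<Sum>\<sigma>\<in>\<Omega>. \<epsilon> * (w \<sigma> * (dg \<sigma> * dh \<sigma> / \<phi> \<sigma>)))"
      by (intro sum.cong) (auto simp: field_simps)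
    also have "\<dots> \<le> (\<Sum>\<sigma>\<in>\<Omega>. \<epsilon> * (w \<sigma> * (2 * (eg \<sigma> + eh \<sigma>))))"
      using \<open>\<epsilon> \<ge> 0\<close> weight_pos prod
      by (intro sum_mono mult_left_mono) (auto intro: less_imp_le)
    finally show ?thesis by (simp add: u_def sum_distrib_left)
  qed
  have ent: "cond_ent U g = (\<Sum>\<sigma>\<in>\<Omega>. w \<sigma> * eg \<sigma>)" "cond_ent U h = (\<Sum>\<sigma>\<in>\<Omega>. w \<sigma> * eh \<sigma>)"
    by (simp_all add: cond_ent_eq_sum_av eg_def eh_def)
  have "cond_ent U g = (\<Sum>\<sigma>\<in>\<Omega>. w \<sigma> * (g \<sigma> * ln (g \<sigma> / \<phi> \<sigma>)))"
    "cond_ent U h = (\<Sum>\<sigma>\<in>\<Omega>. w \<sigma> * (h \<sigma> * ln (h \<sigma> / \<phi> \<sigma>)))"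
    by (auto simp: cond_ent_def avg)
  moreover have "(\<Sum>\<sigma>\<in>\<Omega>. w \<sigma> * (g \<sigma> * ln (g \<sigma> / \<phi> \<sigma>))) = (\<Sum>\<sigma>\<in>\<Omega>. w \<sigma> * (f \<sigma> * ln (g \<sigma> / \<phi> \<sigma>)))"
    unfolding g_def[abs_def]
    by (rule sum_av_mult_local) (use gloc \<phi>loc cl_mono[OF \<open>A \<subseteq> U\<close>] in \<open>metis g_def subsetD\<close>)
  moreover have "(\<Sum>\<sigma>\<in>\<Omega>. w \<sigma> * (h \<sigma> * ln (h \<sigma> / \<phi> \<sigma>))) = (\<Sum>\<sigma>\<in>\<Omega>. w \<sigma> * (f \<sigma> * ln (h \<sigma> / \<phi> \<sigma>)))"
    unfolding h_def[abs_def]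
    by (rule sum_av_mult_local) (use hloc \<phi>loc cl_mono[OF \<open>B \<subseteq> U\<close>] in \<open>metis h_def subsetD\<close>)
  ultimately have "cond_ent U f - cond_ent U g - cond_ent U h =
      (\<Sum>\<sigma>\<in>\<Omega>. w \<sigma> * (f \<sigma> * ln (f \<sigma> / \<phi> \<sigma>)) - w \<sigma> * (f \<sigma> * ln (g \<sigma> / \<phi> \<sigma>))
         - w \<sigma> * (f \<sigma> * ln (h \<sigma> / \<phi> \<sigma>)))"
    by (simp add: cond_ent_def \<phi>_def sum_subtractf)
  also have "\<dots> = (\<Sum>\<sigma>\<in>\<Omega>. w \<sigma> * (f \<sigma> * ln (f \<sigma> / (g \<sigma> * h \<sigma> / \<phi> \<sigma>))))"
  proof (intro sum.cong refl)
    fix \<sigma> assume \<sigma>: "\<sigma> \<in> \<Omega>"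
    have "ln (f \<sigma> / \<phi> \<sigma>) - ln (g \<sigma> / \<phi> \<sigma>) - ln (h \<sigma> / \<phi> \<sigma>) = ln (f \<sigma> / (g \<sigma> * h \<sigma> / \<phi> \<sigma>))"
      using pos[OF \<sigma>] f[OF \<sigma>] by (simp add: ln_div ln_mult)
    then show "w \<sigma> * (f \<sigma> * ln (f \<sigma> / \<phi> \<sigma>)) - w \<sigma> * (f \<sigma> * ln (g \<sigma> / \<phi> \<sigma>))
         - w \<sigma> * (f \<sigma> * ln (h \<sigma> / \<phi> \<sigma>)) = w \<sigma> * (f \<sigma> * ln (f \<sigma> / (g \<sigma> * h \<sigma> / \<phi> \<sigma>)))"
      by (metis right_diff_distrib)
  qed
  also have "\<dots> \<ge> (\<Sum>\<sigma>\<in>\<Omega>. w \<sigma> * (f \<sigma> - g \<sigma> * h \<sigma> / \<phi> \<sigma>))"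
    using pos f weight_pos by (intro sum_mono mult_left_mono mult_ln_div_ge) (auto intro: less_imp_le)
  also have "(\<Sum>\<sigma>\<in>\<Omega>. w \<sigma> * (f \<sigma> - g \<sigma> * h \<sigma> / \<phi> \<sigma>)) =
      - (\<Sum>\<sigma>\<in>\<Omega>. w \<sigma> * ((g \<sigma> - \<phi> \<sigma>) * ((h \<sigma> - \<phi> \<sigma>) / \<phi> \<sigma>)))"
  proof -
    have "(\<Sum>\<sigma>\<in>\<Omega>. w \<sigma> * ((g \<sigma> - \<phi> \<sigma>) * ((h \<sigma> - \<phi> \<sigma>) / \<phi> \<sigma>))) =
       (\<Sum>\<sigma>\<in>\<Omega>. w \<sigma> * (g \<sigma> * h \<sigma> / \<phi> \<sigma>) + w \<sigma> * \<phi> \<sigma> - w \<sigma> * g \<sigma> - w \<sigma> * h \<sigma>)"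
      using pos by (intro sum.cong refl) (auto simp: field_simps less_imp_neq[symmetric])
    also have "\<dots> = (\<Sum>\<sigma>\<in>\<Omega>. w \<sigma> * (g \<sigma> * h \<sigma> / \<phi> \<sigma>)) - (\<Sum>\<sigma>\<in>\<Omega>. w \<sigma> * f \<sigma>)"
      by (simp add: sum.distrib sum_subtractf) (simp add: g_def h_def \<phi>_def sum_av)
    finally show ?thesis by (simp add: right_diff_distrib sum_subtractf)
  qed
  finally have "cond_ent U f - cond_ent U g - cond_ent U h \<ge>
      - (\<epsilon> * (\<Sum>\<sigma>\<in>\<Omega>. w \<sigma> * (2 * (eg \<sigma> + eh \<sigma>))))"
    using cov by linarith
  also have "(\<Sum>\<sigma>\<in>\<Omega>. w \<sigma> * (2 * (eg \<sigma> + eh \<sigma>))) = 2 * (cond_ent U g + cond_ent U h)"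
    unfolding ent by (simp add: sum_distrib_left sum.distrib algebra_simps)
  finally show ?thesis
    by (simp add: g_def h_def algebra_simps)
qed

text \<open>By the chain rule, the left side of \<open>cond_ent_superadd\<close> involves twice the
  entropy on \<open>U\<close> minus those on \<open>A\<close> and \<open>B\<close>, and the linear
  inequality is solved for the entropy on \<open>U\<close>. The bound \<open>1 / 8\<close> makes
  \<open>(1 - 2 * \<epsilon>) / (1 - 4 * \<epsilon>)\<close> at most
  \<open>1 + 4 * \<epsilon>\<close>.\<close>

lemma cond_ent_factorization:
  assumes f: "\<And>\<sigma>. \<sigma> \<in> \<Omega> \<Longrightarrow> f \<sigma> > 0" and sub: "A \<subseteq> U" "B \<subseteq> U"
    and ni: "nearly_indep U A B \<epsilon>" and \<epsilon>: "0 \<le> \<epsilon>" "\<epsilon> \<le> 1 / 8"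
  shows "cond_ent U f \<le> (1 + 4 * \<epsilon>) * (cond_ent A f + cond_ent B f)"
proof -
  define X where "X = cond_ent U f"
  define Y where "Y = cond_ent A f + cond_ent B f"
  have "Y \<ge> 0" using f by (simp add: Y_def cond_ent_nonneg)
  have "cond_ent U (av A f) + cond_ent U (av B f) = 2 * X - Y"
    using cond_ent_chain[of f A U, OF f] cond_ent_chain[of f B U, OF f] sub by (simp add: X_def Y_def)
  then have "(1 - 2 * \<epsilon>) * (2 * X - Y) \<le> X"
    using cond_ent_superadd[of f A U B \<epsilon>, OF f sub ni \<epsilon>(1)] by (simp add: X_def)
  then have 1: "(1 - 4 * \<epsilon>) * X \<le> (1 - 2 * \<epsilon>) * Y" by (simp add: algebra_simps)
  have "(1 - 2 * \<epsilon>) \<le> (1 - 4 * \<epsilon>) * (1 + 4 * \<epsilon>)"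
    using \<epsilon> mult_mono[of \<epsilon> "1/8" \<epsilon> \<epsilon>] by (simp add: algebra_simps)
  then have "(1 - 2 * \<epsilon>) * Y \<le> (1 - 4 * \<epsilon>) * (1 + 4 * \<epsilon>) * Y"
    using \<open>Y \<ge> 0\<close> by (rule mult_right_mono)
  with 1 have "(1 - 4 * \<epsilon>) * X \<le> (1 - 4 * \<epsilon>) * ((1 + 4 * \<epsilon>) * Y)" by (simp add: mult.assoc)
  then show ?thesis using \<epsilon> by (simp add: X_def Y_def)
qed

text \<open>A mean over \<open>U\<close> is a mean of means over \<open>B\<close>, so for
  nonnegative \<open>u\<close> the two agree up to the factor \<open>\<theta>\<close>. A centred
  \<open>u\<close> is split into its positive and its negative part. Both have the same mean
  \<open>q\<close> over \<open>U\<close>, their means over \<open>B\<close> lie between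
  \<open>q / \<theta>\<close> and \<open>\<theta> * q\<close>, and the L1 norm of \<open>u\<close>
  is \<open>2 * q\<close>.\<close>

lemma nearly_indepI:
  assumes "A \<subseteq> U" "B \<subseteq> U" "\<theta> \<ge> 1"
    and ratio: "\<And>u \<sigma> \<rho>. (\<And>\<tau>. \<tau> \<in> \<Omega> \<Longrightarrow> u \<tau> \<ge> 0) \<Longrightarrow>
      (\<And>\<tau> \<rho>. \<tau> \<in> \<Omega> \<Longrightarrow> \<rho> \<in> cl A \<tau> \<Longrightarrow> u \<rho> = u \<tau>) \<Longrightarrow>
      \<sigma> \<in> \<Omega> \<Longrightarrow> \<rho> \<in> cl U \<sigma> \<Longrightarrow> av B u \<sigma> \<le> \<theta> * av B u \<rho>"
  shows "nearly_indep U A B (\<theta> - 1)"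
  unfolding nearly_indep_def
proof (intro allI impI)
  fix u \<sigma> assume \<sigma>: "\<sigma> \<in> \<Omega>" and loc: "\<forall>\<tau>\<in>\<Omega>. \<forall>\<rho>\<in>cl A \<tau>. u \<rho> = u \<tau>"
    and z: "\<forall>\<tau>\<in>\<Omega>. av U u \<tau> = 0"
  have bds: "av B v \<sigma> \<le> \<theta> * av U v \<sigma>" "av U v \<sigma> \<le> \<theta> * av B v \<sigma>"
    if v: "\<And>\<tau>. \<tau> \<in> \<Omega> \<Longrightarrow> v \<tau> \<ge> 0" "\<And>\<tau> \<rho>. \<tau> \<in> \<Omega> \<Longrightarrow> \<rho> \<in> cl A \<tau> \<Longrightarrow> v \<rho> = v \<tau>" for v
  proof -
    have "av U (\<lambda>_. av B v \<sigma>) \<sigma> \<le> av U (\<lambda>\<rho>. \<theta> * av B v \<rho>) \<sigma>"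
      using \<sigma> by (intro av_mono ratio[OF v]) auto
    then show "av B v \<sigma> \<le> \<theta> * av U v \<sigma>"
      using \<sigma> assms by (simp add: av_const av_cmult av_av)
    have "av U (av B v) \<sigma> \<le> av U (\<lambda>_. \<theta> * av B v \<sigma>) \<sigma>"
      using \<sigma> cl_subset by (intro av_mono ratio[OF v]) (auto dest: cl_sym)
    then show "av U v \<sigma> \<le> \<theta> * av B v \<sigma>"
      using \<sigma> assms by (simp add: av_const av_av)
  qed
  define p n where "p = (\<lambda>\<rho>. max (u \<rho>) 0)" and "n = (\<lambda>\<rho>. max (- u \<rho>) 0)"
  have u: "u = (\<lambda>\<rho>. p \<rho> - n \<rho>)" "(\<lambda>\<rho>. \<bar>u \<rho>\<bar>) = (\<lambda>\<rho>. p \<rho> + n \<rho>)"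
    by (auto simp: p_def n_def fun_eq_iff max_def)
  define q where "q = av U p \<sigma>"
  have qn: "av U n \<sigma> = q"
    using z \<sigma> by (subst (asm) u(1)) (auto simp: av_diff q_def)
  have pl: "p \<rho> = p \<tau>" "n \<rho> = n \<tau>" if "\<tau> \<in> \<Omega>" "\<rho> \<in> cl A \<tau>" for \<tau> \<rho>
    using loc that by (auto simp: p_def n_def)
  have bp: "av B p \<sigma> \<le> \<theta> * q" "q \<le> \<theta> * av B p \<sigma>"
    using bds[of p] pl by (auto simp: q_def p_def)
  have bn: "av B n \<sigma> \<le> \<theta> * q" "q \<le> \<theta> * av B n \<sigma>"
    using bds[of n] pl qn by (auto simp: n_def)
  have "q \<ge> 0" using \<sigma> by (auto simp: q_def p_def intro!: av_nonneg)
  have up: "q / \<theta> \<ge> (2 - \<theta>) * q"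
  proof -
    have "(2 - \<theta>) * \<theta> \<le> 1"
      using zero_le_power2[of "\<theta> - 1"] by (simp add: power2_eq_square algebra_simps)
    then have "(2 - \<theta>) * \<theta> * q \<le> 1 * q" using \<open>q \<ge> 0\<close> by (rule mult_right_mono)
    then show ?thesis using \<open>\<theta> \<ge> 1\<close> by (simp add: field_simps)
  qed
  have "q / \<theta> \<le> av B p \<sigma>" "q / \<theta> \<le> av B n \<sigma>"
    using bp bn \<open>\<theta> \<ge> 1\<close> by (simp_all add: field_simps)
  then have "\<bar>av B p \<sigma> - av B n \<sigma>\<bar> \<le> \<theta> * q - (2 - \<theta>) * q"
    using bp bn up by linarith
  also have "\<dots> = (\<theta> - 1) * (2 * q)" by (simp add: algebra_simps)
  finally have "\<bar>av B p \<sigma> - av B n \<sigma>\<bar> \<le> (\<theta> - 1) * (2 * q)" .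
  moreover have "av B u \<sigma> = av B p \<sigma> - av B n \<sigma>" by (subst u(1)) (simp add: av_diff)
  moreover have "av U (\<lambda>\<rho>. \<bar>u \<rho>\<bar>) \<sigma> = 2 * q" by (subst u(2)) (simp add: av_add qn q_def)
  ultimately show "\<bar>av B u \<sigma>\<bar> \<le> (\<theta> - 1) * av U (\<lambda>\<rho>. \<bar>u \<rho>\<bar>) \<sigma>" by simp
qed

text \<open>\<open>ln x \<le> x - 1\<close> turns the entropy into variance over mean, and a
  variance is at most the mean square distance to any function that is constant on classes. In
  \<open>tensorizes_crude\<close>, \<open>g\<close> is the value of \<open>f\<close> at a reference
  configuration of the class.\<close>

lemma cond_ent_le_square:
  assumes f: "\<And>\<sigma>. \<sigma> \<in> \<Omega> \<Longrightarrow> f \<sigma> > 0" and g: "\<And>\<sigma> \<rho>. \<rho> \<in> cl U \<sigma> \<Longrightarrow> g \<rho> = g \<sigma>"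
  shows "cond_ent U f \<le> (\<Sum>\<sigma>\<in>\<Omega>. w \<sigma> * ((f \<sigma> - g \<sigma>)\<^sup>2 / av U f \<sigma>))"
proof -
  define \<phi> where "\<phi> = av U f"
  have \<phi>: "\<phi> \<sigma> > 0" if "\<sigma> \<in> \<Omega>" for \<sigma> unfolding \<phi>_def using that f by (rule av_pos)
  have loc: "h (\<phi> \<rho>) (g \<rho>) = h (\<phi> \<sigma>) (g \<sigma>)" if "\<rho> \<in> cl U \<sigma>" for \<sigma> \<rho> and h :: "real \<Rightarrow> real \<Rightarrow> real"
    using that g[OF that] by (simp add: \<phi>_def av_eq)
  have "cond_ent U f \<le> (\<Sum>\<sigma>\<in>\<Omega>. w \<sigma> * (f \<sigma> * (f \<sigma> / \<phi> \<sigma> - 1)))"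
    unfolding cond_ent_def \<phi>_def[symmetric]
    using weight_pos f \<phi> by (intro sum_mono mult_left_mono ln_le_minus_one) (auto intro: less_imp_le)
  also have "\<dots> = (\<Sum>\<sigma>\<in>\<Omega>. w \<sigma> * ((f \<sigma> - g \<sigma>)\<^sup>2 / \<phi> \<sigma>) + w \<sigma> * (f \<sigma> * (2 * g \<sigma> / \<phi> \<sigma> - 1))
      - w \<sigma> * ((g \<sigma>)\<^sup>2 / \<phi> \<sigma>))"
  proof (intro sum.cong refl)
    fix \<sigma> assume "\<sigma> \<in> \<Omega>"
    then have "\<phi> \<sigma> \<noteq> 0" using \<phi> by fastforce
    then have "f \<sigma> * (f \<sigma> / \<phi> \<sigma> - 1) = (f \<sigma> - g \<sigma>)\<^sup>2 / \<phi> \<sigma> + f \<sigma> * (2 * g \<sigma> / \<phi> \<sigma> - 1) - (g \<sigma>)\<^sup>2 / \<phi> \<sigma>"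
      by (simp add: power2_eq_square field_simps)
    then show "w \<sigma> * (f \<sigma> * (f \<sigma> / \<phi> \<sigma> - 1)) = w \<sigma> * ((f \<sigma> - g \<sigma>)\<^sup>2 / \<phi> \<sigma>)
      + w \<sigma> * (f \<sigma> * (2 * g \<sigma> / \<phi> \<sigma> - 1)) - w \<sigma> * ((g \<sigma>)\<^sup>2 / \<phi> \<sigma>)"
      by (simp only: distrib_left right_diff_distrib)
  qed
  also have "\<dots> = (\<Sum>\<sigma>\<in>\<Omega>. w \<sigma> * ((f \<sigma> - g \<sigma>)\<^sup>2 / \<phi> \<sigma>))
      + (\<Sum>\<sigma>\<in>\<Omega>. w \<sigma> * (f \<sigma> * (2 * g \<sigma> / \<phi> \<sigma> - 1))) - (\<Sum>\<sigma>\<in>\<Omega>. w \<sigma> * ((g \<sigma>)\<^sup>2 / \<phi> \<sigma>))"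
    by (simp only: sum.distrib sum_subtractf)
  also have "(\<Sum>\<sigma>\<in>\<Omega>. w \<sigma> * (f \<sigma> * (2 * g \<sigma> / \<phi> \<sigma> - 1)))
      = (\<Sum>\<sigma>\<in>\<Omega>. w \<sigma> * (\<phi> \<sigma> * (2 * g \<sigma> / \<phi> \<sigma> - 1)))"
    unfolding \<phi>_def by (rule sum_av_mult_local[symmetric])
      (use loc[where h = "\<lambda>p q. 2 * q / p - 1"] in \<open>simp add: \<phi>_def\<close>)
  also have "(\<Sum>\<sigma>\<in>\<Omega>. w \<sigma> * (\<phi> \<sigma> * (2 * g \<sigma> / \<phi> \<sigma> - 1))) \<le> (\<Sum>\<sigma>\<in>\<Omega>. w \<sigma> * ((g \<sigma>)\<^sup>2 / \<phi> \<sigma>))"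
  proof (intro sum_mono mult_left_mono)
    fix \<sigma> assume \<sigma>: "\<sigma> \<in> \<Omega>"
    have "0 \<le> (g \<sigma> - \<phi> \<sigma>)\<^sup>2" by simp
    then have "2 * g \<sigma> * \<phi> \<sigma> - \<phi> \<sigma> * \<phi> \<sigma> \<le> (g \<sigma>)\<^sup>2"
      by (simp add: power2_eq_square algebra_simps)
    then have "(2 * g \<sigma> * \<phi> \<sigma> - \<phi> \<sigma> * \<phi> \<sigma>) / \<phi> \<sigma> \<le> (g \<sigma>)\<^sup>2 / \<phi> \<sigma>"
      using \<phi>[OF \<sigma>] by (intro divide_right_mono) auto
    then show "\<phi> \<sigma> * (2 * g \<sigma> / \<phi> \<sigma> - 1) \<le> (g \<sigma>)\<^sup>2 / \<phi> \<sigma>"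
      using \<phi>[OF \<sigma>] by (simp add: diff_divide_distrib right_diff_distrib)
  qed (use weight_pos in \<open>auto intro: less_imp_le\<close>)
  finally show ?thesis by (simp add: \<phi>_def)
qed

end

section \<open>Balanced separators from tree decompositions\<close>

text \<open>Connectivity by cuts, for a plain relation: it serves the tree and the graph alike, and
  a set that is not connected comes with a splitting. The empty set counts as connected.\<close>

definition set_connected :: "('n \<times> 'n) set \<Rightarrow> 'n set \<Rightarrow> bool" where
  "set_connected E X \<longleftrightarrow> (\<forall>Y. Y \<subset> X \<and> Y \<noteq> {} \<longrightarrow> (\<exists>u\<in>Y. \<exists>v\<in>X - Y. (u, v) \<in> E))"

lemma set_connectedD:
  "set_connected E X \<Longrightarrow> Y \<subseteq> X \<Longrightarrow> Y \<noteq> {} \<Longrightarrow> Y \<noteq> X \<Longrightarrow> \<exists>u\<in>Y. \<exists>v\<in>X - Y. (u, v) \<in> E"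
  by (auto simp: set_connected_def)

text \<open>Trees grown leaf by leaf: among the earlier nodes, the new node \<open>t\<close> has the
  only neighbour \<open>x\<close>. This supplies the induction for the Helly property.\<close>

inductive leaf_built :: "('n \<times> 'n) set \<Rightarrow> 'n set \<Rightarrow> bool" for E where
  single: "leaf_built E {r}"
| attach: "leaf_built E A \<Longrightarrow> x \<in> A \<Longrightarrow> t \<notin> A \<Longrightarrow> (x, t) \<in> E \<Longrightarrow>
    (\<And>y. y \<in> A \<Longrightarrow> (y, t) \<in> E \<Longrightarrow> y = x) \<Longrightarrow> leaf_built E (insert t A)"

text \<open>Helly property of subtrees. Remove the last leaf \<open>t\<close>. Unless
  \<open>{t}\<close> itself belongs to \<open>F\<close>, in which case \<open>t\<close> is common to
  all members, each member containing \<open>t\<close> also contains its neighbour \<open>x\<close>;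
  so without \<open>t\<close> the members are still connected and still meet pairwise.\<close>

lemma leaf_built_helly:
  assumes "leaf_built E A" and sym: "sym E"
    and "\<And>X. X \<in> F \<Longrightarrow> X \<subseteq> A \<and> set_connected E X"
    and "\<And>X Y. X \<in> F \<Longrightarrow> Y \<in> F \<Longrightarrow> X \<inter> Y \<noteq> {}"
  shows "\<exists>a\<in>A. \<forall>X\<in>F. a \<in> X"
  using assms(1,3,4)
proof (induction arbitrary: F)
  case (single r)
  have "r \<in> X" if "X \<in> F" for X
    using single.prems(1)[OF that] single.prems(2)[OF that that] by blast
  then show ?case by blast
next
  case (attach A x t)
  have "x \<noteq> t" using attach.hyps(2,3) by auto
  show ?case
  proof (cases "{t} \<in> F")
    case True
    then have "t \<in> X" if "X \<in> F" for X using attach.prems(2)[OF that True] by blast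
    then show ?thesis by blast
  next
    case False
    have x_in: "x \<in> X" if X: "X \<in> F" "t \<in> X" for X
    proof -
      have "{t} \<noteq> X" using False X(1) by auto
      moreover have "set_connected E X" "X \<subseteq> insert t A" using attach.prems(1)[OF X(1)] by auto
      ultimately obtain v where v: "v \<in> X - {t}" "(t, v) \<in> E"
        using set_connectedD[of E X "{t}"] X(2) by auto
      have "v \<in> A" "(v, t) \<in> E" using v \<open>X \<subseteq> insert t A\<close> symD[OF sym v(2)] by auto
      then have "v = x" by (rule attach.hyps(5))
      then show ?thesis using v(1) by simp
    qed
    have "\<exists>a\<in>A. \<forall>X\<in>(\<lambda>X. X - {t}) ` F. a \<in> X"
    proof (rule attach.IH)
      fix X' assume "X' \<in> (\<lambda>X. X - {t}) ` F"
      then obtain X where X: "X \<in> F" "X' = X - {t}" by auto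
      have sub: "X' \<subseteq> A" using attach.prems(1)[OF X(1)] X(2) by auto
      have conX: "set_connected E X" using attach.prems(1)[OF X(1)] by simp
      \<comment> \<open>An arc leaving \<open>Y\<close> inside \<open>X\<close> cannot end in
        \<open>t\<close>, whose only neighbour \<open>x\<close> is not in \<open>Y\<close>. A set
        that contains \<open>x\<close> is treated below through its complement and symmetry.\<close>
      have cross: "\<exists>u\<in>Y. \<exists>v\<in>X' - Y. (u, v) \<in> E" if Y: "Y \<subseteq> X'" "Y \<noteq> X'" "Y \<noteq> {}" "x \<notin> Y" for Y
      proof -
        have "Y \<subseteq> X" "Y \<noteq> X" using Y(1,2) X(2) by auto
        then obtain u v where uv: "u \<in> Y" "v \<in> X - Y" "(u, v) \<in> E"
          using set_connectedD[OF conX _ Y(3)] by blast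
        have "u \<in> A" "u \<noteq> x" using uv(1) Y(1,4) sub by auto
        then have "v \<noteq> t" using attach.hyps(5)[of u] uv(3) by auto
        then have "v \<in> X' - Y" using uv(2) X(2) by simp
        then show ?thesis using uv(1,3) by (intro bexI)
      qed
      have "set_connected E X'"
        unfolding set_connected_def
      proof (intro allI impI, elim conjE)
        fix Y assume Y: "Y \<subset> X'" "Y \<noteq> {}"
        then have Y': "Y \<subseteq> X'" "Y \<noteq> X'" by auto
        show "\<exists>u\<in>Y. \<exists>v\<in>X' - Y. (u, v) \<in> E"
        proof (cases "x \<in> Y")
          case False
          then show ?thesis using Y(2) Y' by (intro cross)
        next
          case True
          have "X' - Y \<subseteq> X'" "X' - Y \<noteq> X'" "X' - Y \<noteq> {}" "x \<notin> X' - Y"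
            using True Y' Y(2) by auto
          from cross[OF this] obtain u v
            where uv: "u \<in> X' - Y" "v \<in> X' - (X' - Y)" "(u, v) \<in> E" by (elim bexE)
          then have "v \<in> Y" by simp
          with uv(1) symD[OF sym uv(3)] show ?thesis by (intro bexI)
        qed
      qed
      with sub show "X' \<subseteq> A \<and> set_connected E X'" ..
    next
      fix X' Y' assume "X' \<in> (\<lambda>X. X - {t}) ` F" "Y' \<in> (\<lambda>X. X - {t}) ` F"
      then obtain X Y where XY: "X \<in> F" "X' = X - {t}" "Y \<in> F" "Y' = Y - {t}" by auto
      obtain z where z: "z \<in> X" "z \<in> Y" using attach.prems(2)[OF XY(1,3)] by blast
      have "\<exists>z. z \<in> X \<and> z \<in> Y \<and> z \<noteq> t"
      proof (cases "z = t")
        case True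
        then have "x \<in> X" "x \<in> Y" using x_in XY(1,3) z by auto
        then show ?thesis using \<open>x \<noteq> t\<close> by blast
      next
        case False
        then show ?thesis using z by blast
      qed
      then show "X' \<inter> Y' \<noteq> {}" unfolding XY(2,4) by blast
    qed
    then obtain a where "a \<in> A" "\<forall>X\<in>(\<lambda>X. X - {t}) ` F. a \<in> X" by (elim bexE)
    then have "a \<in> insert t A" "\<forall>X\<in>F. a \<in> X" by auto
    then show ?thesis by (rule bexI[rotated])
  qed
qed

lemma connected_imp_set_connected:
  assumes "Digraph_Component.connected H"
    and E: "\<And>e. e \<in> arcs H \<Longrightarrow> (tail H e, head H e) \<in> E" and sym: "sym E"
  shows "set_connected E (verts H)"
  unfolding set_connected_def
proof (intro allI impI)
  fix Y assume Y: "Y \<subset> verts H \<and> Y \<noteq> {}"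
  then obtain y z where yz: "y \<in> Y" "z \<in> verts H" "z \<notin> Y" by blast
  let ?S = "arcs_ends (with_proj (mk_symmetric H))"
  have S: "?S \<subseteq> E"
    using E sym by (auto simp: mk_symmetric_def arcs_ends_def arc_to_ends_def dest: symD)
  have yz_reach: "(y, z) \<in> rtrancl_on (verts H) ?S"
    using assms(1) yz Y by (auto simp: connected_def strongly_connected_def reachable_def mk_symmetric_def)
  have "v \<in> Y \<or> (\<exists>u\<in>Y. \<exists>v\<in>verts H - Y. (u, v) \<in> E)"
    if "(y, v) \<in> rtrancl_on (verts H) ?S" for v
    using that
  proof (induction rule: rtrancl_on_induct)
    case base
    then show ?case using yz(1) by blast
  next
    case (step u v)
    then show ?case using S by blast
  qed
  from this[OF yz_reach] show "\<exists>u\<in>Y. \<exists>v\<in>verts H - Y. (u, v) \<in> E" using yz by blast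
qed

context pair_graph
begin

lemma sym_parcs: "sym (parcs G)"
  using sym_arcs by (auto simp: symmetric_def)

lemma leaf_built_apath:
  assumes "leaf_built (parcs G) A" "A \<subseteq> pverts G" "x \<in> A" "y \<in> A"
  shows "\<exists>p. apath x p y \<and> set (awalk_verts x p) \<subseteq> A"
  using assms
proof (induction arbitrary: x y)
  case (single r)
  then have "apath x [] y \<and> set (awalk_verts x []) \<subseteq> {r}"
    by (auto simp: apath_def awalk_Nil_iff)
  then show ?case by blast
next
  case (attach A x0 t)
  have arcs: "(x0, t) \<in> parcs G" "(t, x0) \<in> parcs G"
    using attach.hyps(4) sym_parcs by (auto dest: symD)
  consider "x \<in> A" "y \<in> A" | "x = t" "y \<in> A" | "x \<in> A" "y = t" | "x = t" "y = t"
    using attach.prems by blast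
  then show ?case
  proof cases
    case 1
    then show ?thesis using attach.IH[of x y] attach.prems by fastforce
  next
    case 2
    then obtain p where p: "apath x0 p y" "set (awalk_verts x0 p) \<subseteq> A"
      using attach.IH[of x0 y] attach.prems attach.hyps(2) by blast
    then have "apath t ((t, x0) # p) y"
      using arcs attach.hyps(3) by (auto simp: apath_def awalk_Cons_iff)
    then show ?thesis using p 2 by (intro exI[of _ "(t, x0) # p"]) auto
  next
    case 3
    then obtain p where p: "apath x p x0" "set (awalk_verts x p) \<subseteq> A"
      using attach.IH[of x x0] attach.prems attach.hyps(2) by blast
    have w: "awalk x (p @ [(x0, t)]) t"
      using p arcs attach.prems by (auto simp: apath_def awalk_Cons_iff awalk_Nil_iff)
    have v: "awalk_verts x (p @ [(x0, t)]) = awalk_verts x p @ [t]"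
      using awalk_verts_append[OF w] by simp
    then have "apath x (p @ [(x0, t)]) t"
      using w p attach.hyps(3) by (auto simp: apath_def)
    then show ?thesis using p 3 v by (intro exI[of _ "p @ [(x0, t)]"]) auto
  next
    case 4
    then have "apath x [] y \<and> set (awalk_verts x []) \<subseteq> insert t A"
      using attach.prems by (auto simp: apath_def awalk_Nil_iff)
    then show ?thesis by blast
  qed
qed

end

text \<open>Take a maximal leaf-built set. If an arc leads from \<open>x\<close> in it to
  \<open>t\<close> outside, a second neighbour \<open>y\<close> of \<open>t\<close> in the set would
  close the path from \<open>x\<close> to \<open>y\<close> to a cycle of length at least three. So
  \<open>t\<close> can be attached as a leaf, contrary to maximality.\<close>

lemma undirected_tree_leaf_built:
  assumes "undirected_tree T"
  shows "leaf_built (parcs T) (pverts T)"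
proof -
  interpret T: pair_graph T using assms by (simp add: undirected_tree_def)
  have conn: "Digraph_Component.connected (with_proj T)"
    and acyc: "\<And>p. T.cycle p \<Longrightarrow> length p < 3"
    using assms by (force simp: undirected_tree_def not_le)+
  have sc: "set_connected (parcs T) (pverts T)"
    using connected_imp_set_connected[OF conn, of "parcs T"] T.sym_parcs by simp
  obtain r where r: "r \<in> pverts T"
    using conn by (auto simp: connected_def strongly_connected_def mk_symmetric_def)
  define P where "P = (\<lambda>A. leaf_built (parcs T) A \<and> A \<subseteq> pverts T)"
  have "P {r}" using r by (auto simp: P_def intro: leaf_built.single)
  have "finite {A. P A}"
    by (rule finite_subset[of _ "Pow (pverts T)"]) (auto simp: P_def T.pair_finite_verts)
  then obtain A where A: "P A" "\<And>A'. P A' \<Longrightarrow> A \<subseteq> A' \<Longrightarrow> A = A'"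
    using finite_has_maximal[of "{A. P A}"] \<open>P {r}\<close> by auto
  have lb: "leaf_built (parcs T) A" "A \<subseteq> pverts T" using A by (auto simp: P_def)
  have "A \<noteq> {}" using lb(1) by cases auto
  have "A = pverts T"
  proof (rule ccontr)
    assume "A \<noteq> pverts T"
    then obtain x t where xt: "x \<in> A" "t \<in> pverts T - A" "(x, t) \<in> parcs T"
      using set_connectedD[OF sc lb(2) \<open>A \<noteq> {}\<close>] by blast
    have "y = x" if y: "y \<in> A" "(y, t) \<in> parcs T" for y
    proof (rule ccontr)
      assume "y \<noteq> x"
      obtain p where p: "T.apath x p y" "set (T.awalk_verts x p) \<subseteq> A"
        using T.leaf_built_apath[OF lb xt(1) y(1)] by blast
      have "p \<noteq> []" using p \<open>y \<noteq> x\<close> by (auto simp: T.apath_def T.awalk_Nil_iff)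
      have tx: "(t, x) \<in> parcs T" using xt T.sym_parcs by (auto dest: symD)
      have w: "T.awalk x (p @ [(y, t)]) t"
        using p y xt by (auto simp: T.apath_def T.awalk_Cons_iff T.awalk_Nil_iff)
      have v: "T.awalk_verts x (p @ [(y, t)]) = T.awalk_verts x p @ [t]"
        using T.awalk_verts_append[OF w] by simp
      have "T.cycle ((t, x) # p @ [(y, t)])"
        unfolding T.cycle_def using w tx v p xt
        by (intro exI[of _ t]) (auto simp: T.awalk_Cons_iff T.apath_def)
      then have "length p < 1" using acyc by fastforce
      then show False using \<open>p \<noteq> []\<close> by simp
    qed
    then have "P (insert t A)"
      using lb xt by (auto simp: P_def intro!: leaf_built.attach[of _ A x t])
    then show False using A(2)[of "insert t A"] xt by blast
  qed
  then show ?thesis using lb by simp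
qed

text \<open>
  If every bag missed a component with more than half of the vertices, these components would
  pairwise meet, so would the subtrees of the bags they touch, and a bag common to all of these
  subtrees could not miss its own component.
\<close>

lemma tree_decomposition_balanced_bag:
  assumes "pair_graph H" and td: "tree_decomposition H T B" and "U \<subseteq> pverts H"
  shows "\<exists>t\<in>pverts T. \<forall>C. C \<subseteq> U - B t \<and> set_connected (parcs H) C \<longrightarrow> 2 * card C \<le> card U"
proof (rule ccontr)
  assume neg: "\<not> ?thesis"
  interpret H: pair_graph H by fact
  have tree: "undirected_tree T" using td by (simp add: tree_decomposition_def)
  interpret T: pair_graph T using tree by (simp add: undirected_tree_def)
  have finU: "finite U" using assms(3) H.pair_finite_verts finite_subset by blast
  have "\<forall>t\<in>pverts T. \<exists>C. C \<subseteq> U - B t \<and> set_connected (parcs H) C \<and> card U < 2 * card C"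
    using neg by (auto simp: not_le)
  then obtain C where C: "\<And>t. t \<in> pverts T \<Longrightarrow>
      C t \<subseteq> U - B t \<and> set_connected (parcs H) (C t) \<and> card U < 2 * card (C t)"
    by metis
  define N where "N v = {t \<in> pverts T. v \<in> B t}" for v
  define S where "S X = {t \<in> pverts T. B t \<inter> X \<noteq> {}}" for X
  have N: "set_connected (parcs T) (N v)" "N v \<noteq> {}" if "v \<in> pverts H" for v
  proof -
    have c: "Digraph_Component.connected (induce_subgraph (with_proj T) (N v))"
      using td that by (auto simp: tree_decomposition_def N_def)
    have "verts (induce_subgraph (with_proj T) (N v)) = N v"
      by (auto simp: N_def)
    then show "set_connected (parcs T) (N v)"
      using connected_imp_set_connected[OF c, of "parcs T"] T.sym_parcs by auto
    show "N v \<noteq> {}"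
      using c by (auto simp: connected_def strongly_connected_def mk_symmetric_def)
  qed
  \<comment> \<open>The nodes whose bags meet a connected \<open>X\<close> form a subtree. If no arc
    left \<open>Y\<close>, each \<open>N v\<close> with \<open>v\<close> in \<open>X\<close> would
    lie entirely inside or entirely outside \<open>Y\<close>; but some edge of \<open>X\<close>
    joins the two kinds of vertices, and the node of a bag containing both ends would be on both
    sides.\<close>
  have S: "set_connected (parcs T) (S X)"
    if X: "X \<subseteq> pverts H" "set_connected (parcs H) X" for X
    unfolding set_connected_def
  proof (intro allI impI, rule ccontr)
    fix Y assume Y: "Y \<subset> S X \<and> Y \<noteq> {}"
      and no: "\<not> (\<exists>u\<in>Y. \<exists>v\<in>S X - Y. (u, v) \<in> parcs T)"
    have dich: "N v \<subseteq> Y \<or> N v \<inter> Y = {}" if "v \<in> X" for v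
    proof (rule ccontr)
      assume "\<not> ?thesis"
      then have "N v \<inter> Y \<noteq> {}" "N v \<inter> Y \<noteq> N v" by auto
      moreover have "set_connected (parcs T) (N v)" using N(1) that X by blast
      ultimately obtain a b where ab: "a \<in> N v \<inter> Y" "b \<in> N v - (N v \<inter> Y)" "(a, b) \<in> parcs T"
        using set_connectedD[of "parcs T" "N v" "N v \<inter> Y"] by auto
      moreover have "N v \<subseteq> S X" using that by (auto simp: N_def S_def)
      ultimately have "a \<in> Y" "b \<in> S X - Y" by auto
      then show False using no ab(3) by blast
    qed
    define X1 where "X1 = {v \<in> X. N v \<subseteq> Y}"
    obtain t where t: "t \<in> Y" using Y by blast
    then obtain v where "v \<in> X" "t \<in> N v" using Y unfolding S_def N_def by blast
    then have "X1 \<noteq> {}" using dich t by (auto simp: X1_def)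
    obtain t' where t': "t' \<in> S X - Y" using Y by blast
    then obtain v' where "v' \<in> X" "t' \<in> N v'" unfolding S_def N_def by blast
    then have "X1 \<noteq> X" using t' by (auto simp: X1_def)
    then obtain a b where ab: "a \<in> X1" "b \<in> X - X1" "(a, b) \<in> parcs H"
      using set_connectedD[OF X(2), of X1] \<open>X1 \<noteq> {}\<close> unfolding X1_def by blast
    then obtain s where "s \<in> pverts T" "a \<in> B s" "b \<in> B s"
      using td by (fastforce simp: tree_decomposition_def)
    then have "s \<in> N a" "s \<in> N b" by (auto simp: N_def)
    moreover have "N a \<subseteq> Y" "N b \<inter> Y = {}" using ab dich by (auto simp: X1_def)
    ultimately show False by blast
  qed
  have inter: "C s \<inter> C t \<noteq> {}" if st: "s \<in> pverts T" "t \<in> pverts T" for s t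
  proof
    assume "C s \<inter> C t = {}"
    then have "card (C s \<union> C t) = card (C s) + card (C t)"
      using C[OF st(1)] C[OF st(2)] finU by (intro card_Un_disjoint) (auto intro: finite_subset)
    moreover have "card (C s \<union> C t) \<le> card U"
      using C[OF st(1)] C[OF st(2)] finU by (intro card_mono) auto
    ultimately show False using C[OF st(1)] C[OF st(2)] by linarith
  qed
  have Csub: "C t \<subseteq> pverts H" if "t \<in> pverts T" for t
    using C[OF that] assms(3) by blast
  have "\<exists>a\<in>pverts T. \<forall>X\<in>(\<lambda>t. S (C t)) ` pverts T. a \<in> X"
  proof (rule leaf_built_helly[OF undirected_tree_leaf_built[OF tree] T.sym_parcs])
    fix X assume "X \<in> (\<lambda>t. S (C t)) ` pverts T"
    then obtain t where t: "t \<in> pverts T" "X = S (C t)" by auto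
    moreover have "S (C t) \<subseteq> pverts T" by (auto simp: S_def)
    moreover have "set_connected (parcs T) (S (C t))"
      using C[OF t(1)] Csub[OF t(1)] by (intro S) auto
    ultimately show "X \<subseteq> pverts T \<and> set_connected (parcs T) X" by simp
  next
    fix X Y assume "X \<in> (\<lambda>t. S (C t)) ` pverts T" "Y \<in> (\<lambda>t. S (C t)) ` pverts T"
    then obtain s t where st: "s \<in> pverts T" "X = S (C s)" "t \<in> pverts T" "Y = S (C t)" by auto
    obtain v where v: "v \<in> C s" "v \<in> C t" using inter st by blast
    then obtain n where "n \<in> N v" using N(2) Csub st by blast
    then have "n \<in> X \<inter> Y" using v st by (auto simp: N_def S_def)
    then show "X \<inter> Y \<noteq> {}" by blast
  qed
  then obtain a where "a \<in> pverts T" "a \<in> S (C a)" by blast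
  then show False using C[of a] by (auto simp: S_def)
qed

section \<open>Entropy factorization for the hardcore model\<close>

text \<open>A relational form of distance at most \<open>l\<close>, with composition and symmetry at
  hand. Every point is at distance 0 from itself, even outside the graph.\<close>

definition dist_le :: "'a pair_pre_digraph \<Rightarrow> nat \<Rightarrow> 'a \<Rightarrow> 'a \<Rightarrow> bool" where
  "dist_le G l u v \<longleftrightarrow> (\<exists>j\<le>l. (u, v) \<in> parcs G ^^ j)"

lemma dist_le_refl: "dist_le G l u u"
  unfolding dist_le_def by (rule exI[of _ 0]) simp

lemma dist_le_arc: "(u, v) \<in> parcs G \<Longrightarrow> l \<ge> 1 \<Longrightarrow> dist_le G l u v"
  unfolding dist_le_def by (rule exI[of _ 1]) simp

lemma dist_le_trans: "dist_le G k u v \<Longrightarrow> dist_le G l v x \<Longrightarrow> dist_le G (k + l) u x"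
  unfolding dist_le_def by (blast intro: add_mono relpow_trans)

lemma dist_le_mono: "dist_le G k u v \<Longrightarrow> k \<le> l \<Longrightarrow> dist_le G l u v"
  unfolding dist_le_def using order_trans by blast

lemma (in pair_wf_digraph) awalk_imp_relpow: "awalk u p v \<Longrightarrow> (u, v) \<in> parcs G ^^ length p"
proof (induction p arbitrary: u)
  case Nil
  then show ?case by (simp add: awalk_Nil_iff)
next
  case (Cons e p)
  then have "e \<in> parcs G" "u = fst e" "(snd e, v) \<in> parcs G ^^ length p"
    by (auto simp: awalk_Cons_iff)
  then have "(u, v) \<in> parcs G ^^ Suc (length p)"
    by (cases e) (auto intro: relpow_Suc_I2 simp del: relpow.simps)
  then show ?case by simp
qed

lemma (in pair_wf_digraph) relpow_imp_awalk:
  "(u, v) \<in> parcs G ^^ n \<Longrightarrow> u \<in> pverts G \<Longrightarrow> \<exists>p. awalk u p v \<and> length p = n"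
proof (induction n arbitrary: u)
  case 0
  then show ?case by (intro exI[of _ "[]"]) (simp add: awalk_Nil_iff)
next
  case (Suc n)
  then obtain y where y: "(u, y) \<in> parcs G" "(y, v) \<in> parcs G ^^ n"
    by (meson relpow_Suc_E2)
  then obtain p where "awalk y p v" "length p = n"
    using Suc.IH in_arcsD2 by blast
  then show ?case using y by (intro exI[of _ "(u, y) # p"]) (simp add: awalk_Cons_iff)
qed

lemma set_dist_ge:
  assumes "pair_wf_digraph G" "\<And>x. x \<in> W \<Longrightarrow> \<not> dist_le G l s x"
  shows "enat (Suc l) \<le> set_dist G s W"
proof -
  interpret pair_wf_digraph G by fact
  have "enat (Suc l) \<le> enat (length p)" if "x \<in> W" "awalk s p x" for x p
    using awalk_imp_relpow[OF that(2)] assms(2)[OF that(1)] by (auto simp: dist_le_def not_le Suc_le_eq)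
  then show ?thesis
    unfolding set_dist_def graph_dist_def by (intro INF_greatest) auto
qed

lemma decay_le:
  assumes "0 \<le> r" "r \<le> 1" "enat n \<le> D"
  shows "decay r D \<le> r ^ n"
  using assms by (cases D) (auto simp: decay_def intro: power_decreasing)

section \<open>Configurations and conditional spin probabilities of the hardcore model\<close>

locale hardcore_graph = pair_graph G for G :: "'a pair_pre_digraph" +
  fixes lam :: real
  assumes lam_pos: "lam > 0"
begin

definition configs :: "('a \<Rightarrow> bool) set" where
  "configs = {\<sigma>. independent_set G {v. \<sigma> v}}"

abbreviation "\<mu>\<^sub>G \<equiv> hardcore G lam"

abbreviation "wt \<equiv> pmf \<mu>\<^sub>G"

lemma configs_False: "\<sigma> \<in> configs \<Longrightarrow> x \<notin> pverts G \<Longrightarrow> \<not> \<sigma> x"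
  by (auto simp: configs_def independent_set_def)

lemma configs_arc: "\<sigma> \<in> configs \<Longrightarrow> (u, v) \<in> parcs G \<Longrightarrow> \<sigma> u \<Longrightarrow> \<not> \<sigma> v"
  by (auto simp: configs_def independent_set_def)

lemma configsI:
  "(\<And>x. \<sigma> x \<Longrightarrow> x \<in> pverts G) \<Longrightarrow> (\<And>u v. (u, v) \<in> parcs G \<Longrightarrow> \<sigma> u \<Longrightarrow> \<not> \<sigma> v) \<Longrightarrow> \<sigma> \<in> configs"
  by (auto simp: configs_def independent_set_def)

lemma configs_down: "\<sigma> \<in> configs \<Longrightarrow> (\<And>x. \<rho> x \<Longrightarrow> \<sigma> x) \<Longrightarrow> \<rho> \<in> configs"
  by (auto simp: configs_def independent_set_def)

lemma finite_independent_sets: "finite {I. independent_set G I}"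
  by (rule finite_subset[of _ "Pow (pverts G)"]) (auto simp: independent_set_def pair_finite_verts)

lemma finite_conf: "finite configs"
proof (rule finite_imageD)
  show "finite ((\<lambda>\<sigma>. {v. \<sigma> v}) ` configs)"
    by (rule finite_subset[OF _ finite_independent_sets]) (auto simp: configs_def)
  show "inj_on (\<lambda>\<sigma>. {v. \<sigma> v}) configs"
    by (auto simp: inj_on_def fun_eq_iff)
qed

lemma finite_occupied: "\<sigma> \<in> configs \<Longrightarrow> finite {v. \<sigma> v}"
  using pair_finite_verts by (auto simp: configs_def independent_set_def intro: finite_subset)

lemma partition_pos: "hardcore_partition G lam > 0"
  unfolding hardcore_partition_def using lam_pos
  by (intro sum_pos finite_independent_sets) (auto simp: independent_set_def)

lemma wt_eq: "\<sigma> \<in> configs \<Longrightarrow> wt \<sigma> = lam ^ card {v. \<sigma> v} / hardcore_partition G lam"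
  using pmf_hardcore[OF pair_graph_axioms lam_pos] by (simp add: configs_def)

lemma wt_pos: "\<sigma> \<in> configs \<Longrightarrow> wt \<sigma> > 0"
  using lam_pos partition_pos by (simp add: wt_eq)

lemma wt_eq_0: "\<sigma> \<notin> configs \<Longrightarrow> wt \<sigma> = 0"
  using pmf_hardcore[OF pair_graph_axioms lam_pos] by (simp add: configs_def)

lemma set_pmf_hardcore: "set_pmf \<mu>\<^sub>G = configs"
  using wt_pos wt_eq_0 by (force simp: set_pmf_eq)

sublocale weighted_configs configs wt
  by unfold_locales (use finite_conf wt_pos in auto)

lemma prob_eq: "measure_pmf.prob \<mu>\<^sub>G {\<sigma>. P \<sigma>} = (\<Sum>\<sigma>\<in>{\<sigma>\<in>configs. P \<sigma>}. wt \<sigma>)"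
proof -
  have "measure_pmf.prob \<mu>\<^sub>G {\<sigma>. P \<sigma>} = measure_pmf.prob \<mu>\<^sub>G {\<sigma>\<in>configs. P \<sigma>}"
    unfolding set_pmf_hardcore[symmetric]
    by (subst measure_Int_set_pmf[symmetric]) (auto intro!: arg_cong[where f = "measure_pmf.prob \<mu>\<^sub>G"])
  also have "\<dots> = (\<Sum>\<sigma>\<in>{\<sigma>\<in>configs. P \<sigma>}. wt \<sigma>)"
    using finite_conf by (intro measure_measure_pmf_finite) auto
  finally show ?thesis .
qed

definition spin_prob :: "'a set \<Rightarrow> ('a \<Rightarrow> bool) \<Rightarrow> 'a \<Rightarrow> bool \<Rightarrow> real" where
  "spin_prob B \<sigma> s c = (\<Sum>\<rho>\<in>{\<rho>\<in>cl B \<sigma>. \<rho> s = c}. wt \<rho>) / mass B \<sigma>"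

text \<open>Dictionary for strong spatial mixing: a pinning outside \<open>U\<close> together with a
  configuration on \<open>U - B\<close> fixes everything but the spins on \<open>B\<close>, since
  outside the graph all configurations are \<open>False\<close>.\<close>

lemma cl_eq_agrees:
  assumes "\<sigma> \<in> configs" "\<tau> \<in> configs" "B \<subseteq> U" "U \<subseteq> pverts G" "\<And>x. x \<notin> U \<Longrightarrow> \<tau> x = \<sigma> x"
  shows "{\<rho> \<in> configs. agrees (pverts G - U) \<sigma> \<rho> \<and> agrees (U - B) \<tau> \<rho>} = cl B \<tau>"
proof -
  have "agrees (pverts G - U) \<sigma> \<rho> \<and> agrees (U - B) \<tau> \<rho> \<longleftrightarrow> (\<forall>x. x \<notin> B \<longrightarrow> \<rho> x = \<tau> x)"
    if "\<rho> \<in> configs" for \<rho>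
  proof
    assume agr: "agrees (pverts G - U) \<sigma> \<rho> \<and> agrees (U - B) \<tau> \<rho>"
    show "\<forall>x. x \<notin> B \<longrightarrow> \<rho> x = \<tau> x"
    proof (intro allI impI)
      fix x assume "x \<notin> B"
      consider "x \<in> U" | "x \<notin> U" "x \<in> pverts G" | "x \<notin> pverts G" by blast
      then show "\<rho> x = \<tau> x"
      proof cases
        case 3
        then show ?thesis using configs_False[OF that] configs_False[OF assms(2)] by blast
      qed (use agr \<open>x \<notin> B\<close> assms(5) in \<open>auto simp: agrees_def\<close>)
    qed
  next
    assume "\<forall>x. x \<notin> B \<longrightarrow> \<rho> x = \<tau> x"
    then show "agrees (pverts G - U) \<sigma> \<rho> \<and> agrees (U - B) \<tau> \<rho>"
      using assms(3,5) unfolding agrees_def by blast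
  qed
  then show ?thesis by (auto simp: cl_def)
qed

lemma cond_marginal_eq:
  assumes "\<sigma> \<in> configs" "\<tau> \<in> configs" "B \<subseteq> U" "U \<subseteq> pverts G" "\<And>x. x \<notin> U \<Longrightarrow> \<tau> x = \<sigma> x"
  shows "cond_marginal \<mu>\<^sub>G (pverts G - U) \<sigma> s c (U - B) \<tau> = spin_prob B \<tau> s c"
proof -
  have "{\<rho> \<in> configs. \<rho> s = c \<and> agrees (pverts G - U) \<sigma> \<rho> \<and> agrees (U - B) \<tau> \<rho>} = {\<rho>\<in>cl B \<tau>. \<rho> s = c}"
    using cl_eq_agrees[OF assms] by auto
  then show ?thesis
    unfolding cond_marginal_def cond_prob_def spin_prob_def mass_def
    by (simp add: prob_eq cl_eq_agrees[OF assms])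
qed

lemma spin_prob_nonneg: "\<sigma> \<in> configs \<Longrightarrow> spin_prob B \<sigma> s c \<ge> 0"
  using mass_pos[of \<sigma> B] by (auto simp: spin_prob_def intro!: divide_nonneg_pos sum_nonneg)

lemma spin_prob_pos_iff:
  assumes "\<sigma> \<in> configs"
  shows "spin_prob B \<sigma> s c > 0 \<longleftrightarrow> (\<exists>\<rho>\<in>cl B \<sigma>. \<rho> s = c)"
proof
  assume "\<exists>\<rho>\<in>cl B \<sigma>. \<rho> s = c"
  then have "(\<Sum>\<rho>\<in>{\<rho>\<in>cl B \<sigma>. \<rho> s = c}. wt \<rho>) > 0"
    using wt_pos cl_subset by (intro sum_pos) auto
  then show "spin_prob B \<sigma> s c > 0"
    using mass_pos[OF assms, of B] by (simp add: spin_prob_def)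
next
  assume "spin_prob B \<sigma> s c > 0"
  show "\<exists>\<rho>\<in>cl B \<sigma>. \<rho> s = c"
  proof (rule ccontr)
    assume "\<not> ?thesis"
    then have "{\<rho>\<in>cl B \<sigma>. \<rho> s = c} = {}" by blast
    then show False using \<open>spin_prob B \<sigma> s c > 0\<close> unfolding spin_prob_def by (simp only: sum.empty)
  qed
qed

text \<open>Strong spatial mixing speaks only of spins that are possible under both conditions. Spin
  0 always is. For spin 1, occupy nothing in \<open>B\<close> but \<open>s\<close>: the neighbours
  of \<open>s\<close> lie in \<open>B\<close> or outside \<open>U\<close>, where \<sigma> and \<tau>
  agree.\<close>

lemma spin_feasible_transfer:
  assumes "\<sigma> \<in> configs" "\<tau> \<in> cl U \<sigma>" "B \<subseteq> U" "U \<subseteq> pverts G" "s \<in> B"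
    and far: "\<And>x. x \<in> U - B \<Longrightarrow> (s, x) \<notin> parcs G"
    and ex: "\<exists>\<rho>\<in>cl B \<sigma>. \<rho> s = c"
  shows "\<exists>\<rho>\<in>cl B \<tau>. \<rho> s = c"
proof (cases c)
  case False
  have "\<tau> \<in> configs" using assms(2) cl_subset by blast
  then have "\<tau>(s := False) \<in> configs" by (rule configs_down) (auto split: if_splits)
  then show ?thesis using False \<open>s \<in> B\<close> by (intro bexI[of _ "\<tau>(s := False)"]) (auto simp: cl_def)
next
  case True
  then obtain \<rho> where \<rho>: "\<rho> \<in> cl B \<sigma>" "\<rho> s" using ex by auto
  have \<rho>c: "\<rho> \<in> configs" and \<tau>c: "\<tau> \<in> configs" using \<rho>(1) assms(2) cl_subset by blast+
  define \<rho>' where "\<rho>' = (\<lambda>x. if x \<in> B then x = s else \<tau> x)"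
  have nb: "\<not> \<rho>' x" if "(s, x) \<in> parcs G" for x
  proof
    assume x: "\<rho>' x"
    have "x \<noteq> s" using that no_loops' by blast
    then have "x \<notin> B" "\<tau> x" using x by (auto simp: \<rho>'_def split: if_splits)
    then have "x \<notin> U" using far[of x] that by blast
    then have "\<rho> x" using \<open>\<tau> x\<close> \<rho>(1) assms(2,3) by (auto simp: cl_def)
    then show False using configs_arc[OF \<rho>c that \<rho>(2)] by simp
  qed
  have "\<rho>' \<in> configs"
  proof (rule configsI)
    fix x assume "\<rho>' x"
    then show "x \<in> pverts G"
      using configs_False[OF \<tau>c, of x] assms(3,4,5) by (auto simp: \<rho>'_def split: if_splits)
  next
    fix x y assume xy: "(x, y) \<in> parcs G" "\<rho>' x"
    show "\<not> \<rho>' y"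
    proof
      assume y: "\<rho>' y"
      have "x \<noteq> s" using nb[of y] xy y by blast
      moreover have "y \<noteq> s" using nb[of x] symD[OF sym_parcs xy(1)] xy(2) by blast
      ultimately have "\<tau> x" "\<tau> y" using xy(2) y by (auto simp: \<rho>'_def split: if_splits)
      then show False using configs_arc[OF \<tau>c xy(1)] by simp
    qed
  qed
  then show ?thesis
    using True \<open>s \<in> B\<close> by (intro bexI[of _ \<rho>']) (auto simp: cl_def \<rho>'_def)
qed

end

section \<open>Near independence from strong spatial mixing\<close>

locale hardcore_ssm = hardcore_graph +
  fixes C \<delta> :: real
  assumes ssm: "strong_spatial_mixing G (hardcore G lam) C \<delta>"
    and C_pos: "C > 0" and delta: "0 < \<delta>" "\<delta> < 1"
begin

text \<open>Vertices missed by an \<open>l\<close>-ball are at distance at least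
  \<open>l + 1\<close>, whence the exponent.\<close>

definition kap :: "nat \<Rightarrow> real" where
  "kap l = C * (1 - \<delta>) ^ Suc l"

lemma kap_nonneg: "kap l \<ge> 0"
  using C_pos delta by (simp add: kap_def)

text \<open>Strong spatial mixing for the pinning \<sigma> outside \<open>U\<close> and the set
  \<open>W = U - B\<close>. A spin that is impossible under \<sigma> has probability 0 on the left,
  and a possible one is possible under \<tau> by \<open>spin_feasible_transfer\<close>.\<close>

lemma spin_prob_ratio:
  assumes \<sigma>: "\<sigma> \<in> configs" and \<tau>: "\<tau> \<in> cl U \<sigma>" and BU: "B \<subseteq> U" "U \<subseteq> pverts G" and s: "s \<in> B"
    and far: "\<And>x. x \<in> U - B \<Longrightarrow> \<not> dist_le G l s x" and "l \<ge> 1"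
  shows "spin_prob B \<sigma> s c \<le> (1 + kap l) * spin_prob B \<tau> s c"
proof (cases "spin_prob B \<sigma> s c > 0")
  case False
  have \<tau>c: "\<tau> \<in> configs" using \<tau> cl_subset by blast
  have "0 \<le> (1 + kap l) * spin_prob B \<tau> s c"
    using kap_nonneg spin_prob_nonneg[OF \<tau>c] by (intro mult_nonneg_nonneg add_nonneg_nonneg) auto
  then show ?thesis using False by linarith
next
  case True
  have \<tau>c: "\<tau> \<in> configs" using \<tau> cl_subset by blast
  have eqU: "\<tau> x = \<sigma> x" if "x \<notin> U" for x using \<tau> that by (auto simp: cl_def)
  have no_arc: "(s, x) \<notin> parcs G" if "x \<in> U - B" for x
    using far[OF that] dist_le_arc[of s x G l] \<open>l \<ge> 1\<close> by blast
  have "\<exists>\<rho>\<in>cl B \<sigma>. \<rho> s = c" using True spin_prob_pos_iff[OF \<sigma>] by simp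
  then have "\<exists>\<rho>\<in>cl B \<tau>. \<rho> s = c"
    by (intro spin_feasible_transfer[OF \<sigma> \<tau> BU s] no_arc)
  then have pos: "spin_prob B \<tau> s c > 0" using spin_prob_pos_iff[OF \<tau>c] by simp
  have feas: "feasible \<mu>\<^sub>G (agrees \<Lambda> \<sigma>)" for \<Lambda>
    unfolding feasible_def prob_eq using \<sigma> wt_pos finite_conf
    by (intro sum_pos) (auto simp: agrees_def)
  have feas2: "feasible \<mu>\<^sub>G (\<lambda>\<rho>. agrees (pverts G - U) \<sigma> \<rho> \<and> agrees (U - B) \<xi> \<rho>)"
    if "\<xi> \<in> configs" "\<And>x. x \<notin> U \<Longrightarrow> \<xi> x = \<sigma> x" for \<xi>
    unfolding feasible_def prob_eq using that wt_pos finite_conf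
    by (intro sum_pos) (auto simp: agrees_def)
  have m\<sigma>: "cond_marginal \<mu>\<^sub>G (pverts G - U) \<sigma> s c (U - B) \<sigma> = spin_prob B \<sigma> s c"
    using \<sigma> BU by (intro cond_marginal_eq) auto
  have m\<tau>: "cond_marginal \<mu>\<^sub>G (pverts G - U) \<sigma> s c (U - B) \<tau> = spin_prob B \<tau> s c"
    using \<sigma> \<tau>c BU eqU by (intro cond_marginal_eq) auto
  have "\<bar>cond_marginal \<mu>\<^sub>G (pverts G - U) \<sigma> s c (U - B) \<sigma> /
      cond_marginal \<mu>\<^sub>G (pverts G - U) \<sigma> s c (U - B) \<tau> - 1\<bar> \<le> C * decay (1 - \<delta>) (set_dist G s (U - B))"
  proof (rule ssm[unfolded strong_spatial_mixing_def, rule_format])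
    show "pverts G - U \<subseteq> pverts G \<and> feasible \<mu>\<^sub>G (agrees (pverts G - U) \<sigma>) \<and>
        s \<in> pverts G - (pverts G - U) \<and> U - B \<subseteq> pverts G - (pverts G - U \<union> {s}) \<and>
        feasible \<mu>\<^sub>G (\<lambda>\<rho>. agrees (pverts G - U) \<sigma> \<rho> \<and> agrees (U - B) \<sigma> \<rho>) \<and>
        feasible \<mu>\<^sub>G (\<lambda>\<rho>. agrees (pverts G - U) \<sigma> \<rho> \<and> agrees (U - B) \<tau> \<rho>) \<and>
        cond_marginal \<mu>\<^sub>G (pverts G - U) \<sigma> s c (U - B) \<sigma> > 0 \<and>
        cond_marginal \<mu>\<^sub>G (pverts G - U) \<sigma> s c (U - B) \<tau> > 0"
      unfolding m\<sigma> m\<tau> using feas feas2[OF \<sigma>] feas2[OF \<tau>c eqU] True pos BU s by auto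
  qed
  also have "\<dots> \<le> kap l"
    unfolding kap_def using C_pos delta
    by (intro mult_left_mono decay_le set_dist_ge pair_wf_digraph_axioms far) auto
  finally have "spin_prob B \<sigma> s c / spin_prob B \<tau> s c \<le> 1 + kap l"
    unfolding m\<sigma> m\<tau> by linarith
  then show ?thesis using pos by (simp add: field_simps)
qed

text \<open>Reveal the spins on \<open>S\<close> one by one. Each costs a factor
  \<open>1 + kap l\<close>, and a revealed vertex leaves both \<open>U\<close> and \<open>B\<close>,
  so the distant set \<open>U - B\<close> stays the same. Once \<open>S\<close> is exhausted,
  \<open>u\<close> is constant on the classes of \<open>U\<close>.\<close>

lemma av_ratio:
  assumes "finite S"
    and "S \<subseteq> B" "B \<subseteq> U" "U \<subseteq> pverts G" and "l \<ge> 1"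
    and "\<And>s x. s \<in> S \<Longrightarrow> x \<in> U - B \<Longrightarrow> \<not> dist_le G l s x"
    and u: "\<And>\<rho>. \<rho> \<in> configs \<Longrightarrow> u \<rho> \<ge> 0"
    and "\<And>\<tau> \<rho>. \<tau> \<in> configs \<Longrightarrow> \<rho> \<in> cl (U - S) \<tau> \<Longrightarrow> u \<rho> = u \<tau>"
    and "\<sigma> \<in> configs" "\<tau> \<in> cl U \<sigma>"
  shows "av B u \<sigma> \<le> (1 + kap l) ^ card S * av B u \<tau>"
  using assms(1-6,8-)
proof (induction arbitrary: U B \<sigma> \<tau> rule: finite_induct)
  case empty
  have "\<tau> \<in> configs" using empty.prems cl_subset by blast
  have loc: "u \<rho> = u \<xi>" if "\<xi> \<in> configs" "\<rho> \<in> cl B \<xi>" for \<rho> \<xi>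
    using empty.prems(6)[OF that(1), of \<rho>] that(2) cl_mono[OF empty.prems(2)] by auto
  have "av B u \<sigma> = u \<sigma>" "av B u \<tau> = u \<tau>"
    by (rule av_local; use empty.prems(7) \<open>\<tau> \<in> configs\<close> loc in blast)+
  moreover have "u \<tau> = u \<sigma>"
    using empty.prems(6)[OF empty.prems(7), of \<tau>] empty.prems(8) by simp
  ultimately show ?case by simp
next
  case (insert s S)
  note \<sigma> = insert.prems(7) and \<tau> = insert.prems(8)
  have \<tau>c: "\<tau> \<in> configs" using \<tau> cl_subset by blast
  define part where "part \<xi> c = (\<Sum>\<rho>\<in>{\<rho>\<in>cl B \<xi>. \<rho> s = c}. wt \<rho> * u \<rho>) / mass B \<xi>" for \<xi> c
  have av: "av B u \<xi> = part \<xi> True + part \<xi> False" for \<xi>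
  proof -
    have "(\<Sum>\<rho>\<in>cl B \<xi>. wt \<rho> * u \<rho>) =
      (\<Sum>\<rho>\<in>{\<rho>\<in>cl B \<xi>. \<rho> s = True} \<union> {\<rho>\<in>cl B \<xi>. \<rho> s = False}. wt \<rho> * u \<rho>)"
      by (rule sum.cong) auto
    also have "\<dots> = (\<Sum>\<rho>\<in>{\<rho>\<in>cl B \<xi>. \<rho> s = True}. wt \<rho> * u \<rho>) + (\<Sum>\<rho>\<in>{\<rho>\<in>cl B \<xi>. \<rho> s = False}. wt \<rho> * u \<rho>)"
      by (rule sum.union_disjoint) auto
    finally show ?thesis by (simp add: av_def part_def add_divide_distrib)
  qed
  \<comment> \<open>Fixing the spin at \<open>s\<close> turns a class of \<open>B\<close> into a
    class of \<open>B - {s}\<close>.\<close>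
  have part_rep: "part \<xi> c = spin_prob B \<xi> s c * av (B - {s}) u \<rho>"
    if \<rho>: "\<rho> \<in> cl B \<xi>" "\<rho> s = c" and "\<xi> \<in> configs" for \<xi> \<rho> c
  proof -
    have eq: "{\<rho>\<in>cl B \<xi>. \<rho> s = c} = cl (B - {s}) \<rho>"
      using \<rho> insert.prems(1) by (fastforce simp: cl_def)
    have "mass (B - {s}) \<rho> > 0" using \<rho> cl_subset by (intro mass_pos) auto
    then show ?thesis unfolding part_def spin_prob_def eq by (simp add: av_def mass_def)
  qed
  have "part \<sigma> c \<le> (1 + kap l) ^ card (insert s S) * part \<tau> c" for c
  proof (cases "\<exists>\<rho>\<in>cl B \<sigma>. \<rho> s = c")
    case False
    then have e: "{\<rho>\<in>cl B \<sigma>. \<rho> s = c} = {}" by blast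
    have "part \<sigma> c = 0" unfolding part_def e by simp
    moreover have "part \<tau> c \<ge> 0"
      unfolding part_def using mass_pos[OF \<tau>c, of B] u cl_subset
      by (intro divide_nonneg_pos sum_nonneg mult_nonneg_nonneg) auto
    ultimately show ?thesis using kap_nonneg by (auto intro!: mult_nonneg_nonneg zero_le_power add_nonneg_nonneg)
  next
    case True
    then obtain \<rho> where \<rho>: "\<rho> \<in> cl B \<sigma>" "\<rho> s = c" by blast
    have far: "\<not> dist_le G l s x" if "x \<in> U - B" for x
      using insert.prems(5) that by blast
    have sB: "s \<in> B" using insert.prems(1) by blast
    have no_arc: "(s, x) \<notin> parcs G" if "x \<in> U - B" for x
      using far[OF that] dist_le_arc[of s x G l] \<open>l \<ge> 1\<close> by blast
    obtain \<rho>' where \<rho>': "\<rho>' \<in> cl B \<tau>" "\<rho>' s = c"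
      using spin_feasible_transfer[OF \<sigma> \<tau> insert.prems(2,3) sB, of c] no_arc True by blast
    have \<rho>c: "\<rho> \<in> configs" and \<rho>'c: "\<rho>' \<in> configs" using \<rho> \<rho>' cl_subset by blast+
    have IH: "av (B - {s}) u \<rho> \<le> (1 + kap l) ^ card S * av (B - {s}) u \<rho>'"
    proof (rule insert.IH[of _ "U - {s}"])
      show "S \<subseteq> B - {s}" "B - {s} \<subseteq> U - {s}" "U - {s} \<subseteq> pverts G"
        using insert.prems(1-3) insert.hyps(2) by auto
      show "\<rho> \<in> configs" by (rule \<rho>c)
      show "\<rho>' \<in> cl (U - {s}) \<rho>"
        using \<rho> \<rho>' \<tau> insert.prems(2) \<rho>'c by (auto simp: cl_def)
      show "\<not> dist_le G l s' x" if "s' \<in> S" "x \<in> U - {s} - (B - {s})" for s' x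
        using insert.prems(5)[of s' x] that by blast
      show "u \<xi>' = u \<xi>" if "\<xi> \<in> configs" "\<xi>' \<in> cl (U - {s} - S) \<xi>" for \<xi> \<xi>'
      proof -
        have "U - insert s S = U - {s} - S" by blast
        then show ?thesis using insert.prems(6)[OF that(1), of \<xi>'] that(2) by metis
      qed
    qed (rule \<open>l \<ge> 1\<close>)
    have ratio: "spin_prob B \<sigma> s c \<le> (1 + kap l) * spin_prob B \<tau> s c"
      using far \<open>l \<ge> 1\<close> by (intro spin_prob_ratio[OF \<sigma> \<tau> insert.prems(2,3) sB]) auto
    have "part \<sigma> c \<le> ((1 + kap l) * spin_prob B \<tau> s c) * ((1 + kap l) ^ card S * av (B - {s}) u \<rho>')"
      unfolding part_rep[OF \<rho> \<sigma>] using ratio IH spin_prob_nonneg[OF \<tau>c] kap_nonneg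
      by (intro mult_mono mult_nonneg_nonneg add_nonneg_nonneg av_nonneg \<rho>c u) auto
    also have "\<dots> = (1 + kap l) ^ card (insert s S) * part \<tau> c"
      unfolding part_rep[OF \<rho>' \<tau>c] using insert.hyps by simp
    finally show ?thesis .
  qed
  from this[of True] this[of False] show ?case
    unfolding av by (simp add: distrib_left)
qed

definition nbhd :: "nat \<Rightarrow> 'a set \<Rightarrow> 'a set" where
  "nbhd l S = {x. \<exists>s\<in>S. dist_le G l s x}"

text \<open>Near independence holds with \<open>\<theta> = (1 + kap l) ^ card S\<close>, which for
  \<open>x = card S * kap l\<close> is at most \<open>exp x\<close>, hence at most
  \<open>1 + 2 * x\<close>. The assumption \<open>16 * x \<le> 1\<close> keeps the error below the
  \<open>1 / 8\<close> of the factorization.\<close>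

lemma cond_ent_separator:
  assumes f: "\<And>\<sigma>. \<sigma> \<in> configs \<Longrightarrow> f \<sigma> > 0" and "S \<subseteq> U" "U \<subseteq> pverts G" "l \<ge> 1"
    and small: "16 * (real (card S) * kap l) \<le> 1"
  shows "cond_ent U f \<le> (1 + 8 * (real (card S) * kap l)) * (cond_ent (U - S) f + cond_ent (U \<inter> nbhd l S) f)"
proof -
  define x where "x = real (card S) * kap l"
  have x: "0 \<le> x" "16 * x \<le> 1" using kap_nonneg small by (auto simp: x_def)
  have "finite S" by (rule finite_subset[OF _ pair_finite_verts]) (use assms(2,3) in blast)
  have "(1 + kap l) ^ card S \<le> exp (kap l) ^ card S"
    using kap_nonneg by (intro power_mono) auto
  also have "\<dots> = exp x" by (simp add: x_def exp_of_nat_mult)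
  also have "\<dots> \<le> 1 + x + x\<^sup>2" using x by (intro exp_bound) auto
  also have "x\<^sup>2 \<le> x" using x by (simp add: power2_eq_square mult_left_le_one_le)
  finally have th: "(1 + kap l) ^ card S \<le> 1 + 2 * x" by simp
  have th1: "1 \<le> (1 + kap l) ^ card S" using kap_nonneg by simp
  have SB: "S \<subseteq> U \<inter> nbhd l S" using assms(2) dist_le_refl by (fastforce simp: nbhd_def)
  define \<epsilon> where "\<epsilon> = (1 + kap l) ^ card S - 1"
  have ni: "nearly_indep U (U - S) (U \<inter> nbhd l S) \<epsilon>"
    unfolding \<epsilon>_def
  proof (rule nearly_indepI)
    fix u :: "('a \<Rightarrow> bool) \<Rightarrow> real" and \<sigma> \<tau> :: "'a \<Rightarrow> bool"
    assume "\<And>\<rho>. \<rho> \<in> configs \<Longrightarrow> 0 \<le> u \<rho>" "\<And>\<tau> \<rho>. \<tau> \<in> configs \<Longrightarrow> \<rho> \<in> cl (U - S) \<tau> \<Longrightarrow> u \<rho> = u \<tau>"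
      "\<sigma> \<in> configs" "\<tau> \<in> cl U \<sigma>"
    then show "av (U \<inter> nbhd l S) u \<sigma> \<le> (1 + kap l) ^ card S * av (U \<inter> nbhd l S) u \<tau>"
      using \<open>finite S\<close> SB assms(3,4) by (intro av_ratio[of S _ U]) (auto simp: nbhd_def)
  qed (use th1 in auto)
  have "cond_ent U f \<le> (1 + 4 * \<epsilon>) * (cond_ent (U - S) f + cond_ent (U \<inter> nbhd l S) f)"
    using th th1 x by (intro cond_ent_factorization[OF f _ _ ni]) (auto simp: \<epsilon>_def)
  also have "\<dots> \<le> (1 + 8 * x) * (cond_ent (U - S) f + cond_ent (U \<inter> nbhd l S) f)"
    using th f by (intro mult_right_mono add_nonneg_nonneg cond_ent_nonneg) (auto simp: \<epsilon>_def)
  finally show ?thesis by (simp add: x_def)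
qed

end

section \<open>Exact independence and approximate tensorization\<close>

context hardcore_graph
begin

text \<open>Markov property. Replacing the spins on \<open>A\<close> by those of \<rho> maps
  \<open>cl B \<sigma>\<close> bijectively onto \<open>cl B \<rho>\<close>: as no arc joins
  \<open>A\<close> and \<open>B\<close>, the result is again independent. All weights change by the
  same quotient of powers of \<open>lam\<close>, and \<open>u\<close> does not change, so the
  averages coincide.\<close>

lemma av_indep:
  assumes disj: "A \<inter> B = {}" and sub: "A \<union> B \<subseteq> pverts G"
    and no: "\<And>x y. x \<in> A \<Longrightarrow> y \<in> B \<Longrightarrow> (x, y) \<notin> parcs G"
    and u: "\<And>\<tau> \<rho>. \<tau> \<in> configs \<Longrightarrow> \<rho> \<in> cl A \<tau> \<Longrightarrow> u \<rho> = u \<tau>"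
    and \<sigma>: "\<sigma> \<in> configs" and \<rho>: "\<rho> \<in> cl (A \<union> B) \<sigma>"
  shows "av B u \<sigma> = av B u \<rho>"
proof -
  have \<rho>c: "\<rho> \<in> configs" using \<rho> cl_subset by blast
  define swap where "swap \<xi> \<tau> = (\<lambda>x. if x \<in> A then \<xi> x else \<tau> x)" for \<xi> \<tau> :: "'a \<Rightarrow> bool"
  have swap_cl: "swap \<xi>' \<tau> \<in> cl B \<xi>'"
    if \<tau>: "\<tau> \<in> cl B \<xi>" and \<xi>': "\<xi>' \<in> configs" "\<And>x. x \<notin> A \<union> B \<Longrightarrow> \<xi>' x = \<xi> x" for \<xi> \<xi>' \<tau>
  proof -
    have \<tau>c: "\<tau> \<in> configs" using \<tau> cl_subset by blast
    have off: "swap \<xi>' \<tau> x = \<xi>' x" if "x \<notin> B" for x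
      using that \<tau> \<xi>'(2) by (auto simp: swap_def cl_def)
    have offA: "swap \<xi>' \<tau> x = \<tau> x" if "x \<notin> A" for x using that by (simp add: swap_def)
    have "swap \<xi>' \<tau> \<in> configs"
    proof (rule configsI)
      fix x assume "swap \<xi>' \<tau> x"
      then show "x \<in> pverts G"
        using configs_False[OF \<tau>c] configs_False[OF \<xi>'(1)] by (auto simp: swap_def split: if_splits)
    next
      fix x y assume xy: "(x, y) \<in> parcs G" "swap \<xi>' \<tau> x"
      have "(x \<notin> B \<and> y \<notin> B) \<or> (x \<notin> A \<and> y \<notin> A)"
        using no[of x y] no[of y x] xy(1) symD[OF sym_parcs xy(1)] disj by blast
      then show "\<not> swap \<xi>' \<tau> y"
      proof
        assume "x \<notin> B \<and> y \<notin> B"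
        then show ?thesis using off configs_arc[OF \<xi>'(1) xy(1)] xy(2) by simp
      next
        assume "x \<notin> A \<and> y \<notin> A"
        then show ?thesis using offA configs_arc[OF \<tau>c xy(1)] xy(2) by simp
      qed
    qed
    then show ?thesis using off by (auto simp: cl_def)
  qed
  have off\<rho>: "\<rho> x = \<sigma> x" if "x \<notin> A \<union> B" for x using \<rho> that by (auto simp: cl_def)
  have inv: "swap \<xi> (swap \<xi>' \<tau>) = \<tau>" if "\<tau> \<in> cl B \<xi>" for \<xi> \<xi>' \<tau>
    using that disj by (fastforce simp: swap_def cl_def)
  define K where "K = lam ^ card {x\<in>A. \<rho> x} / lam ^ card {x\<in>A. \<sigma> x}"
  have Kpos: "K > 0" using lam_pos by (simp add: K_def)
  have cards: "card {x. \<tau> x} = card {x\<in>A. \<xi> x} + card {x. x \<notin> A \<and> \<tau> x}"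
    if \<tau>: "\<tau> \<in> cl B \<xi>" for \<xi> \<tau>
  proof -
    have fin: "finite {x. \<tau> x}" using \<tau> cl_subset finite_occupied by blast
    have "{x. \<tau> x} = {x\<in>A. \<xi> x} \<union> {x. x \<notin> A \<and> \<tau> x}"
      using \<tau> disj by (auto simp: cl_def)
    moreover have "{x\<in>A. \<xi> x} \<subseteq> {x. \<tau> x}" using \<tau> disj by (auto simp: cl_def)
    ultimately show ?thesis
      using fin by (metis (no_types, lifting) card_Un_disjoint disjoint_iff finite_Un mem_Collect_eq)
  qed
  have swap_wt: "wt (swap \<rho> \<tau>) = K * wt \<tau>" if \<tau>: "\<tau> \<in> cl B \<sigma>" for \<tau>
  proof -
    have s: "swap \<rho> \<tau> \<in> cl B \<rho>" using swap_cl[OF \<tau> \<rho>c off\<rho>] .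
    have "{x. x \<notin> A \<and> swap \<rho> \<tau> x} = {x. x \<notin> A \<and> \<tau> x}" by (auto simp: swap_def)
    moreover have "swap \<rho> \<tau> \<in> configs" "\<tau> \<in> configs" using s \<tau> cl_subset by blast+
    ultimately show ?thesis
      using cards[OF s] cards[OF \<tau>] lam_pos by (simp add: wt_eq K_def power_add)
  qed
  have bij: "bij_betw (swap \<rho>) (cl B \<sigma>) (cl B \<rho>)"
    by (rule bij_betw_byWitness[where f' = "swap \<sigma>"])
      (use inv swap_cl \<rho>c \<sigma> off\<rho> in auto)
  have swap_u: "u (swap \<rho> \<tau>) = u \<tau>" if "\<tau> \<in> cl B \<sigma>" for \<tau>
  proof (rule u)
    show "\<tau> \<in> configs" using that cl_subset by blast
    show "swap \<rho> \<tau> \<in> cl A \<tau>"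
      using swap_cl[OF that \<rho>c off\<rho>] cl_subset by (auto simp: cl_def swap_def)
  qed
  have "(\<Sum>\<tau>\<in>cl B \<rho>. wt \<tau> * g \<tau>) = (\<Sum>\<tau>\<in>cl B \<sigma>. wt (swap \<rho> \<tau>) * g (swap \<rho> \<tau>))" for g
    by (rule sum.reindex_bij_betw[OF bij, symmetric])
  also have "(\<Sum>\<tau>\<in>cl B \<sigma>. wt (swap \<rho> \<tau>) * g (swap \<rho> \<tau>)) = K * (\<Sum>\<tau>\<in>cl B \<sigma>. wt \<tau> * g (swap \<rho> \<tau>))" for g
    by (simp add: sum_distrib_left swap_wt mult_ac)
  finally have sums: "(\<Sum>\<tau>\<in>cl B \<rho>. wt \<tau> * g \<tau>) = K * (\<Sum>\<tau>\<in>cl B \<sigma>. wt \<tau> * g (swap \<rho> \<tau>))" for g .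
  have "(\<Sum>\<tau>\<in>cl B \<rho>. wt \<tau> * u \<tau>) = K * (\<Sum>\<tau>\<in>cl B \<sigma>. wt \<tau> * u \<tau>)"
    unfolding sums by (simp add: swap_u)
  moreover have "mass B \<rho> = K * mass B \<sigma>"
    using sums[of "\<lambda>_. 1"] by (simp add: mass_def)
  ultimately show ?thesis using Kpos by (simp add: av_def)
qed

lemma cond_ent_disconnected:
  assumes f: "\<And>\<sigma>. \<sigma> \<in> configs \<Longrightarrow> f \<sigma> > 0" and "A \<inter> B = {}" "A \<union> B \<subseteq> pverts G"
    and "\<And>x y. x \<in> A \<Longrightarrow> y \<in> B \<Longrightarrow> (x, y) \<notin> parcs G"
  shows "cond_ent (A \<union> B) f \<le> cond_ent A f + cond_ent B f"
proof -
  have "nearly_indep (A \<union> B) A B (1 - 1)"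
    by (rule nearly_indepI) (auto simp: av_indep[OF assms(2-4)])
  then show ?thesis
    using cond_ent_factorization[of f A "A \<union> B" B 0] f by simp
qed

text \<open>Approximate tensorization of entropy. The constant may vary with the vertex, because in
  the ball cutting it depends on how many annuli have contained the vertex.\<close>

definition tensorizes :: "'a set \<Rightarrow> ('a \<Rightarrow> real) \<Rightarrow> bool" where
  "tensorizes U k \<longleftrightarrow> (\<forall>f. (\<forall>\<sigma>\<in>configs. f \<sigma> > 0) \<longrightarrow> cond_ent U f \<le> (\<Sum>v\<in>U. k v * cond_ent {v} f))"

lemma tensorizes_mono:
  assumes "tensorizes U k" "\<And>v. v \<in> U \<Longrightarrow> k v \<le> k' v"
  shows "tensorizes U k'"
  unfolding tensorizes_def
proof (intro allI impI)
  fix f :: "('a \<Rightarrow> bool) \<Rightarrow> real" assume f: "\<forall>\<sigma>\<in>configs. f \<sigma> > 0"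
  have "cond_ent U f \<le> (\<Sum>v\<in>U. k v * cond_ent {v} f)"
    using assms(1) f by (simp add: tensorizes_def)
  also have "\<dots> \<le> (\<Sum>v\<in>U. k' v * cond_ent {v} f)"
    using f assms(2) by (intro sum_mono mult_right_mono cond_ent_nonneg) auto
  finally show "cond_ent U f \<le> (\<Sum>v\<in>U. k' v * cond_ent {v} f)" .
qed

lemma cond_ent_empty: "(\<And>\<sigma>. \<sigma> \<in> configs \<Longrightarrow> f \<sigma> > 0) \<Longrightarrow> cond_ent {} f = 0"
proof -
  assume f: "\<And>\<sigma>. \<sigma> \<in> configs \<Longrightarrow> f \<sigma> > 0"
  have "av {} f \<sigma> = f \<sigma>" if "\<sigma> \<in> configs" for \<sigma>
    by (rule av_local[OF that]) (auto simp: cl_def fun_eq_iff intro!: arg_cong[where f = f])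
  then show ?thesis using f by (force simp: cond_ent_def intro!: sum.neutral)
qed

lemma tensorizes_empty: "tensorizes {} k"
  by (auto simp: tensorizes_def cond_ent_empty)

lemma tensorizes_disconnected:
  assumes "A \<inter> B = {}" "A \<union> B \<subseteq> pverts G" "\<And>x y. x \<in> A \<Longrightarrow> y \<in> B \<Longrightarrow> (x, y) \<notin> parcs G"
    and "tensorizes A k" "tensorizes B k"
  shows "tensorizes (A \<union> B) k"
  unfolding tensorizes_def
proof (intro allI impI)
  fix f :: "('a \<Rightarrow> bool) \<Rightarrow> real" assume f: "\<forall>\<sigma>\<in>configs. f \<sigma> > 0"
  have fin: "finite A" "finite B" by (rule finite_subset[OF _ pair_finite_verts]; use assms(2) in blast)+
  have "cond_ent (A \<union> B) f \<le> cond_ent A f + cond_ent B f"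
    using f assms by (intro cond_ent_disconnected) auto
  also have "\<dots> \<le> (\<Sum>v\<in>A. k v * cond_ent {v} f) + (\<Sum>v\<in>B. k v * cond_ent {v} f)"
    using assms(4,5) f by (auto simp: tensorizes_def intro: add_mono)
  also have "\<dots> = (\<Sum>v\<in>A \<union> B. k v * cond_ent {v} f)"
    using fin assms(1) by (simp add: sum.union_disjoint)
  finally show "cond_ent (A \<union> B) f \<le> (\<Sum>v\<in>A \<union> B. k v * cond_ent {v} f)" .
qed

text \<open>Splitting along a set that no arc leaves costs nothing, so it suffices to know the
  connected subsets.\<close>

lemma tensorizes_components:
  assumes "A \<subseteq> pverts G"
    and "\<And>X. X \<subseteq> A \<Longrightarrow> set_connected (parcs G) X \<Longrightarrow> tensorizes X k"
  shows "tensorizes A k"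
  using assms
proof (induction "card A" arbitrary: A rule: less_induct)
  case less
  have fin: "finite A" by (rule finite_subset[OF _ pair_finite_verts]) (use less.prems(1) in blast)
  show ?case
  proof (cases "set_connected (parcs G) A")
    case True
    then show ?thesis using less.prems(2) by blast
  next
    case False
    then obtain Y where Y: "Y \<subset> A" "Y \<noteq> {}" "\<And>u v. u \<in> Y \<Longrightarrow> v \<in> A - Y \<Longrightarrow> (u, v) \<notin> parcs G"
      unfolding set_connected_def by blast
    have "card Y < card A" "card (A - Y) < card A"
      using Y fin by (auto intro!: psubset_card_mono)
    have sub: "tensorizes Z k" if "Z \<subseteq> A" "card Z < card A" for Z
    proof (rule less.hyps[OF that(2)])
      show "Z \<subseteq> pverts G" using that(1) less.prems(1) by (rule subset_trans)
      show "tensorizes X k" if "X \<subseteq> Z" "set_connected (parcs G) X" for X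
        using less.prems(2)[OF subset_trans[OF that(1) \<open>Z \<subseteq> A\<close>] that(2)] .
    qed
    have "tensorizes (Y \<union> (A - Y)) k"
    proof (rule tensorizes_disconnected)
      show "tensorizes Y k" "tensorizes (A - Y) k"
        using Y(1) \<open>card Y < card A\<close> \<open>card (A - Y) < card A\<close> by (auto intro!: sub)
    qed (use Y less.prems(1) in auto)
    moreover have "Y \<union> (A - Y) = A" using Y by auto
    ultimately show ?thesis by simp
  qed
qed

end

context hardcore_ssm
begin

lemma tensorizes_separator:
  assumes "S \<subseteq> U" "U \<subseteq> pverts G" "l \<ge> 1"
    and small: "16 * (real (card S) * kap l) \<le> 1"
    and t: "tensorizes (U - S) k1" "tensorizes (U \<inter> nbhd l S) k2"
  shows "tensorizes U (\<lambda>v. (1 + 8 * (real (card S) * kap l)) *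
    ((if v \<in> S then 0 else k1 v) + (if v \<in> nbhd l S then k2 v else 0)))"
  unfolding tensorizes_def
proof (intro allI impI)
  fix f :: "('a \<Rightarrow> bool) \<Rightarrow> real" assume f: "\<forall>\<sigma>\<in>configs. f \<sigma> > 0"
  define a where "a = 1 + 8 * (real (card S) * kap l)"
  have "a \<ge> 0" using kap_nonneg by (simp add: a_def)
  have fin: "finite U" by (rule finite_subset[OF _ pair_finite_verts]) (use assms(2) in blast)
  have "cond_ent U f \<le> a * (cond_ent (U - S) f + cond_ent (U \<inter> nbhd l S) f)"
    unfolding a_def using f by (intro cond_ent_separator assms) auto
  also have "\<dots> \<le> a * ((\<Sum>v\<in>U - S. k1 v * cond_ent {v} f) + (\<Sum>v\<in>U \<inter> nbhd l S. k2 v * cond_ent {v} f))"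
    using t f \<open>a \<ge> 0\<close> unfolding tensorizes_def by (intro mult_left_mono add_mono) auto
  also have "(\<Sum>v\<in>U - S. k1 v * cond_ent {v} f) = (\<Sum>v\<in>U. if v \<in> S then 0 else k1 v * cond_ent {v} f)"
    using fin by (intro sum.mono_neutral_cong_left) auto
  also have "(\<Sum>v\<in>U \<inter> nbhd l S. k2 v * cond_ent {v} f) = (\<Sum>v\<in>U. if v \<in> nbhd l S then k2 v * cond_ent {v} f else 0)"
    using fin by (intro sum.mono_neutral_cong_left) auto
  also have "a * ((\<Sum>v\<in>U. if v \<in> S then 0 else k1 v * cond_ent {v} f) +
        (\<Sum>v\<in>U. if v \<in> nbhd l S then k2 v * cond_ent {v} f else 0)) =
      (\<Sum>v\<in>U. a * ((if v \<in> S then 0 else k1 v) + (if v \<in> nbhd l S then k2 v else 0)) * cond_ent {v} f)"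
    unfolding sum.distrib[symmetric] sum_distrib_left by (intro sum.cong refl) (simp add: algebra_simps)
  finally show "cond_ent U f \<le> (\<Sum>v\<in>U. (1 + 8 * (real (card S) * kap l)) *
    ((if v \<in> S then 0 else k1 v) + (if v \<in> nbhd l S then k2 v else 0)) * cond_ent {v} f)"
    by (simp add: a_def)
qed

end

section \<open>Cutting into pieces of small treewidth\<close>

context pair_graph
begin

lemma finite_out: "finite {x. (s, x) \<in> parcs G}"
  by (rule finite_subset[OF _ pair_finite_verts]) (use in_arcsD2 in auto)

lemma card_out_le: "card {x. (s, x) \<in> parcs G} \<le> max_degree G"
proof (cases "s \<in> pverts G")
  case True
  have "{e \<in> parcs G. fst e = s} = Pair s ` {x. (s, x) \<in> parcs G}" by auto
  then have "card {x. (s, x) \<in> parcs G} = out_degree (with_proj G) s"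
    by (simp add: out_degree_def out_arcs_def card_image inj_on_def)
  also have "\<dots> \<le> max_degree G"
    unfolding max_degree_def using True pair_finite_verts by (intro cSUP_upper) auto
  finally show ?thesis .
next
  case False
  then have "{x. (s, x) \<in> parcs G} = {}" using in_arcsD1 by auto
  then show ?thesis by simp
qed

lemma dist_le_Suc_eq:
  "{x. dist_le G (Suc l) s x} = {x. dist_le G l s x} \<union> (\<Union>y\<in>{x. dist_le G l s x}. {x. (y, x) \<in> parcs G})"
proof (intro set_eqI iffI)
  fix x assume "x \<in> {x. dist_le G (Suc l) s x}"
  then obtain j where j: "j \<le> Suc l" "(s, x) \<in> parcs G ^^ j" by (auto simp: dist_le_def)
  show "x \<in> {x. dist_le G l s x} \<union> (\<Union>y\<in>{x. dist_le G l s x}. {x. (y, x) \<in> parcs G})"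
  proof (cases "j \<le> l")
    case True
    then show ?thesis using j by (auto simp: dist_le_def)
  next
    case False
    then have "(s, x) \<in> parcs G ^^ Suc l" using j by (metis le_SucE)
    then obtain y where "(s, y) \<in> parcs G ^^ l" "(y, x) \<in> parcs G" by (meson relpow_Suc_E)
    then show ?thesis by (auto simp: dist_le_def)
  qed
next
  fix x assume "x \<in> {x. dist_le G l s x} \<union> (\<Union>y\<in>{x. dist_le G l s x}. {x. (y, x) \<in> parcs G})"
  then show "x \<in> {x. dist_le G (Suc l) s x}"
    using dist_le_mono[of G l s x "Suc l"] dist_le_trans[of G l s _ 1 x] dist_le_arc[of _ x G 1] by auto
qed

lemma card_ball: "finite {x. dist_le G l s x} \<and> card {x. dist_le G l s x} \<le> (max_degree G + 1) ^ l"
proof (induction l)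
  case 0
  have "{x. dist_le G 0 s x} = {s}" by (auto simp: dist_le_def)
  then show ?case by simp
next
  case (Suc l)
  let ?B = "{x. dist_le G l s x}"
  have fin: "finite ?B" using Suc by simp
  have "card {x. dist_le G (Suc l) s x} \<le> card ?B + card (\<Union>y\<in>?B. {x. (y, x) \<in> parcs G})"
    unfolding dist_le_Suc_eq by (rule card_Un_le)
  also have "card (\<Union>y\<in>?B. {x. (y, x) \<in> parcs G}) \<le> (\<Sum>y\<in>?B. card {x. (y, x) \<in> parcs G})"
    by (rule card_UN_le[OF fin])
  also have "\<dots> \<le> (\<Sum>y\<in>?B. max_degree G)" by (intro sum_mono card_out_le)
  also have "card ?B + (\<Sum>y\<in>?B. max_degree G) = card ?B * (max_degree G + 1)" by simp
  also have "\<dots> \<le> (max_degree G + 1) ^ l * (max_degree G + 1)"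
    using Suc by (intro mult_right_mono) auto
  finally have "card {x. dist_le G (Suc l) s x} \<le> (max_degree G + 1) ^ Suc l" by (simp add: mult.commute)
  moreover have "finite {x. dist_le G (Suc l) s x}"
    unfolding dist_le_Suc_eq using fin finite_out by simp
  ultimately show ?case by simp
qed

lemma relpow_sym: "(x, y) \<in> parcs G ^^ n \<Longrightarrow> (y, x) \<in> parcs G ^^ n"
proof (induction n arbitrary: y)
  case 0
  then show ?case by simp
next
  case (Suc n)
  then obtain z where z: "(x, z) \<in> parcs G ^^ n" "(z, y) \<in> parcs G" by (meson relpow_Suc_E)
  then show ?case using Suc.IH[OF z(1)] symD[OF sym_parcs z(2)] by (meson relpow_Suc_I2)
qed

lemma dist_le_sym: "dist_le G l x y \<Longrightarrow> dist_le G l y x"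
  using relpow_sym by (auto simp: dist_le_def)

lemma dist_le_verts: "dist_le G l v x \<Longrightarrow> v \<in> pverts G \<Longrightarrow> x \<in> pverts G"
proof -
  have "(v, x) \<in> parcs G ^^ n \<Longrightarrow> v \<in> pverts G \<Longrightarrow> x \<in> pverts G" for n
    by (induction n arbitrary: x) (auto dest: in_arcsD2)
  then show "dist_le G l v x \<Longrightarrow> v \<in> pverts G \<Longrightarrow> x \<in> pverts G" by (auto simp: dist_le_def)
qed

text \<open>The ball is taken in all of \<open>G\<close>. A subset of it may itself have large or
  infinite diameter, whereas a decomposition of the whole ball yields separators for all its
  subsets.\<close>

definition ball_graph :: "nat \<Rightarrow> 'a \<Rightarrow> 'a pair_pre_digraph" where
  "ball_graph R v = \<lparr> pverts = {x. dist_le G R v x},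
     parcs = {(x, y). (x, y) \<in> parcs G \<and> dist_le G R v x \<and> dist_le G R v y} \<rparr>"

lemma pair_graph_ball_graph: "pair_graph (ball_graph R v)"
proof -
  have "finite {x. dist_le G R v x}" using card_ball by blast
  moreover have "finite (parcs (ball_graph R v))"
    by (rule finite_subset[OF _ pair_finite_arcs]) (auto simp: ball_graph_def)
  moreover have "sym (parcs (ball_graph R v))"
    using symD[OF sym_parcs] by (auto simp: ball_graph_def intro!: symI)
  ultimately show ?thesis
    using no_loops' by unfold_locales (auto simp: ball_graph_def symmetric_def)
qed

lemma subgraph_ball_graph: "v \<in> pverts G \<Longrightarrow> subgraph (with_proj (ball_graph R v)) (with_proj G)"
proof -
  assume v: "v \<in> pverts G"
  interpret B: pair_graph "ball_graph R v" by (rule pair_graph_ball_graph)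
  show ?thesis
    unfolding subgraph_def compatible_def
    using dist_le_verts[OF _ v] wf_digraph_axioms B.wf_digraph_axioms by (auto simp: ball_graph_def)
qed

text \<open>Walks of length at most \<open>R\<close> from the centre stay in the ball, so any two of
  its vertices are joined through the centre.\<close>

lemma graph_diam_ball_graph: "graph_diam (ball_graph R v) \<le> enat (2 * R)"
proof -
  interpret B: pair_graph "ball_graph R v" by (rule pair_graph_ball_graph)
  have center: "j \<le> R \<Longrightarrow> (v, x) \<in> parcs G ^^ j \<Longrightarrow> (v, x) \<in> parcs (ball_graph R v) ^^ j" for j x
  proof (induction j arbitrary: x)
    case 0
    then show ?case by simp
  next
    case (Suc j)
    then obtain y where y: "(v, y) \<in> parcs G ^^ j" "(y, x) \<in> parcs G" by (meson relpow_Suc_E)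
    have "dist_le G R v y" "dist_le G R v x"
      unfolding dist_le_def using Suc.prems y(1) by (blast intro: Suc_leD)+
    then have "(y, x) \<in> parcs (ball_graph R v)" using y(2) by (simp add: ball_graph_def)
    then show ?case using Suc.IH[OF _ y(1)] Suc.prems(1) by (auto intro: relpow_Suc_I)
  qed
  have "graph_dist (ball_graph R v) x y \<le> enat (2 * R)"
    if x: "x \<in> pverts (ball_graph R v)" and y: "y \<in> pverts (ball_graph R v)" for x y
  proof -
    obtain i j where ij: "i \<le> R" "(v, x) \<in> parcs G ^^ i" "j \<le> R" "(v, y) \<in> parcs G ^^ j"
      using x y by (auto simp: ball_graph_def dist_le_def)
    have "(x, y) \<in> parcs (ball_graph R v) ^^ (i + j)"
      using B.relpow_sym[OF center[OF ij(1,2)]] center[OF ij(3,4)] by (rule relpow_trans)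
    then obtain p where "B.awalk x p y" "length p = i + j"
      using B.relpow_imp_awalk[OF _ x] by blast
    then have "graph_dist (ball_graph R v) x y \<le> enat (i + j)"
      unfolding graph_dist_def by (intro INF_lower2[of p]) auto
    also have "\<dots> \<le> enat (2 * R)" using ij by simp
    finally show ?thesis .
  qed
  then show ?thesis unfolding graph_diam_def by (intro SUP_least)
qed

lemma small_bag_decomposition:
  assumes tw: "poly_bounded_local_treewidth G a d" and "a > 0" "d > 0" and v: "v \<in> pverts G"
  obtains T B where "tree_decomposition (ball_graph R v) T B"
    "\<And>t. t \<in> pverts T \<Longrightarrow> real (card (B t)) \<le> a * real (2 * R) powr d + 1"
proof -
  let ?H = "ball_graph R v"
  obtain k where k: "graph_diam ?H = enat k" "k \<le> 2 * R"
    using graph_diam_ball_graph[of R v] by (cases "graph_diam ?H") auto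
  have "real (treewidth ?H) \<le> a * real k powr d"
    using tw pair_graph_ball_graph subgraph_ball_graph[OF v] k(1)
    unfolding poly_bounded_local_treewidth_def by (metis enat.simps(4))
  also have "\<dots> \<le> a * real (2 * R) powr d"
    using k(2) assms by (intro mult_left_mono powr_mono2) auto
  finally have w: "real (treewidth ?H) \<le> a * real (2 * R) powr d" .
  have "\<exists>T B. tree_decomposition ?H T B \<and> decomposition_width T B = treewidth ?H"
    unfolding treewidth_def
    by (rule LeastI_ex) (use ex_tree_decomposition[OF pair_graph_ball_graph] in blast)
  then obtain T B where TB: "tree_decomposition ?H T B" "decomposition_width T B = treewidth ?H" by blast
  interpret T: pair_graph T
    using TB(1) by (simp add: tree_decomposition_def undirected_tree_def)
  have "card (B t) \<le> decomposition_width T B + 1" if "t \<in> pverts T" for t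
  proof -
    have "card (B t) \<le> Max ((\<lambda>t. card (B t)) ` pverts T)"
      using that T.pair_finite_verts by (intro Max_ge) auto
    then show ?thesis by (simp add: decomposition_width_def)
  qed
  then have "real (card (B t)) \<le> a * real (2 * R) powr d + 1" if "t \<in> pverts T" for t
    using that w TB(2) by fastforce
  with TB(1) that show thesis by blast
qed

lemma ball_balanced_separator:
  assumes "tree_decomposition (ball_graph R v) T B" "U \<subseteq> {x. dist_le G R v x}"
  obtains t where "t \<in> pverts T"
    "\<And>X. X \<subseteq> U - B t \<Longrightarrow> set_connected (parcs G) X \<Longrightarrow> 2 * card X \<le> card U"
proof -
  have "U \<subseteq> pverts (ball_graph R v)" using assms(2) by (simp add: ball_graph_def)
  then have "\<exists>t\<in>pverts T. \<forall>X. X \<subseteq> U - B t \<and> set_connected (parcs (ball_graph R v)) X \<longrightarrow> 2 * card X \<le> card U"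
    by (rule tree_decomposition_balanced_bag[OF pair_graph_ball_graph assms(1)])
  then obtain t where t: "t \<in> pverts T"
    "\<forall>X. X \<subseteq> U - B t \<and> set_connected (parcs (ball_graph R v)) X \<longrightarrow> 2 * card X \<le> card U"
    by (elim bexE)
  show thesis
  proof (rule that[OF t(1) t(2)[rule_format]], rule conjI)
    fix X assume X: "X \<subseteq> U - B t" "set_connected (parcs G) X"
    show "set_connected (parcs (ball_graph R v)) X"
      unfolding set_connected_def
    proof (intro allI impI)
      fix Y assume Y: "Y \<subset> X \<and> Y \<noteq> {}"
      then obtain x y where xy: "x \<in> Y" "y \<in> X - Y" "(x, y) \<in> parcs G"
        using X(2) unfolding set_connected_def by blast
      moreover have "dist_le G R v x" "dist_le G R v y"
        using xy Y X(1) assms(2) by auto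
      ultimately show "\<exists>u\<in>Y. \<exists>w\<in>X - Y. (u, w) \<in> parcs (ball_graph R v)"
        by (intro bexI[of _ x] bexI[of _ y]) (auto simp: ball_graph_def)
    qed
    show "X \<subseteq> U - B t" by (rule X(1))
  qed
qed

end

section \<open>Recursion over separators and ball cutting\<close>

context hardcore_ssm
begin

lemma card_nbhd:
  assumes "finite S"
  shows "card (nbhd l S) \<le> card S * (max_degree G + 1) ^ l" "finite (nbhd l S)"
proof -
  have eq: "nbhd l S = (\<Union>s\<in>S. {x. dist_le G l s x})" by (auto simp: nbhd_def)
  have "card (nbhd l S) \<le> (\<Sum>s\<in>S. card {x. dist_le G l s x})"
    unfolding eq by (rule card_UN_le[OF assms])
  also have "\<dots> \<le> (\<Sum>s\<in>S. (max_degree G + 1) ^ l)"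
    using card_ball by (intro sum_mono) auto
  finally show "card (nbhd l S) \<le> card S * (max_degree G + 1) ^ l" by simp
  show "finite (nbhd l S)" unfolding eq using assms card_ball by blast
qed

text \<open>\<open>T\<close> is a binary logarithm of the size; the recursion for \<open>K\<close>
  passes from \<open>T\<close> to a multiple of log T.\<close>

definition tensor_bound :: "nat \<Rightarrow> real \<Rightarrow> bool" where
  "tensor_bound T K \<longleftrightarrow> (\<forall>U. U \<subseteq> pverts G \<and> card U < 2 ^ T \<longrightarrow> tensorizes U (\<lambda>_. K))"

lemma tensor_boundD: "tensor_bound T K \<Longrightarrow> U \<subseteq> pverts G \<Longrightarrow> card U < 2 ^ T \<Longrightarrow> tensorizes U (\<lambda>_. K)"
  by (simp add: tensor_bound_def)

lemma tensor_bound_mono: "tensor_bound T K \<Longrightarrow> T' \<le> T \<Longrightarrow> K \<le> K' \<Longrightarrow> tensor_bound T' K'"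
  unfolding tensor_bound_def
  by (meson tensorizes_mono order.strict_trans2 power_increasing one_le_numeral)

text \<open>Induction over the binary logarithm \<open>j\<close> of the size, with one decomposition
  of the ball for all levels. Removing the separator leaves connected parts of at most half the
  size, and its neighbourhood has fewer than \<open>2 ^ T'\<close> vertices, so the assumed
  \<open>K\<close> pays for it. A level thus costs one more \<open>K\<close> and one more error
  factor.\<close>

lemma tensorizes_small_treewidth:
  assumes v: "v \<in> pverts G" and td: "tree_decomposition (ball_graph R v) T0 B"
    and bags: "\<And>t. t \<in> pverts T0 \<Longrightarrow> card (B t) \<le> s"
    and "l \<ge> 1" and small: "16 * (real s * kap l) \<le> 1"
    and K: "tensor_bound T' K" "K \<ge> 0" "s * (max_degree G + 1) ^ l < 2 ^ T'"
    and "U \<subseteq> {x. dist_le G R v x}" "card U < 2 ^ j"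
  shows "tensorizes U (\<lambda>_. (1 + 8 * (real s * kap l)) ^ j * real j * K)"
  using assms(9,10)
proof (induction j arbitrary: U)
  case 0
  have "finite U" by (rule finite_subset[OF 0(1)]) (simp add: card_ball)
  then have "U = {}" using 0 by simp
  then show ?case by (simp add: tensorizes_empty)
next
  case (Suc j)
  define b where "b = 1 + 8 * (real s * kap l)"
  have b1: "b \<ge> 1" using kap_nonneg by (simp add: b_def)
  have finU: "finite U" by (rule finite_subset[OF Suc.prems(1)]) (simp add: card_ball)
  have UV: "U \<subseteq> pverts G" using Suc.prems(1) dist_le_verts[OF _ v] by blast
  obtain t where t: "t \<in> pverts T0"
    "\<And>X. X \<subseteq> U - B t \<Longrightarrow> set_connected (parcs G) X \<Longrightarrow> 2 * card X \<le> card U"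
    using ball_balanced_separator[OF td Suc.prems(1)] by blast
  define S where "S = B t \<inter> U"
  have S: "S \<subseteq> U" "finite S" using finU by (auto simp: S_def)
  interpret H: pair_graph "ball_graph R v" by (rule pair_graph_ball_graph)
  have "finite (B t)"
  proof (rule finite_subset[OF _ H.pair_finite_verts])
    show "B t \<subseteq> pverts (ball_graph R v)" using td t(1) by (auto simp: tree_decomposition_def)
  qed
  then have "card S \<le> card (B t)" unfolding S_def by (intro card_mono) auto
  then have cS: "card S \<le> s" using bags[OF t(1)] by linarith
  have le: "real (card S) * kap l \<le> real s * kap l"
    using cS kap_nonneg by (intro mult_right_mono) auto
  have 1: "tensorizes (U - S) (\<lambda>_. b ^ j * real j * K)"
  proof (rule tensorizes_components)
    show "U - S \<subseteq> pverts G" using UV by blast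
    fix X assume X: "X \<subseteq> U - S" "set_connected (parcs G) X"
    have "X \<subseteq> U - B t" using X(1) by (auto simp: S_def)
    then have "2 * card X \<le> card U" using X(2) by (rule t(2))
    then have "card X < 2 ^ j" using Suc.prems(2) by simp
    moreover have "X \<subseteq> {x. dist_le G R v x}" using X(1) Suc.prems(1) by blast
    ultimately show "tensorizes X (\<lambda>_. b ^ j * real j * K)"
      unfolding b_def by (intro Suc.IH)
  qed
  have "card (U \<inter> nbhd l S) \<le> card (nbhd l S)"
    using card_nbhd(2)[OF S(2)] by (intro card_mono) auto
  also have "\<dots> \<le> card S * (max_degree G + 1) ^ l" by (rule card_nbhd(1)[OF S(2)])
  also have "\<dots> \<le> s * (max_degree G + 1) ^ l" using cS by (intro mult_right_mono) auto
  also have "\<dots> < 2 ^ T'" by (rule K(3))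
  finally have 2: "tensorizes (U \<inter> nbhd l S) (\<lambda>_. K)"
    using UV by (intro tensor_boundD[OF K(1)]) auto
  have 3: "tensorizes U (\<lambda>v. (1 + 8 * (real (card S) * kap l)) *
    ((if v \<in> S then 0 else b ^ j * real j * K) + (if v \<in> nbhd l S then K else 0)))"
    using le small by (intro tensorizes_separator[OF S(1) UV \<open>l \<ge> 1\<close> _ 1 2]) linarith
  have "tensorizes U (\<lambda>_. b ^ Suc j * real (Suc j) * K)"
  proof (rule tensorizes_mono[OF 3])
    fix x
    have K1: "K \<le> b ^ j * K" using b1 K(2) by (simp add: mult_le_cancel_right1)
    have "(if x \<in> S then 0 else b ^ j * real j * K) + (if x \<in> nbhd l S then K else 0)
        \<le> b ^ j * real j * K + b ^ j * K"
      using K1 K(2) b1 by (intro add_mono) auto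
    then have "(1 + 8 * (real (card S) * kap l)) *
      ((if x \<in> S then 0 else b ^ j * real j * K) + (if x \<in> nbhd l S then K else 0))
      \<le> b * (b ^ j * real j * K + b ^ j * K)"
      using le b1 K(2) by (intro mult_mono) (auto simp: b_def)
    then show "(1 + 8 * (real (card S) * kap l)) *
      ((if x \<in> S then 0 else b ^ j * real j * K) + (if x \<in> nbhd l S then K else 0))
      \<le> b ^ Suc j * real (Suc j) * K"
      by (simp add: algebra_simps)
  qed
  then show ?case by (simp only: b_def)
qed

text \<open>
  Balls are cut off one at a time. The radius is chosen so that the annulus around the cutting
  sphere weighs no more than the inner ball, a vertex that has been in \<open>c\<close> annuli having weight
  \<open>2 ^ c\<close>. So the total weight of the remaining graph never increases, and no vertex can be in
  more than logarithmically many annuli.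
\<close>

lemma tensorizes_ball_cutting:
  assumes "l \<ge> 1" and small: "16 * (2 ^ T * kap l) \<le> 1" and K_nonneg: "K \<ge> 0"
    and pieces: "\<And>v X. v \<in> pverts G \<Longrightarrow> X \<subseteq> {x. dist_le G ((T + 1) * (2 * l + 1)) v x} \<Longrightarrow>
      card X < 2 ^ T \<Longrightarrow> tensorizes X (\<lambda>_. K)"
    and "U \<subseteq> pverts G" "card U < 2 ^ T" "(\<Sum>u\<in>U. 2 ^ c u) \<le> (2 ^ T :: nat)"
  shows "tensorizes U (\<lambda>u. (1 + 8 * (2 ^ T * kap l)) ^ card U * K * (real T + 2 - real (c u)))"
  using assms(5-7)
proof (induction "card U" arbitrary: U c rule: less_induct)
  case less
  have finU: "finite U" by (rule finite_subset[OF less.prems(1) pair_finite_verts])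
  define b where "b = 1 + 8 * (2 ^ T * kap l)"
  have b1: "b \<ge> 1" using kap_nonneg by (simp add: b_def)
  show ?case
  proof (cases "U = {}")
    case True
    then show ?thesis by (simp add: tensorizes_empty)
  next
    case False
    then obtain v where v: "v \<in> U" by blast
    then have vG: "v \<in> pverts G" using less.prems(1) by blast
    define W :: "'a set \<Rightarrow> nat" where "W X = (\<Sum>u\<in>X. 2 ^ c u)" for X
    have W_mono: "W X \<le> W Y" if "X \<subseteq> Y" "Y \<subseteq> U" for X Y
        unfolding W_def using that finite_subset[OF that(2) finU] by (intro sum_mono2) auto
    have cT: "c u \<le> T" if "u \<in> U" for u
    proof -
      have "2 ^ c u = W {u}" by (simp add: W_def)
      also have "\<dots> \<le> W U" using that by (intro W_mono) auto
      also have "\<dots> \<le> 2 ^ T" using less.prems(3) by (simp add: W_def)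
      finally show ?thesis by simp
    qed
    \<comment> \<open>Concentric balls in the metric of \<open>G\<close>, restricted to
      \<open>U\<close>. A shell of width \<open>2 * l + 1\<close> has room for a sphere and
      \<open>l\<close> layers on either side.\<close>
    define D where "D j = {u \<in> U. dist_le G (j * (2 * l + 1)) v u}" for j
    have D_sub: "D j \<subseteq> U" for j by (auto simp: D_def)
    \<comment> \<open>Otherwise the weight, which is at least 1 at \<open>v\<close>, would more than
      double \<open>T + 1\<close> times and exceed the total of \<open>2 ^ T\<close>.\<close>
    have "\<exists>j\<le>T. W (D (Suc j)) \<le> 2 * W (D j)"
    proof (rule ccontr)
      assume neg: "\<not> ?thesis"
      have "2 ^ j \<le> W (D j)" if "j \<le> Suc T" for j
        using that
      proof (induction j)
        case 0
        have "1 \<le> W {v}" by (simp add: W_def)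
        also have "\<dots> \<le> W (D 0)" using v by (intro W_mono) (auto simp: D_def dist_le_refl)
        finally show ?case by simp
      next
        case (Suc j)
        then have "\<not> W (D (Suc j)) \<le> 2 * W (D j)" using neg by (metis Suc_le_mono)
        then show ?case using Suc by simp
      qed
      from this[of "Suc T"] have "2 ^ Suc T \<le> W U" using W_mono[OF D_sub, of "Suc T"] by simp
      moreover have "W U \<le> 2 ^ T" "0 < (2 ^ T :: nat)" using less.prems(3) by (simp_all add: W_def)
      ultimately show False by simp
    qed
    then obtain j where j: "j \<le> T" "W (D (Suc j)) \<le> 2 * W (D j)" by blast
    \<comment> \<open>The sphere of radius \<open>q + 1\<close> is the middle of the shell: what is
      within \<open>l\<close> of it lies outside \<open>D j\<close> and inside
      \<open>D (Suc j)\<close>.\<close>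
    define q where "q = j * (2 * l + 1) + l"
    define L where "L = {u \<in> U. dist_le G q v u}"
    define S where "S = {u \<in> U. dist_le G (Suc q) v u \<and> \<not> dist_le G q v u}"
    define R where "R = {u \<in> U. \<not> dist_le G (Suc q) v u}"
    define N where "N = U \<inter> nbhd l S"
    have SU: "S \<subseteq> U" and RU: "R \<subseteq> U" and LU: "L \<subseteq> U" and NU: "N \<subseteq> U"
      by (auto simp: S_def R_def L_def N_def)
    have LR: "U - S = L \<union> R" "L \<inter> R = {}"
      using dist_le_mono[of G q v _ "Suc q"] by (auto simp: L_def S_def R_def)
    have N_sub: "N \<subseteq> D (Suc j) - D j"
    proof
      fix x assume "x \<in> N"
      then obtain s where s: "s \<in> S" "dist_le G l s x" "x \<in> U" by (auto simp: N_def nbhd_def)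
      have "dist_le G (Suc q + l) v x"
        using s by (intro dist_le_trans[of G "Suc q" v s l x]) (auto simp: S_def)
      then have "x \<in> D (Suc j)" using s(3) by (simp add: D_def q_def algebra_simps)
      moreover have "\<not> dist_le G (j * (2 * l + 1)) v x"
      proof
        assume "dist_le G (j * (2 * l + 1)) v x"
        then have "dist_le G q v s"
          unfolding q_def using dist_le_sym[OF s(2)] by (rule dist_le_trans)
        then show False using s(1) by (simp add: S_def)
      qed
      ultimately show "x \<in> D (Suc j) - D j" by (simp add: D_def)
    qed
    have rad: "Suc j * (2 * l + 1) \<le> (T + 1) * (2 * l + 1)" using j(1) by (intro mult_right_mono) auto
    have piece: "tensorizes X (\<lambda>_. K)" if "X \<subseteq> D (Suc j)" for X
    proof (rule pieces[OF vG])
      show "X \<subseteq> {x. dist_le G ((T + 1) * (2 * l + 1)) v x}"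
      proof
        fix x assume "x \<in> X"
        then have "x \<in> D (Suc j)" using that by (rule rev_subsetD)
        then have "dist_le G (Suc j * (2 * l + 1)) v x" unfolding D_def by blast
        from dist_le_mono[OF this rad] show "x \<in> {x. dist_le G ((T + 1) * (2 * l + 1)) v x}"
          by (rule CollectI)
      qed
      have "card X \<le> card U" using that D_sub finU by (intro card_mono) auto
      then show "card X < 2 ^ T" using less.prems(2) by linarith
    qed
    have LD: "L \<subseteq> D (Suc j)"
      using dist_le_mono[of G q v _ "Suc j * (2 * l + 1)"] by (auto simp: L_def D_def q_def)
    define c' where "c' u = (if u \<in> nbhd l S then c u + 1 else c u)" for u
    have "v \<notin> R" by (simp add: R_def dist_le_refl)
    then have Rlt: "card R < card U" using RU v finU by (intro psubset_card_mono) auto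
    \<comment> \<open>Doubling weights in the annulus adds at most the weight of \<open>D j\<close>.
      As \<open>D j\<close> is disjoint from \<open>R\<close>, what is added to \<open>R\<close> is
      outweighed by what the cut removes.\<close>
    have "(\<Sum>u\<in>R. 2 ^ c' u) = (\<Sum>u\<in>R. 2 ^ c u + (if u \<in> N then 2 ^ c u else 0 :: nat))"
      using RU by (intro sum.cong) (auto simp: c'_def N_def)
    also have "\<dots> = W R + W (R \<inter> N)"
      using finite_subset[OF RU finU] by (simp add: sum.distrib W_def sum.inter_restrict)
    also have "W (R \<inter> N) \<le> W (D (Suc j) - D j)"
      using N_sub D_sub by (intro W_mono) auto
    also have "W (D (Suc j) - D j) = W (D (Suc j)) - W (D j)"
    proof -
      have "D j \<subseteq> D (Suc j)"
        using dist_le_mono[of G "j * (2 * l + 1)" v _ "Suc j * (2 * l + 1)"] by (auto simp: D_def)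
      then have "W (D (Suc j)) = W (D (Suc j) - D j) + W (D j)"
        unfolding W_def using finite_subset[OF D_sub finU] by (intro sum.subset_diff)
      then show ?thesis by simp
    qed
    also have "\<dots> \<le> W (D j)" using j(2) by simp
    also have "W R + W (D j) = W (R \<union> D j)"
    proof -
      have "R \<inter> D j = {}"
        using dist_le_mono[of G "j * (2 * l + 1)" v _ "Suc q"] by (auto simp: R_def D_def q_def)
      then show ?thesis
        unfolding W_def using finite_subset[OF D_sub finU] finite_subset[OF RU finU]
        by (intro sum.union_disjoint[symmetric])
    qed
    also have "\<dots> \<le> W U" using RU D_sub by (intro W_mono) auto
    also have "\<dots> \<le> 2 ^ T" using less.prems(3) by (simp add: W_def)
    finally have wR: "(\<Sum>u\<in>R. 2 ^ c' u) \<le> (2 ^ T :: nat)" by simp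
    have tR: "tensorizes R (\<lambda>u. b ^ card R * K * (real T + 2 - real (c' u)))"
      unfolding b_def using less.prems Rlt RU wR by (intro less.hyps) auto
    define k1 where "k1 u = (if u \<in> L then K else b ^ card R * K * (real T + 2 - real (c' u)))" for u
    have t1: "tensorizes (U - S) k1"
      unfolding LR(1)
    proof (rule tensorizes_disconnected[OF LR(2)])
      show "L \<union> R \<subseteq> pverts G" using LU RU less.prems(1) by blast
      show "(x, y) \<notin> parcs G" if "x \<in> L" "y \<in> R" for x y
      proof
        assume "(x, y) \<in> parcs G"
        then have "dist_le G 1 x y" by (rule dist_le_arc) simp
        then have "dist_le G (q + 1) v y"
          using that(1) by (intro dist_le_trans[of G q v x 1 y]) (auto simp: L_def)
        then show False using that(2) by (simp add: R_def)
      qed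
      show "tensorizes L k1" by (rule tensorizes_mono[OF piece[OF LD]]) (simp add: k1_def)
      show "tensorizes R k1"
        by (rule tensorizes_mono[OF tR]) (use LR(2) in \<open>auto simp: k1_def\<close>)
    qed
    have t2: "tensorizes (U \<inter> nbhd l S) (\<lambda>_. K)"
      using N_sub by (intro piece) (auto simp: N_def)
    have "card S \<le> card U" using SU finU by (intro card_mono) auto
    then have "real (card S) \<le> 2 ^ T" using less.prems(2) by (simp flip: of_nat_le_iff)
    then have le: "real (card S) * kap l \<le> 2 ^ T * kap l"
      using kap_nonneg by (intro mult_right_mono) auto
    have t3: "tensorizes U (\<lambda>v. (1 + 8 * (real (card S) * kap l)) *
      ((if v \<in> S then 0 else k1 v) + (if v \<in> nbhd l S then K else 0)))"
      using le small by (intro tensorizes_separator[OF SU less.prems(1) \<open>l \<ge> 1\<close> _ t1 t2]) linarith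
    \<comment> \<open>A vertex of \<open>R\<close> in the annulus pays \<open>K\<close> now, and the
      increase of its \<open>c\<close> lowers its later share by at least as much. A vertex outside
      \<open>R\<close> pays at most \<open>2 * K\<close>, once for \<open>L\<close> and once for the
      annulus; the summand 2 covers this because \<open>c u \<le> T\<close>. Every cut removes at
      least \<open>v\<close>, so \<open>card U\<close> bounds the number of error factors.\<close>
    have "tensorizes U (\<lambda>u. b ^ card U * K * (real T + 2 - real (c u)))"
    proof (rule tensorizes_mono[OF t3])
      fix u assume u: "u \<in> U"
      define m where "m = card U - 1"
      have m: "card U = Suc m" "card R \<le> m" using Rlt by (auto simp: m_def)
      have bm: "b ^ card R \<le> b ^ m" "1 \<le> b ^ m" using m b1 by (auto intro: power_increasing)
      have cu: "2 \<le> real T + 2 - real (c u)" using cT[OF u] by simp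
      have K1: "K \<le> b ^ m * K" using bm K_nonneg by (simp add: mult_le_cancel_right1)
      have K2: "2 * K \<le> b ^ m * K * (real T + 2 - real (c u))"
      proof -
        have "K * 2 \<le> b ^ m * K * (real T + 2 - real (c u))"
          using K1 cu K_nonneg bm by (intro mult_mono) auto
        then show ?thesis by simp
      qed
      have "(if u \<in> S then 0 else k1 u) + (if u \<in> nbhd l S then K else 0)
          \<le> b ^ m * K * (real T + 2 - real (c u))"
      proof (cases "u \<in> R")
        case False
        then have "(if u \<in> S then 0 else k1 u) \<le> K"
          using LR(1) u K_nonneg by (auto simp: k1_def)
        then show ?thesis using K2 K_nonneg by (auto split: if_splits)
      next
        case True
        then have "u \<notin> L" "u \<notin> S" using LR by auto
        have "b ^ card R * K * (real T + 2 - real (c' u)) \<le> b ^ m * K * (real T + 2 - real (c' u))"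
          using bm K_nonneg cu by (intro mult_right_mono) (auto simp: c'_def)
        then show ?thesis
          using \<open>u \<notin> L\<close> \<open>u \<notin> S\<close> K1 by (auto simp: k1_def c'_def algebra_simps)
      qed
      then have "(1 + 8 * (real (card S) * kap l)) *
          ((if u \<in> S then 0 else k1 u) + (if u \<in> nbhd l S then K else 0))
        \<le> (1 + 8 * (real (card S) * kap l)) * (b ^ m * K * (real T + 2 - real (c u)))"
        using kap_nonneg by (intro mult_left_mono) auto
      also have "\<dots> \<le> b * (b ^ m * K * (real T + 2 - real (c u)))"
        using le K2 K_nonneg by (intro mult_right_mono) (auto simp: b_def)
      finally show "(1 + 8 * (real (card S) * kap l)) *
          ((if u \<in> S then 0 else k1 u) + (if u \<in> nbhd l S then K else 0))
        \<le> b ^ card U * K * (real T + 2 - real (c u))"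
        by (simp add: m(1) mult.assoc)
    qed
    then show ?thesis by (simp only: b_def)
  qed
qed

end

lemma one_plus_power_le_2:
  fixes x :: real
  assumes "x \<ge> 0" "real n * x \<le> 1 / 2"
  shows "(1 + x) ^ n \<le> 2"
proof -
  have "(1 + x) ^ n \<le> exp x ^ n" using assms by (intro power_mono) auto
  also have "\<dots> = exp (real n * x)" by (simp add: exp_of_nat_mult)
  also have "\<dots> \<le> exp (1 / 2)" using assms by simp
  also have "\<dots> \<le> 1 + 1 / 2 + (1 / 2)\<^sup>2" by (rule exp_bound) auto
  also have "\<dots> \<le> (2 :: real)" by (simp add: power2_eq_square)
  finally show ?thesis .
qed

context hardcore_ssm
begin

text \<open>The condition with \<open>4 ^ T\<close> allows for \<open>2 ^ T\<close> cuts by spheres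
  of \<open>2 ^ T\<close> vertices, the one with \<open>real s * real (T + 1)\<close> for
  \<open>T\<close> levels of separators of \<open>s\<close> vertices; the error factors of each kind
  then multiply to at most 2. What remains is \<open>2 * T * K\<close> from the separators,
  multiplied by \<open>2 * (T + 2)\<close> from the balls.\<close>

lemma tensor_bound_step:
  assumes tw: "poly_bounded_local_treewidth G a d" and "a > 0" "d > 0" and l: "l1 \<ge> 1" "l2 \<ge> 1"
    and k1: "16 * (4 ^ T * kap l1) \<le> 1"
    and s: "a * real (2 * ((T + 1) * (2 * l1 + 1))) powr d + 1 \<le> real s"
    and k2: "16 * (real s * real (T + 1) * kap l2) \<le> 1"
    and K: "s * (max_degree G + 1) ^ l2 < 2 ^ T'" "tensor_bound T' K" "K \<ge> 0"
  shows "tensor_bound T (4 * (real T + 2)\<^sup>2 * K)"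
  unfolding tensor_bound_def
proof (intro allI impI)
  fix U assume U: "U \<subseteq> pverts G \<and> card U < 2 ^ T"
  define R where "R = (T + 1) * (2 * l1 + 1)"
  have sk: "0 \<le> real s * kap l2" using kap_nonneg by simp
  have e2: "(1 + 8 * (real s * kap l2)) ^ T \<le> 2"
    using k2 sk by (intro one_plus_power_le_2) (auto simp: algebra_simps)
  have pieces: "tensorizes X (\<lambda>_. 2 * real T * K)"
    if v: "v \<in> pverts G" and X: "X \<subseteq> {x. dist_le G R v x}" "card X < 2 ^ T" for v X
  proof -
    obtain T0 B where TB: "tree_decomposition (ball_graph R v) T0 B"
      "\<And>t. t \<in> pverts T0 \<Longrightarrow> real (card (B t)) \<le> a * real (2 * R) powr d + 1"
      using small_bag_decomposition[OF tw \<open>a > 0\<close> \<open>d > 0\<close> v] by metis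
    have "card (B t) \<le> s" if "t \<in> pverts T0" for t
      using TB(2)[OF that] s by (simp add: R_def flip: of_nat_le_iff)
    moreover have "16 * (real s * kap l2) \<le> 1"
    proof -
      have "real s * kap l2 * 1 \<le> real s * kap l2 * real (T + 1)"
        by (intro mult_left_mono sk) auto
      also have "\<dots> = real s * real (T + 1) * kap l2" by simp
      finally show ?thesis using k2 by linarith
    qed
    ultimately have "tensorizes X (\<lambda>_. (1 + 8 * (real s * kap l2)) ^ T * real T * K)"
      using l K X by (intro tensorizes_small_treewidth[OF v TB(1), of s l2 T' K]) auto
    then show ?thesis
      by (rule tensorizes_mono) (use e2 K in \<open>intro mult_right_mono; simp\<close>)
  qed
  have four: "(2 :: real) ^ T * 2 ^ T = 4 ^ T" by (simp flip: power_mult_distrib)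
  have e1: "(1 + 8 * (2 ^ T * kap l1)) ^ card U \<le> 2"
  proof (rule one_plus_power_le_2)
    show "0 \<le> 8 * (2 ^ T * kap l1)" using kap_nonneg by simp
    have "real (card U) \<le> 2 ^ T" using U by (simp flip: of_nat_le_iff)
    then have "real (card U) * (8 * (2 ^ T * kap l1)) \<le> 2 ^ T * (8 * (2 ^ T * kap l1))"
      using kap_nonneg by (intro mult_right_mono) auto
    also have "\<dots> = 8 * (4 ^ T * kap l1)" using four by (simp add: algebra_simps)
    finally show "real (card U) * (8 * (2 ^ T * kap l1)) \<le> 1 / 2" using k1 by simp
  qed
  have small: "16 * (2 ^ T * kap l1) \<le> 1"
  proof -
    have "2 ^ T * kap l1 \<le> 4 ^ T * kap l1" using kap_nonneg by (intro mult_right_mono power_mono) auto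
    then show ?thesis using k1 by simp
  qed
  have "(\<Sum>u\<in>U. 2 ^ 0) \<le> (2 ^ T :: nat)" using U by simp
  then have "tensorizes U (\<lambda>u. (1 + 8 * (2 ^ T * kap l1)) ^ card U * (2 * real T * K) * (real T + 2 - real 0))"
    using U pieces small l K unfolding R_def
    by (intro tensorizes_ball_cutting[of l1 T "2 * real T * K" U "\<lambda>_. 0"]) auto
  then show "tensorizes U (\<lambda>_. 4 * (real T + 2)\<^sup>2 * K)"
  proof (rule tensorizes_mono)
    have "(1 + 8 * (2 ^ T * kap l1)) ^ card U * (2 * real T * K) * (real T + 2 - real 0)
        \<le> 2 * (2 * (real T + 2) * K) * (real T + 2)"
      using e1 K kap_nonneg by (intro mult_mono) auto
    then show "(1 + 8 * (2 ^ T * kap l1)) ^ card U * (2 * real T * K) * (real T + 2 - real 0)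
      \<le> 4 * (real T + 2)\<^sup>2 * K" by (simp add: power2_eq_square algebra_simps)
  qed
qed

end

section \<open>Choice of the parameters\<close>

lemma ex_power_le:
  fixes r e :: real
  assumes "0 \<le> r" "r < 1" "e > 0"
  shows "\<exists>n\<ge>1. r ^ n \<le> e"
proof -
  obtain n where n: "r ^ n < e" using real_arch_pow_inv[OF assms(3,2)] by blast
  have "r ^ Suc n \<le> r ^ n" using assms by (intro power_decreasing) auto
  then show ?thesis using n by (intro exI[of _ "Suc n"]) auto
qed

text \<open>Here \<open>2 ^ j\<close> is of the order of \<open>T\<close>. The witnesses are
  \<open>l1\<close> linear in \<open>T\<close>, \<open>s\<close> polynomial in \<open>T\<close> and
  thus exponential in \<open>j\<close>, and \<open>l2\<close> linear in \<open>j\<close>; so the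
  neighbourhoods of separators have a size exponential in \<open>j\<close>, at a rate
  \<open>b\<close> that depends on the constants only.\<close>

lemma ex_step_parameters:
  fixes C \<delta> a d :: real and D :: nat
  assumes "C > 0" "0 < \<delta>" "\<delta> < 1" "a > 0" "d > 0"
  shows "\<exists>b. \<forall>T j. T + 2 \<le> 2 ^ j \<longrightarrow> (\<exists>l1\<ge>1. \<exists>l2\<ge>1. \<exists>s.
    16 * (4 ^ T * (C * (1 - \<delta>) ^ Suc l1)) \<le> 1 \<and>
    a * real (2 * ((T + 1) * (2 * l1 + 1))) powr d + 1 \<le> real s \<and>
    16 * (real s * real (T + 1) * (C * (1 - \<delta>) ^ Suc l2)) \<le> 1 \<and>
    s * (D + 1) ^ l2 < 2 ^ (b * j))"
proof -
  define r where "r = 1 - \<delta>"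
  have r: "0 < r" "r < 1" using assms by (auto simp: r_def)
  define C1 where "C1 = max 1 C"
  have C1: "C1 \<ge> 1" "C \<le> C1" by (auto simp: C1_def)
  \<comment> \<open>\<open>l1\<close> will be \<open>c1 * (T + 1)\<close>: one of the
    \<open>T + 1\<close> factors \<open>1 / (16 * C1)\<close> makes up for \<open>16 * C\<close>,
    the others, being at most \<open>1 / 4\<close>, for \<open>4 ^ T\<close>.\<close>
  obtain c1 where c1: "c1 \<ge> 1" "r ^ c1 \<le> 1 / (16 * C1)"
    using ex_power_le[of r "1 / (16 * C1)"] r C1 by auto
  \<comment> \<open>The radius is quadratic in \<open>T + 2\<close>, so bags have at most
    \<open>A * (T + 2) ^ e2\<close> vertices; \<open>e1\<close> trades \<open>A\<close> for a
    further power of \<open>T + 2\<close>.\<close>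
  define A where "A = a * real (6 * c1) powr d + 1"
  obtain e1 :: nat where e1: "A < 2 ^ e1" using real_arch_pow[of 2 A] by auto
  obtain e2 :: nat where e2: "2 * d \<le> real e2" using real_arch_simple by blast
  define e where "e = e1 + e2"
  \<comment> \<open>\<open>l2\<close> will be \<open>c2 * j\<close>; the decay has to beat
    \<open>real s * real (T + 1)\<close>, which is at most \<open>2 ^ ((e + 1) * j)\<close>.\<close>
  obtain c2 where c2: "c2 \<ge> 1" "r ^ c2 \<le> 1 / (16 * C1 * 2 ^ (e + 1))"
    using ex_power_le[of r "1 / (16 * C1 * 2 ^ (e + 1))"] r C1 by auto
  obtain g :: nat where g: "D + 1 < 2 ^ g" using less_exp[of "D + 1"] by blast
  \<comment> \<open>The summand \<open>e\<close> is for \<open>s\<close>, \<open>g * c2\<close> for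
    the growth of balls, and 1 makes the last inequality strict.\<close>
  define b where "b = e + g * c2 + 1"
  show ?thesis
  proof (rule exI[of _ b], intro allI impI)
    fix T j :: nat assume j: "T + 2 \<le> 2 ^ j"
    have j1: "j \<ge> 1" using j by (cases j) auto
    have "real (T + 2) \<le> real (2 ^ j)" using j by (simp only: of_nat_le_iff)
    then have jr: "real (T + 2) \<le> 2 ^ j" by simp
    define l1 l2 s :: nat where "l1 = c1 * (T + 1)" and "l2 = c2 * j" and "s = 2 ^ (j * e)"
    have l: "l1 \<ge> 1" "l2 \<ge> 1" using c1 c2 j1 by (auto simp: l1_def l2_def)
    have rS: "r ^ Suc n \<le> r ^ n" for n using r by (intro power_decreasing) auto
    have 1: "16 * (4 ^ T * (C * r ^ Suc l1)) \<le> 1"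
    proof -
      have "r ^ Suc l1 \<le> (r ^ c1) ^ (T + 1)" using rS[of l1] by (simp only: l1_def power_mult)
      also have "\<dots> \<le> (1 / (16 * C1)) ^ (T + 1)" using c1 r by (intro power_mono) auto
      also have "\<dots> = (1 / (16 * C1)) * (1 / (16 * C1)) ^ T" by simp
      also have "\<dots> \<le> (1 / (16 * C1)) * (1 / 4) ^ T"
        using C1 by (intro mult_left_mono power_mono) (auto simp: field_simps)
      finally have "C * r ^ Suc l1 \<le> C1 * ((1 / (16 * C1)) * (1 / 4) ^ T)"
        using C1 r assms by (intro mult_mono) auto
      also have "\<dots> = (1 / 16) * (1 / 4) ^ T" using C1 by simp
      finally have "4 ^ T * (C * r ^ Suc l1) \<le> 4 ^ T * ((1 / 16) * (1 / 4) ^ T)"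
        by (intro mult_left_mono) auto
      then show ?thesis by (simp add: power_one_over)
    qed
    have 2: "a * real (2 * ((T + 1) * (2 * l1 + 1))) powr d + 1 \<le> real s"
    proof -
      have "2 * ((T + 1) * (2 * l1 + 1)) \<le> 2 * ((T + 2) * (3 * c1 * (T + 2)))"
      proof (intro mult_left_mono mult_mono)
        have "1 \<le> c1 * (T + 2)" using c1 by simp
        then show "2 * l1 + 1 \<le> 3 * c1 * (T + 2)" by (simp add: l1_def algebra_simps)
      qed auto
      then have "real (2 * ((T + 1) * (2 * l1 + 1))) \<le> real (2 * ((T + 2) * (3 * c1 * (T + 2))))"
        by (simp only: of_nat_le_iff)
      also have "\<dots> = real (6 * c1) * (real (T + 2))\<^sup>2"
        unfolding of_nat_mult power2_eq_square by simp
      finally have "a * real (2 * ((T + 1) * (2 * l1 + 1))) powr d + 1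
          \<le> a * (real (6 * c1) * (real (T + 2))\<^sup>2) powr d + 1"
        using assms by (intro add_right_mono mult_left_mono powr_mono2) auto
      also have "\<dots> = a * real (6 * c1) powr d * real (T + 2) powr (2 * d) + 1"
        by (simp add: powr_mult powr_powr flip: powr_realpow powr_numeral)
      also have "\<dots> \<le> a * real (6 * c1) powr d * real (T + 2) powr real e2 + real (T + 2) powr real e2"
        using assms e2 by (intro add_mono mult_left_mono powr_mono ge_one_powr_ge_zero) auto
      also have "\<dots> = A * real (T + 2) ^ e2"
        by (simp add: A_def algebra_simps powr_realpow)
      also have "\<dots> \<le> 2 ^ e1 * real (T + 2) ^ e2" using e1 by (intro mult_right_mono) auto
      also have "\<dots> \<le> real (T + 2) ^ e1 * real (T + 2) ^ e2"
        by (intro mult_right_mono power_mono) auto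
      also have "\<dots> = real (T + 2) ^ e" by (simp add: e_def power_add)
      also have "\<dots> \<le> (2 ^ j) ^ e" using jr by (intro power_mono) auto
      also have "\<dots> = real s" by (simp add: s_def power_mult)
      finally show ?thesis .
    qed
    have 3: "16 * (real s * real (T + 1) * (C * r ^ Suc l2)) \<le> 1"
    proof -
      have "r ^ Suc l2 \<le> (r ^ c2) ^ j" using rS[of l2] by (simp only: l2_def power_mult)
      also have "\<dots> \<le> (1 / (16 * C1 * 2 ^ (e + 1))) ^ j" using c2 r by (intro power_mono) auto
      also have "\<dots> = ((1 / (16 * C1)) * (1 / 2 ^ (e + 1))) ^ j" by simp
      also have "\<dots> = (1 / (16 * C1)) ^ j * (1 / 2 ^ (e + 1)) ^ j" by (rule power_mult_distrib)
      also have "\<dots> \<le> (1 / (16 * C1)) * (1 / 2 ^ (e + 1)) ^ j"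
        using C1 j1 power_decreasing[of 1 j "1 / (16 * C1)"] by (intro mult_right_mono) (auto simp: field_simps)
      finally have "C * r ^ Suc l2 \<le> C1 * ((1 / (16 * C1)) * (1 / 2 ^ (e + 1)) ^ j)"
        using C1 r assms by (intro mult_mono) auto
      also have "\<dots> = (1 / 16) * (1 / 2 ^ (e + 1)) ^ j" using C1 by simp
      finally have a: "C * r ^ Suc l2 \<le> (1 / 16) * (1 / 2 ^ (e + 1)) ^ j" .
      have "real s * real (T + 1) \<le> real s * 2 ^ j" using jr by (intro mult_left_mono) auto
      then have "real s * real (T + 1) * (C * r ^ Suc l2) \<le> real s * 2 ^ j * ((1 / 16) * (1 / 2 ^ (e + 1)) ^ j)"
        by (rule mult_mono) (use a assms r in auto)
      also have "real s * 2 ^ j = (2 ^ (e + 1)) ^ j"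
        by (simp add: s_def algebra_simps flip: power_mult power_add power_Suc)
      also have "(2 ^ (e + 1)) ^ j * ((1 / 16) * (1 / 2 ^ (e + 1)) ^ j) = (1 / 16 :: real)"
        by (simp add: power_one_over)
      finally show ?thesis by simp
    qed
    have 4: "s * (D + 1) ^ l2 < 2 ^ (b * j)"
    proof -
      have "s * (D + 1) ^ l2 \<le> 2 ^ (j * e) * (2 ^ g) ^ l2"
        unfolding s_def using g by (intro mult_mono power_mono) auto
      also have "\<dots> = 2 ^ (j * e + g * l2)" by (simp add: power_add power_mult)
      also have "\<dots> < 2 ^ (b * j)"
        using j1 by (intro power_strict_increasing) (auto simp: b_def l2_def algebra_simps)
      finally show ?thesis .
    qed
    show "\<exists>l1\<ge>1. \<exists>l2\<ge>1. \<exists>s. 16 * (4 ^ T * (C * (1 - \<delta>) ^ Suc l1)) \<le> 1 \<and>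
      a * real (2 * ((T + 1) * (2 * l1 + 1))) powr d + 1 \<le> real s \<and>
      16 * (real s * real (T + 1) * (C * (1 - \<delta>) ^ Suc l2)) \<le> 1 \<and> s * (D + 1) ^ l2 < 2 ^ (b * j)"
      using l 1 2 3 4 unfolding r_def by blast
  qed
qed

lemma ex_log_scale: "\<exists>j. T + 2 \<le> (2 :: nat) ^ j \<and> 2 ^ j \<le> 2 * (T + 2)"
proof -
  define j where "j = (LEAST j. T + 2 \<le> (2 :: nat) ^ j)"
  have ex: "T + 2 \<le> (2 :: nat) ^ (T + 2)" using less_exp[of "T + 2"] by simp
  have 1: "T + 2 \<le> 2 ^ j" unfolding j_def by (rule LeastI[of _ "T + 2"]) (rule ex)
  then obtain i where i: "j = Suc i" by (cases j) auto
  have "i < (LEAST j. T + 2 \<le> (2 :: nat) ^ j)" using i by (simp add: j_def)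
  then have "\<not> T + 2 \<le> 2 ^ i" by (rule not_less_Least)
  then show ?thesis using 1 i by (intro exI[of _ j]) simp
qed

text \<open>Here the third logarithm is spent. A step of the recursion costs
  \<open>4 * (T + 2)\<^sup>2\<close>, and the cube from the recursive call has to fit into one more
  factor \<open>T + 2\<close>; it does, being a power of log T. The proof has 8 for 4 because
  \<open>2 ^ j\<close> may be twice \<open>T + 2\<close>.\<close>

lemma eventually_scale:
  "\<exists>T0. \<forall>T\<ge>T0. \<forall>j. T + 2 \<le> (2 :: nat) ^ j \<and> 2 ^ j \<le> 2 * (T + 2) \<longrightarrow> 4 * (b * j + 2) ^ 3 \<le> T + 2"
proof -
  have "(\<lambda>j. real j ^ 3 / 2 ^ j) \<longlonglongrightarrow> 0" by real_asymp
  then have "(\<lambda>j. 8 * (real b + 2) ^ 3 * (real j ^ 3 / 2 ^ j)) \<longlonglongrightarrow> 8 * (real b + 2) ^ 3 * 0"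
    by (rule tendsto_mult_left)
  then have "\<forall>\<^sub>F j in sequentially. 8 * (real b + 2) ^ 3 * (real j ^ 3 / 2 ^ j) < 1"
    by (rule order_tendstoD) simp
  then obtain j0 where j0: "\<And>j. j \<ge> j0 \<Longrightarrow> 8 * (real b + 2) ^ 3 * (real j ^ 3 / 2 ^ j) < 1"
    unfolding eventually_sequentially by blast
  show ?thesis
  proof (intro exI[of _ "2 ^ j0"] allI impI)
    fix T j :: nat assume T: "2 ^ j0 \<le> T" and j: "T + 2 \<le> 2 ^ j \<and> 2 ^ j \<le> 2 * (T + 2)"
    have "(2 :: nat) ^ j0 \<le> 2 ^ j" using T j by linarith
    then have "j0 \<le> j" by simp
    have "j \<ge> 1" using j by (cases j) auto
    have "real b * real j + 2 \<le> (real b + 2) * real j" using \<open>j \<ge> 1\<close> by (simp add: algebra_simps)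
    then have "8 * (real b * real j + 2) ^ 3 \<le> 8 * ((real b + 2) * real j) ^ 3"
      by (intro mult_left_mono power_mono) auto
    also have "\<dots> = 8 * (real b + 2) ^ 3 * (real j ^ 3 / 2 ^ j) * 2 ^ j"
      by (simp only: power_mult_distrib) simp
    also have "\<dots> \<le> 1 * 2 ^ j" using j0[OF \<open>j0 \<le> j\<close>] by (intro mult_right_mono) auto
    finally have "8 * (real b * real j + 2) ^ 3 \<le> 2 ^ j" by simp
    then have "real (8 * (b * j + 2) ^ 3) \<le> real (2 ^ j)"
      by (simp only: of_nat_mult of_nat_power of_nat_add of_nat_numeral)
    then have "8 * (b * j + 2) ^ 3 \<le> 2 ^ j" by (simp only: of_nat_le_iff)
    define X where "X = (b * j + 2) ^ 3"
    have "8 * X \<le> 2 ^ j" using \<open>8 * (b * j + 2) ^ 3 \<le> 2 ^ j\<close> by (simp only: X_def)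
    also have "\<dots> \<le> 2 * (T + 2)" using j by simp
    finally have "4 * X \<le> T + 2" by simp
    then show "4 * (b * j + 2) ^ 3 \<le> T + 2" by (simp only: X_def)
  qed
qed

section \<open>Crude bound for small vertex sets\<close>

context hardcore_graph
begin

text \<open>Bounds \<open>mass U \<sigma> / wt \<rho>\<close> for \<rho> in the class:
  \<open>2 ^ N\<close> for the number of configurations on at most \<open>N\<close> vertices, the
  other powers for the quotient of two weights, whether \<open>lam\<close> is above or below
  1.\<close>

definition class_ratio :: "nat \<Rightarrow> real" where
  "class_ratio N = 2 ^ N * (max lam (1 / lam) ^ N * max lam (1 / lam) ^ N)"

lemma max_lam_inverse_ge_1: "max lam (1 / lam) \<ge> 1"
  using lam_pos by (cases "lam \<ge> 1") (auto simp: le_max_iff_disj field_simps)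

lemma class_ratio_ge_1: "class_ratio N \<ge> 1"
proof -
  have "max lam (1 / lam) ^ N * max lam (1 / lam) ^ N \<ge> 1 * 1"
    using max_lam_inverse_ge_1 by (intro mult_mono one_le_power) auto
  then have "2 ^ N * (max lam (1 / lam) ^ N * max lam (1 / lam) ^ N) \<ge> 1 * 1"
    by (intro mult_mono one_le_power) auto
  then show ?thesis by (simp add: class_ratio_def)
qed

lemma mass_le_class_ratio:
  assumes "finite U" "card U \<le> N" and \<rho>: "\<rho> \<in> cl U \<sigma>"
  shows "mass U \<sigma> \<le> class_ratio N * wt \<rho>"
proof -
  define L where "L = max lam (1 / lam)"
  have L1: "L \<ge> 1" unfolding L_def by (rule max_lam_inverse_ge_1)
  have \<rho>c: "\<rho> \<in> configs" using \<rho> cl_subset by blast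
  define c where "c = card {x. x \<notin> U \<and> \<rho> x}"
  have occ: "card {x. \<tau> x} = card {x\<in>U. \<tau> x} + c" if \<tau>: "\<tau> \<in> cl U \<sigma>" for \<tau>
  proof -
    have fin: "finite {x. \<tau> x}" using \<tau> cl_subset finite_occupied by blast
    have eq: "{x. x \<notin> U \<and> \<rho> x} = {x. x \<notin> U \<and> \<tau> x}" using \<tau> \<rho> by (auto simp: cl_def)
    have "card {x. \<tau> x} = card ({x\<in>U. \<tau> x} \<union> {x. x \<notin> U \<and> \<tau> x})"
      by (rule arg_cong[where f = card]) auto
    also have "\<dots> = card {x\<in>U. \<tau> x} + card {x. x \<notin> U \<and> \<tau> x}"
      using fin assms(1) by (intro card_Un_disjoint) (auto elim: finite_subset[rotated])
    finally show ?thesis unfolding c_def eq .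
  qed
  have le: "card {x\<in>U. \<tau> x} \<le> N" for \<tau> :: "'a \<Rightarrow> bool"
    using card_mono[of U "{x\<in>U. \<tau> x}"] assms by auto
  have lamL: "lam ^ i \<le> L ^ N * L ^ N * lam ^ k" if "i \<le> N" "k \<le> N" for i k
  proof -
    have "lam ^ i \<le> L ^ i" using lam_pos by (intro power_mono) (auto simp: L_def)
    also have "\<dots> \<le> L ^ N" using that L1 by (intro power_increasing)
    finally have 1: "lam ^ i \<le> L ^ N" .
    have "1 \<le> (L * lam) ^ k"
      using lam_pos by (intro one_le_power) (auto simp: L_def max_def field_simps)
    also have "\<dots> = L ^ k * lam ^ k" by (simp add: power_mult_distrib)
    also have "\<dots> \<le> L ^ N * lam ^ k"
      using that L1 lam_pos by (intro mult_right_mono power_increasing) auto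
    finally have "L ^ N * 1 \<le> L ^ N * (L ^ N * lam ^ k)" using L1 by (intro mult_left_mono) auto
    with 1 show ?thesis by simp
  qed
  have wle: "wt \<tau> \<le> L ^ N * L ^ N * wt \<rho>" if \<tau>: "\<tau> \<in> cl U \<sigma>" for \<tau>
  proof -
    have \<tau>c: "\<tau> \<in> configs" using \<tau> cl_subset by blast
    have "lam ^ card {x. \<tau> x} \<le> L ^ N * L ^ N * lam ^ card {x. \<rho> x}"
      unfolding occ[OF \<tau>] occ[OF \<rho>] power_add
      using lamL[OF le le, of \<tau> \<rho>] lam_pos by (simp add: mult.assoc[symmetric])
    then show ?thesis
      using partition_pos by (simp add: wt_eq \<tau>c \<rho>c field_simps)
  qed
  have "card (cl U \<sigma>) \<le> card (Pow U)"
  proof (rule card_inj_on_le)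
    show "inj_on (\<lambda>\<tau>. {x\<in>U. \<tau> x}) (cl U \<sigma>)"
    proof (rule inj_onI)
      fix \<tau> \<xi> assume a: "\<tau> \<in> cl U \<sigma>" "\<xi> \<in> cl U \<sigma>" "{x\<in>U. \<tau> x} = {x\<in>U. \<xi> x}"
      show "\<tau> = \<xi>"
      proof
        fix x show "\<tau> x = \<xi> x"
          using a by (cases "x \<in> U") (auto simp: cl_def)
      qed
    qed
  qed (use assms(1) in auto)
  also have "\<dots> = 2 ^ card U" by (rule card_Pow[OF assms(1)])
  also have "\<dots> \<le> 2 ^ N" using assms(2) by (intro power_increasing) auto
  finally have cc: "real (card (cl U \<sigma>)) \<le> 2 ^ N" by (simp add: numeral_power_le_of_nat_cancel_iff of_nat_le_numeral_power_cancel_iff)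
  have "mass U \<sigma> \<le> (\<Sum>\<tau>\<in>cl U \<sigma>. L ^ N * L ^ N * wt \<rho>)"
    unfolding mass_def by (intro sum_mono wle)
  also have "\<dots> = real (card (cl U \<sigma>)) * (L ^ N * L ^ N * wt \<rho>)" by simp
  also have "\<dots> \<le> 2 ^ N * (L ^ N * L ^ N * wt \<rho>)"
    using cc L1 by (intro mult_right_mono) auto
  finally show ?thesis by (simp add: class_ratio_def L_def mult.assoc)
qed

text \<open>A single configuration carries at least the fraction \<open>1 / class_ratio N\<close> of
  its class.\<close>

lemma le_class_ratio_av:
  assumes "finite U" "card U \<le> N" and \<rho>: "\<rho> \<in> cl U \<sigma>" and "\<sigma> \<in> configs"
    and g: "\<And>\<tau>. \<tau> \<in> configs \<Longrightarrow> g \<tau> \<ge> 0"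
  shows "g \<rho> \<le> class_ratio N * av U g \<sigma>"
proof -
  have \<rho>c: "\<rho> \<in> configs" using \<rho> cl_subset by blast
  have "wt \<rho> * g \<rho> \<le> (\<Sum>\<tau>\<in>cl U \<sigma>. wt \<tau> * g \<tau>)"
    using \<rho> g subsetD[OF cl_subset] by (intro member_le_sum mult_nonneg_nonneg) auto
  also have "\<dots> = mass U \<sigma> * av U g \<sigma>" using mass_pos[OF assms(4), of U] by (simp add: av_def)
  also have "\<dots> \<le> class_ratio N * wt \<rho> * av U g \<sigma>"
    using mass_le_class_ratio[OF assms(1-3)] av_nonneg[OF assms(4) g] by (intro mult_right_mono) auto
  finally have "wt \<rho> * g \<rho> \<le> wt \<rho> * (class_ratio N * av U g \<sigma>)" by (simp add: mult_ac)
  then show ?thesis using wt_pos[OF \<rho>c] by simp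
qed

text \<open>Removing vertices keeps a set independent, so every class has this reference
  configuration, and clearing one vertex after the other leads to it within the class.\<close>

definition empty_on :: "'a set \<Rightarrow> ('a \<Rightarrow> bool) \<Rightarrow> 'a \<Rightarrow> bool" where
  "empty_on A \<sigma> = (\<lambda>x. \<sigma> x \<and> x \<notin> A)"

lemma empty_on_cl: "\<sigma> \<in> configs \<Longrightarrow> empty_on A \<sigma> \<in> cl A \<sigma>"
  using configs_down[of \<sigma> "empty_on A \<sigma>"] by (auto simp: cl_def empty_on_def)

lemma empty_on_configs: "\<sigma> \<in> configs \<Longrightarrow> empty_on A \<sigma> \<in> configs"
  using empty_on_cl cl_subset by blast

lemma empty_on_local: "\<rho> \<in> cl A \<sigma> \<Longrightarrow> empty_on A \<rho> = empty_on A \<sigma>"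
  by (auto simp: cl_def empty_on_def fun_eq_iff)

text \<open>Both configurations lie in one class of \<open>{v}\<close>. There a pointwise square
  deviation from the root of the mean is at most \<open>class_ratio N\<close> times its average,
  which \<open>av_hellinger_le\<close> bounds by the entropy.\<close>

lemma site_dirichlet_le:
  assumes f: "\<And>\<sigma>. \<sigma> \<in> configs \<Longrightarrow> f \<sigma> > 0" and "N \<ge> 1"
  shows "(\<Sum>\<sigma>\<in>configs. wt \<sigma> * (sqrt (f \<sigma>) - sqrt (f (empty_on {v} \<sigma>)))\<^sup>2)
    \<le> 4 * class_ratio N * cond_ent {v} f"
proof -
  define Q where "Q = class_ratio N"
  define e where "e = av {v} (\<lambda>\<rho>. f \<rho> * ln (f \<rho> / av {v} f \<rho>))"
  have pt: "(sqrt (f \<sigma>) - sqrt (f (empty_on {v} \<sigma>)))\<^sup>2 \<le> 4 * Q * e \<sigma>" if \<sigma>: "\<sigma> \<in> configs" for \<sigma>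
  proof -
    define s where "s = sqrt (av {v} f \<sigma>)"
    define h where "h = (\<lambda>\<rho>. (sqrt (f \<rho>) - s)\<^sup>2)"
    have h: "h \<rho> \<le> Q * e \<sigma>" if "\<rho> \<in> cl {v} \<sigma>" for \<rho>
    proof -
      have "h \<rho> \<le> Q * av {v} h \<sigma>"
        unfolding Q_def using that \<sigma> \<open>N \<ge> 1\<close> by (intro le_class_ratio_av) (auto simp: h_def)
      also have "\<dots> \<le> Q * e \<sigma>"
        using av_hellinger_le[of f \<sigma> "{v}"] f \<sigma> class_ratio_ge_1[of N]
        by (intro mult_left_mono) (auto simp: h_def s_def e_def Q_def)
      finally show ?thesis .
    qed
    have sq: "(p - q)\<^sup>2 \<le> 2 * (p - s)\<^sup>2 + 2 * (q - s)\<^sup>2" for p q :: real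
    proof -
      have "0 \<le> ((p - s) + (q - s))\<^sup>2" by simp
      then show ?thesis by (simp add: power2_eq_square algebra_simps)
    qed
    have "(sqrt (f \<sigma>) - sqrt (f (empty_on {v} \<sigma>)))\<^sup>2 \<le> 2 * h \<sigma> + 2 * h (empty_on {v} \<sigma>)"
      unfolding h_def by (rule sq)
    also have "\<dots> \<le> 4 * Q * e \<sigma>"
      using h[OF cl_refl[OF \<sigma>]] h[OF empty_on_cl[OF \<sigma>]] by simp
    finally show ?thesis .
  qed
  have "(\<Sum>\<sigma>\<in>configs. wt \<sigma> * (sqrt (f \<sigma>) - sqrt (f (empty_on {v} \<sigma>)))\<^sup>2)
      \<le> (\<Sum>\<sigma>\<in>configs. wt \<sigma> * (4 * Q * e \<sigma>))"
    using pt by (intro sum_mono mult_left_mono) auto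
  also have "\<dots> = 4 * Q * cond_ent {v} f"
    by (simp add: cond_ent_eq_sum_av e_def sum_distrib_left mult_ac)
  finally show ?thesis by (simp add: Q_def)
qed

text \<open>Clear the vertices of \<open>A\<close> one by one; each triangle inequality for squares
  doubles the earlier terms. The step at \<open>v\<close> starts from
  \<open>empty_on A \<sigma>\<close> instead of \<sigma>; its value there is at most
  \<open>class_ratio N\<close> times its average over \<open>A\<close>, and \<open>sum_av\<close>
  undoes the average.\<close>

lemma block_dirichlet_le:
  assumes f: "\<And>\<sigma>. \<sigma> \<in> configs \<Longrightarrow> f \<sigma> > 0" and "finite A" "card A \<le> N"
  shows "(\<Sum>\<sigma>\<in>configs. wt \<sigma> * (sqrt (f \<sigma>) - sqrt (f (empty_on A \<sigma>)))\<^sup>2)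
    \<le> 2 ^ card A * (8 * class_ratio N ^ 2) * (\<Sum>v\<in>A. cond_ent {v} f)"
  using assms(2,3)
proof (induction A rule: finite_induct)
  case empty
  have "empty_on {} \<sigma> = \<sigma>" for \<sigma> :: "'a \<Rightarrow> bool" by (simp add: empty_on_def)
  then show ?case by simp
next
  case (insert v A)
  define Q where "Q = class_ratio N"
  have Q1: "Q \<ge> 1" unfolding Q_def by (rule class_ratio_ge_1)
  have N: "card A \<le> N" "1 \<le> N" using insert by auto
  define h where "h = (\<lambda>\<rho>. (sqrt (f \<rho>) - sqrt (f (empty_on {v} \<rho>)))\<^sup>2)"
  define D where "D = 8 * Q ^ 2"
  define E where "E = (\<Sum>v\<in>A. cond_ent {v} f)"
  have E0: "E \<ge> 0" "cond_ent {v} f \<ge> 0" unfolding E_def using f by (auto intro!: sum_nonneg cond_ent_nonneg)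
  have comp: "empty_on {v} (empty_on A \<sigma>) = empty_on (insert v A) \<sigma>" for \<sigma> :: "'a \<Rightarrow> bool"
    by (auto simp: empty_on_def fun_eq_iff)
  have sq: "(p - q)\<^sup>2 \<le> 2 * (p - s)\<^sup>2 + 2 * (s - q)\<^sup>2" for p q s :: real
  proof -
    have "0 \<le> ((p - s) - (s - q))\<^sup>2" by simp
    then show ?thesis by (simp add: power2_eq_square algebra_simps)
  qed
  have "(\<Sum>\<sigma>\<in>configs. wt \<sigma> * (sqrt (f \<sigma>) - sqrt (f (empty_on (insert v A) \<sigma>)))\<^sup>2)
      \<le> (\<Sum>\<sigma>\<in>configs. wt \<sigma> * (2 * (sqrt (f \<sigma>) - sqrt (f (empty_on A \<sigma>)))\<^sup>2 + 2 * (Q * av A h \<sigma>)))"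
  proof (intro sum_mono mult_left_mono)
    fix \<sigma> assume \<sigma>: "\<sigma> \<in> configs"
    have "h (empty_on A \<sigma>) \<le> Q * av A h \<sigma>"
      unfolding Q_def using \<sigma> N insert.hyps(1) empty_on_cl[OF \<sigma>]
      by (intro le_class_ratio_av) (auto simp: h_def)
    then show "(sqrt (f \<sigma>) - sqrt (f (empty_on (insert v A) \<sigma>)))\<^sup>2
      \<le> 2 * (sqrt (f \<sigma>) - sqrt (f (empty_on A \<sigma>)))\<^sup>2 + 2 * (Q * av A h \<sigma>)"
      using sq[of "sqrt (f \<sigma>)" "sqrt (f (empty_on (insert v A) \<sigma>))" "sqrt (f (empty_on A \<sigma>))"]
      unfolding h_def comp by linarith
  qed auto
  also have "\<dots> = 2 * (\<Sum>\<sigma>\<in>configs. wt \<sigma> * (sqrt (f \<sigma>) - sqrt (f (empty_on A \<sigma>)))\<^sup>2)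
      + 2 * Q * (\<Sum>\<sigma>\<in>configs. wt \<sigma> * av A h \<sigma>)"
    by (simp add: distrib_left sum.distrib sum_distrib_left mult_ac)
  also have "\<dots> \<le> 2 * (2 ^ card A * D * E) + 2 * Q * (4 * Q * cond_ent {v} f)"
    using insert.IH[OF N(1)] site_dirichlet_le[of f N v] f N Q1
    unfolding sum_av by (intro add_mono mult_left_mono) (auto simp: h_def Q_def D_def E_def)
  also have "\<dots> = 2 ^ Suc (card A) * D * E + D * cond_ent {v} f"
    by (simp add: D_def power2_eq_square)
  also have "\<dots> \<le> 2 ^ Suc (card A) * D * E + 2 ^ Suc (card A) * D * cond_ent {v} f"
  proof -
    have "1 * (D * cond_ent {v} f) \<le> 2 ^ Suc (card A) * (D * cond_ent {v} f)"
      using E0 by (intro mult_right_mono one_le_power) (auto simp: D_def)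
    then show ?thesis by simp
  qed
  also have "\<dots> = 2 ^ card (insert v A) * D * (\<Sum>v\<in>insert v A. cond_ent {v} f)"
    using insert.hyps by (simp add: E_def algebra_simps)
  finally show ?case by (simp only: D_def Q_def)
qed

text \<open>The start of the recursion, with a constant depending on \<open>N\<close> and
  \<open>lam\<close> alone. In the variance bound, \<open>x\<^sup>2 - y\<^sup>2\<close> is factored:
  the square of \<open>x + y\<close> cancels the mean in the denominator up to
  \<open>4 * class_ratio N\<close>, and the square of \<open>x - y\<close> is left to
  \<open>block_dirichlet_le\<close>.\<close>

lemma tensorizes_crude:
  assumes "U \<subseteq> pverts G" "card U \<le> N"
  shows "tensorizes U (\<lambda>_. 32 * 2 ^ N * class_ratio N ^ 3)"
  unfolding tensorizes_def
proof (intro allI impI)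
  fix f :: "('a \<Rightarrow> bool) \<Rightarrow> real" assume f: "\<forall>\<sigma>\<in>configs. f \<sigma> > 0"
  have fin: "finite U" by (rule finite_subset[OF assms(1) pair_finite_verts])
  define Q where "Q = class_ratio N"
  have Q1: "Q \<ge> 1" unfolding Q_def by (rule class_ratio_ge_1)
  define z where "z = empty_on U"
  have "cond_ent U f \<le> (\<Sum>\<sigma>\<in>configs. wt \<sigma> * ((f \<sigma> - f (z \<sigma>))\<^sup>2 / av U f \<sigma>))"
    using f by (intro cond_ent_le_square) (auto simp: z_def empty_on_local)
  also have "\<dots> \<le> (\<Sum>\<sigma>\<in>configs. wt \<sigma> * (4 * Q * (sqrt (f \<sigma>) - sqrt (f (z \<sigma>)))\<^sup>2))"
  proof (intro sum_mono mult_left_mono)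
    fix \<sigma> assume \<sigma>: "\<sigma> \<in> configs"
    have oc: "z \<sigma> \<in> configs" "z \<sigma> \<in> cl U \<sigma>"
      using \<sigma> by (auto simp: z_def empty_on_configs empty_on_cl)
    have p: "f \<sigma> > 0" "f (z \<sigma>) > 0" using f \<sigma> oc by auto
    have a: "av U f \<sigma> > 0" using f \<sigma> by (intro av_pos) auto
    have b: "f \<sigma> \<le> Q * av U f \<sigma>" "f (z \<sigma>) \<le> Q * av U f \<sigma>"
      unfolding Q_def
      by (rule le_class_ratio_av[OF fin assms(2)]; use \<sigma> oc f cl_refl[OF \<sigma>] in \<open>auto intro: less_imp_le\<close>)+
    define x y where "x = sqrt (f \<sigma>)" and "y = sqrt (f (z \<sigma>))"
    have xy: "f \<sigma> = x\<^sup>2" "f (z \<sigma>) = y\<^sup>2" using p by (simp_all add: x_def y_def)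
    have "(x\<^sup>2 - y\<^sup>2)\<^sup>2 = (x - y)\<^sup>2 * (x + y)\<^sup>2" by (simp add: power2_eq_square algebra_simps)
    also have "(x + y)\<^sup>2 \<le> 2 * (x\<^sup>2 + y\<^sup>2)"
      using sum_squares_bound[of x y] by (simp add: power2_sum)
    also have "\<dots> \<le> 4 * Q * av U f \<sigma>" using b xy by simp
    finally have "(x\<^sup>2 - y\<^sup>2)\<^sup>2 \<le> (x - y)\<^sup>2 * (4 * Q * av U f \<sigma>)" by (simp add: mult_left_mono)
    then have "(x\<^sup>2 - y\<^sup>2)\<^sup>2 / av U f \<sigma> \<le> 4 * Q * (x - y)\<^sup>2"
      using a by (simp add: field_simps)
    then show "(f \<sigma> - f (z \<sigma>))\<^sup>2 / av U f \<sigma> \<le> 4 * Q * (sqrt (f \<sigma>) - sqrt (f (z \<sigma>)))\<^sup>2"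
      unfolding x_def[symmetric] y_def[symmetric] unfolding xy .
  qed auto
  also have "\<dots> = 4 * Q * (\<Sum>\<sigma>\<in>configs. wt \<sigma> * (sqrt (f \<sigma>) - sqrt (f (empty_on U \<sigma>)))\<^sup>2)"
    by (simp add: sum_distrib_left mult_ac z_def)
  also have "\<dots> \<le> 4 * Q * (2 ^ card U * (8 * Q ^ 2) * (\<Sum>v\<in>U. cond_ent {v} f))"
    unfolding Q_def using f fin assms(2) class_ratio_ge_1[of N]
    by (intro mult_left_mono block_dirichlet_le) auto
  also have "\<dots> \<le> 4 * Q * (2 ^ N * (8 * Q ^ 2) * (\<Sum>v\<in>U. cond_ent {v} f))"
    using Q1 f assms(2)
    by (intro mult_left_mono mult_right_mono power_increasing sum_nonneg cond_ent_nonneg) auto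
  also have "\<dots> = (\<Sum>v\<in>U. 32 * 2 ^ N * class_ratio N ^ 3 * cond_ent {v} f)"
    by (simp add: Q_def sum_distrib_left power2_eq_square power3_eq_cube mult_ac)
  finally show "cond_ent U f \<le> (\<Sum>v\<in>U. 32 * 2 ^ N * class_ratio N ^ 3 * cond_ent {v} f)" .
qed

end

text \<open>Strong induction, from \<open>T\<close> to \<open>b * j\<close> with
  \<open>2 ^ j\<close> of the order of \<open>T\<close>. Up to \<open>T0\<close>, which depends on
  the constants only, the crude bound serves, so \<open>M\<close> is uniform in the graph.\<close>

lemma ex_uniform_tensor_bound:
  fixes a d lam C \<delta> :: real and \<Delta> :: nat
  assumes "a > 0" "d > 0" "lam > 0" "C > 0" "0 < \<delta>" "\<delta> < 1"
  shows "\<exists>M\<ge>1. \<forall>G :: 'a pair_pre_digraph. pair_graph G \<and> max_degree G = \<Delta> \<and>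
      poly_bounded_local_treewidth G a d \<and> strong_spatial_mixing G (hardcore G lam) C \<delta> \<longrightarrow>
      (\<forall>T. hardcore_ssm.tensor_bound G lam T (M * (real T + 2) ^ 3))"
proof -
  obtain b where b: "\<And>T j. T + 2 \<le> 2 ^ j \<Longrightarrow> \<exists>l1\<ge>1. \<exists>l2\<ge>1. \<exists>s.
    16 * (4 ^ T * (C * (1 - \<delta>) ^ Suc l1)) \<le> 1 \<and>
    a * real (2 * ((T + 1) * (2 * l1 + 1))) powr d + 1 \<le> real s \<and>
    16 * (real s * real (T + 1) * (C * (1 - \<delta>) ^ Suc l2)) \<le> 1 \<and>
    s * (\<Delta> + 1) ^ l2 < 2 ^ (b * j)"
    using ex_step_parameters[of C \<delta> a d \<Delta>] assms by metis
  obtain T0 where T0: "\<And>T j. T \<ge> T0 \<Longrightarrow> T + 2 \<le> (2 :: nat) ^ j \<Longrightarrow> 2 ^ j \<le> 2 * (T + 2) \<Longrightarrow>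
      4 * (b * j + 2) ^ 3 \<le> T + 2"
    using eventually_scale[of b] by metis
  define N where "N = (2 :: nat) ^ T0"
  define K0 where "K0 = 32 * 2 ^ N * (2 ^ N * (max lam (1 / lam) ^ N * max lam (1 / lam) ^ N)) ^ 3"
  define M where "M = max 1 K0"
  show ?thesis
  proof (intro exI[of _ M] conjI allI impI)
    show "1 \<le> M" by (simp add: M_def)
    fix G :: "'a pair_pre_digraph" and T :: nat
    assume G: "pair_graph G \<and> max_degree G = \<Delta> \<and>
      poly_bounded_local_treewidth G a d \<and> strong_spatial_mixing G (hardcore G lam) C \<delta>"
    interpret pair_graph G using G by simp
    interpret hardcore_ssm G lam C \<delta>
      using G assms by unfold_locales auto
    show "tensor_bound T (M * (real T + 2) ^ 3)"
    proof (induction T rule: less_induct)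
      case (less T)
      show ?case
      proof (cases "T \<le> T0")
        case True
        have "K0 = 32 * 2 ^ N * class_ratio N ^ 3" by (simp add: K0_def class_ratio_def)
        then have "tensor_bound T0 K0"
          unfolding tensor_bound_def by (auto intro!: tensorizes_crude simp: N_def)
        moreover have "K0 \<le> M * (real T + 2) ^ 3"
        proof -
          have "M * 1 \<le> M * (real T + 2) ^ 3"
            by (intro mult_left_mono one_le_power) (auto simp: M_def)
          then show ?thesis by (simp add: M_def)
        qed
        ultimately show ?thesis by (rule tensor_bound_mono[OF _ True])
      next
        case False
        obtain j where j: "T + 2 \<le> 2 ^ j" "2 ^ j \<le> 2 * (T + 2)" using ex_log_scale by blast
        have sc: "4 * (b * j + 2) ^ 3 \<le> T + 2" using False by (intro T0 j) auto
        have "b * j + 2 \<le> (b * j + 2) ^ 3" by (rule self_le_power) auto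
        then have "b * j < T" using sc by linarith
        then have IH: "tensor_bound (b * j) (M * (real (b * j) + 2) ^ 3)" by (rule less.IH)
        obtain l1 l2 s where l: "l1 \<ge> 1" "l2 \<ge> 1"
          "16 * (4 ^ T * (C * (1 - \<delta>) ^ Suc l1)) \<le> 1"
          "a * real (2 * ((T + 1) * (2 * l1 + 1))) powr d + 1 \<le> real s"
          "16 * (real s * real (T + 1) * (C * (1 - \<delta>) ^ Suc l2)) \<le> 1"
          "s * (\<Delta> + 1) ^ l2 < 2 ^ (b * j)"
          using b[OF j(1)] by blast
        have "tensor_bound T (4 * (real T + 2)\<^sup>2 * (M * (real (b * j) + 2) ^ 3))"
          using G assms l IH by (intro tensor_bound_step[of a d l1 l2 T s "b * j"])
            (auto simp: kap_def M_def)
        moreover have "4 * (real T + 2)\<^sup>2 * (M * (real (b * j) + 2) ^ 3) \<le> M * (real T + 2) ^ 3"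
        proof -
          have "real (4 * (b * j + 2) ^ 3) \<le> real (T + 2)" using sc by (simp only: of_nat_le_iff)
          then have "4 * (real (b * j) + 2) ^ 3 \<le> real T + 2"
            by (simp only: of_nat_mult of_nat_power of_nat_add of_nat_numeral)
          then have "(M * (real T + 2)\<^sup>2) * (4 * (real (b * j) + 2) ^ 3) \<le> (M * (real T + 2)\<^sup>2) * (real T + 2)"
            by (intro mult_left_mono) (auto simp: M_def)
          then show ?thesis by (simp add: power2_eq_square power3_eq_cube mult_ac)
        qed
        ultimately show ?thesis by (rule tensor_bound_mono[OF _ order_refl])
      qed
    qed
  qed
qed

section \<open>Glauber dynamics\<close>

context hardcore_graph
begin

abbreviation "V \<equiv> pverts G"

lemma cl_site_eq:
  assumes "\<sigma> \<in> configs" "v \<in> V"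
  shows "{\<rho> \<in> configs. agrees (V - {v}) \<sigma> \<rho>} = cl {v} \<sigma>"
  using cl_eq_agrees[of \<sigma> \<sigma> "{v}" "{v}"] assms by (simp add: agrees_def)

lemma pmf_glauber_step:
  assumes \<sigma>: "\<sigma> \<in> configs" and ne: "V \<noteq> {}"
  shows "pmf (glauber_step V \<mu>\<^sub>G \<sigma>) \<rho> =
    (\<Sum>v\<in>V. if \<rho> \<in> cl {v} \<sigma> then wt \<rho> / mass {v} \<sigma> else 0) / real (card V)"
proof -
  define p where "p v = cond_pmf \<mu>\<^sub>G {\<rho>. agrees (V - {v}) \<sigma> \<rho>}" for v
  have site: "pmf (map_pmf (\<lambda>\<rho>. \<sigma>(v := \<rho> v)) (p v)) \<rho> = (if \<rho> \<in> cl {v} \<sigma> then wt \<rho> / mass {v} \<sigma> else 0)"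
    if v: "v \<in> V" for v
  proof -
    have ne': "set_pmf \<mu>\<^sub>G \<inter> {\<rho>. agrees (V - {v}) \<sigma> \<rho>} \<noteq> {}"
      using \<sigma> by (auto simp: set_pmf_hardcore agrees_def)
    have set: "set_pmf (p v) = cl {v} \<sigma>"
      unfolding p_def set_cond_pmf[OF ne'] set_pmf_hardcore cl_site_eq[OF \<sigma> v, symmetric] by auto
    \<comment> \<open>Given the other spins, the sampled configuration already agrees with \<sigma>
      off \<open>v\<close>, so the update is the sample itself.\<close>
    have "map_pmf (\<lambda>\<rho>. \<sigma>(v := \<rho> v)) (p v) = map_pmf (\<lambda>\<rho>. \<rho>) (p v)"
    proof (rule map_pmf_cong[OF refl])
      fix \<xi> assume "\<xi> \<in> set_pmf (p v)"
      then show "\<sigma>(v := \<xi> v) = \<xi>" unfolding set by (auto simp: cl_def fun_eq_iff)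
    qed
    moreover have "measure_pmf.prob \<mu>\<^sub>G {\<rho>. agrees (V - {v}) \<sigma> \<rho>} = mass {v} \<sigma>"
      unfolding prob_eq cl_site_eq[OF \<sigma> v] mass_def ..
    moreover have "\<rho> \<in> cl {v} \<sigma>" if "agrees (V - {v}) \<sigma> \<rho>" "\<rho> \<in> configs"
      using that cl_site_eq[OF \<sigma> v] by blast
    moreover have "agrees (V - {v}) \<sigma> \<rho>" if "\<rho> \<in> cl {v} \<sigma>"
      using that cl_site_eq[OF \<sigma> v] by blast
    ultimately show ?thesis
      using pmf_cond[OF ne', of \<rho>] wt_eq_0[of \<rho>] by (auto simp: p_def pmf.map_ident)
  qed
  have "pmf (glauber_step V \<mu>\<^sub>G \<sigma>) \<rho> =
      (\<Sum>v\<in>V. pmf (map_pmf (\<lambda>\<rho>. \<sigma>(v := \<rho> v)) (p v)) \<rho>) / real (card V)"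
    unfolding glauber_step_def p_def[symmetric] pmf_bind
    using ne pair_finite_verts by (rule integral_pmf_of_set)
  also have "(\<Sum>v\<in>V. pmf (map_pmf (\<lambda>\<rho>. \<sigma>(v := \<rho> v)) (p v)) \<rho>) =
      (\<Sum>v\<in>V. if \<rho> \<in> cl {v} \<sigma> then wt \<rho> / mass {v} \<sigma> else 0)"
    by (intro sum.cong refl site)
  finally show ?thesis .
qed

definition site_av :: "(('a \<Rightarrow> bool) \<Rightarrow> real) \<Rightarrow> ('a \<Rightarrow> bool) \<Rightarrow> real" where
  "site_av f \<sigma> = (\<Sum>v\<in>V. av {v} f \<sigma>) / real (card V)"

text \<open>The dynamics is reversible, so on densities with respect to the Gibbs distribution it
  acts as \<open>site_av\<close>; the initial density is that of a point mass.\<close>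

lemma pmf_glauber_dist:
  assumes \<sigma>: "\<sigma> \<in> configs" and ne: "V \<noteq> {}"
  shows "pmf (glauber_dist V \<mu>\<^sub>G t \<sigma>) \<rho> =
    wt \<rho> * (site_av ^^ t) (\<lambda>\<xi>. if \<xi> = \<sigma> then 1 / wt \<sigma> else 0) \<rho>"
proof (induction t arbitrary: \<rho>)
  case 0
  then show ?case using wt_pos[OF \<sigma>] by (simp add: pmf_return)
next
  case (Suc t)
  define n where "n = real (card V)"
  define f where "f = (site_av ^^ t) (\<lambda>\<xi>. if \<xi> = \<sigma> then 1 / wt \<sigma> else 0)"
  define q where "q = glauber_dist V \<mu>\<^sub>G t \<sigma>"
  have q: "pmf q \<xi> = wt \<xi> * f \<xi>" for \<xi> using Suc.IH by (simp add: q_def f_def)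
  have supp: "set_pmf q \<subseteq> configs" using wt_eq_0 by (auto simp: set_pmf_eq q)
  have "pmf (glauber_dist V \<mu>\<^sub>G (Suc t) \<sigma>) \<rho> =
      (\<integral>\<xi>. pmf (glauber_step V \<mu>\<^sub>G \<xi>) \<rho> \<partial>measure_pmf q)"
    by (simp add: q_def pmf_bind)
  also have "\<dots> = (\<Sum>\<xi>\<in>configs. pmf q \<xi> *\<^sub>R pmf (glauber_step V \<mu>\<^sub>G \<xi>) \<rho>)"
    using supp by (intro integral_measure_pmf finite_conf) auto
  also have "\<dots> = (\<Sum>\<xi>\<in>configs. \<Sum>v\<in>V.
      if \<rho> \<in> cl {v} \<xi> then wt \<rho> * (wt \<xi> * f \<xi> / mass {v} \<xi>) / n else 0)"
  proof (intro sum.cong refl)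
    fix \<xi> assume "\<xi> \<in> configs"
    show "pmf q \<xi> *\<^sub>R pmf (glauber_step V \<mu>\<^sub>G \<xi>) \<rho> = (\<Sum>v\<in>V.
      if \<rho> \<in> cl {v} \<xi> then wt \<rho> * (wt \<xi> * f \<xi> / mass {v} \<xi>) / n else 0)"
      unfolding pmf_glauber_step[OF \<open>\<xi> \<in> configs\<close> ne] q n_def[symmetric] sum_divide_distrib
        real_scaleR_def sum_distrib_left
      by (intro sum.cong refl) auto
  qed
  also have "\<dots> = (\<Sum>v\<in>V. \<Sum>\<xi>\<in>configs.
      if \<rho> \<in> cl {v} \<xi> then wt \<rho> * (wt \<xi> * f \<xi> / mass {v} \<xi>) / n else 0)"
    by (rule sum.swap)
  also have "\<dots> = (\<Sum>v\<in>V. wt \<rho> * av {v} f \<rho> / n)"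
  proof (intro sum.cong refl)
    fix v assume "v \<in> V"
    show "(\<Sum>\<xi>\<in>configs. if \<rho> \<in> cl {v} \<xi> then wt \<rho> * (wt \<xi> * f \<xi> / mass {v} \<xi>) / n else 0)
      = wt \<rho> * av {v} f \<rho> / n"
    proof (cases "\<rho> \<in> configs")
      case False
      then show ?thesis using cl_subset by (auto simp: wt_eq_0 intro!: sum.neutral)
    next
      case True
      have "(\<Sum>\<xi>\<in>configs. if \<rho> \<in> cl {v} \<xi> then wt \<rho> * (wt \<xi> * f \<xi> / mass {v} \<xi>) / n else 0)
        = (\<Sum>\<xi>\<in>configs. if \<xi> \<in> cl {v} \<rho> then wt \<rho> * (wt \<xi> * f \<xi> / mass {v} \<rho>) / n else 0)"
      proof (intro sum.cong refl)
        fix \<xi> assume \<xi>: "\<xi> \<in> configs"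
        have "\<rho> \<in> cl {v} \<xi> \<longleftrightarrow> \<xi> \<in> cl {v} \<rho>" using cl_sym[OF _ \<xi>] cl_sym[OF _ True] by blast
        moreover have "mass {v} \<xi> = mass {v} \<rho>" if "\<xi> \<in> cl {v} \<rho>" using that by (rule mass_eq)
        ultimately show "(if \<rho> \<in> cl {v} \<xi> then wt \<rho> * (wt \<xi> * f \<xi> / mass {v} \<xi>) / n else 0) =
          (if \<xi> \<in> cl {v} \<rho> then wt \<rho> * (wt \<xi> * f \<xi> / mass {v} \<rho>) / n else 0)" by simp
      qed
      also have "\<dots> = (\<Sum>\<xi>\<in>cl {v} \<rho>. wt \<rho> * (wt \<xi> * f \<xi> / mass {v} \<rho>) / n)"
        using finite_conf cl_subset[of "{v}" \<rho>] by (simp add: sum.If_cases inf.absorb2)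
      also have "\<dots> = wt \<rho> * av {v} f \<rho> / n"
        by (simp add: av_def sum_distrib_left sum_divide_distrib)
      finally show ?thesis .
    qed
  qed
  also have "\<dots> = wt \<rho> * site_av f \<rho>"
    by (simp add: site_av_def n_def sum_distrib_left sum_divide_distrib)
  finally show ?case by (simp add: f_def)
qed

section \<open>Decay of the relative entropy\<close>

lemma cl_verts: "\<sigma> \<in> configs \<Longrightarrow> cl V \<sigma> = configs"
  using configs_False by (fastforce simp: cl_def)

lemma sum_wt: "(\<Sum>\<sigma>\<in>configs. wt \<sigma>) = 1"
  using finite_conf by (rule sum_pmf_eq_1) (simp add: set_pmf_hardcore)

lemma mass_verts: "\<sigma> \<in> configs \<Longrightarrow> mass V \<sigma> = 1"
  by (simp add: mass_def cl_verts sum_wt)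

lemma av_verts: "\<sigma> \<in> configs \<Longrightarrow> av V f \<sigma> = (\<Sum>\<sigma>\<in>configs. wt \<sigma> * f \<sigma>)"
  by (simp add: av_def mass_verts cl_verts)

lemma cond_ent_verts:
  assumes "(\<Sum>\<sigma>\<in>configs. wt \<sigma> * f \<sigma>) = 1"
  shows "cond_ent V f = (\<Sum>\<sigma>\<in>configs. wt \<sigma> * (f \<sigma> * ln (f \<sigma>)))"
  unfolding cond_ent_def using assms by (intro sum.cong refl) (simp add: av_verts)

lemma site_av_pos:
  assumes "\<And>\<sigma>. \<sigma> \<in> configs \<Longrightarrow> f \<sigma> > 0" "V \<noteq> {}" "\<sigma> \<in> configs"
  shows "site_av f \<sigma> > 0"
  unfolding site_av_def using assms pair_finite_verts
  by (intro divide_pos_pos sum_pos av_pos) (auto simp: card_gt_0_iff)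

lemma sum_site_av:
  assumes "V \<noteq> {}"
  shows "(\<Sum>\<sigma>\<in>configs. wt \<sigma> * site_av f \<sigma>) = (\<Sum>\<sigma>\<in>configs. wt \<sigma> * f \<sigma>)"
proof -
  have "(\<Sum>\<sigma>\<in>configs. wt \<sigma> * site_av f \<sigma>) =
      (\<Sum>\<sigma>\<in>configs. \<Sum>v\<in>V. wt \<sigma> * av {v} f \<sigma>) / real (card V)"
    by (simp add: site_av_def sum_distrib_left sum_divide_distrib)
  also have "(\<Sum>\<sigma>\<in>configs. \<Sum>v\<in>V. wt \<sigma> * av {v} f \<sigma>) =
      (\<Sum>v\<in>V. \<Sum>\<sigma>\<in>configs. wt \<sigma> * av {v} f \<sigma>)" by (rule sum.swap)
  also have "\<dots> = real (card V) * (\<Sum>\<sigma>\<in>configs. wt \<sigma> * f \<sigma>)" by (simp add: sum_av)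
  finally show ?thesis using assms pair_finite_verts by simp
qed

text \<open>Convexity of \<open>x * ln x\<close> bounds the entropy of the averaged density by the
  mean over the updated site, and by the chain rule an update at \<open>v\<close> loses exactly
  \<open>cond_ent {v} f\<close>. By tensorization these losses sum to at least the fraction
  \<open>1 / K\<close> of the entropy.\<close>

lemma cond_ent_site_av_le:
  assumes f: "\<And>\<sigma>. \<sigma> \<in> configs \<Longrightarrow> f \<sigma> > 0" and norm: "(\<Sum>\<sigma>\<in>configs. wt \<sigma> * f \<sigma>) = 1"
    and ne: "V \<noteq> {}" and K: "tensorizes V (\<lambda>_. K)" "K > 0"
  shows "cond_ent V (site_av f) \<le> (1 - 1 / (real (card V) * K)) * cond_ent V f"
proof -
  define n where "n = real (card V)"
  have n: "n > 0" using ne pair_finite_verts by (simp add: n_def card_gt_0_iff)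
  let ?H = "cond_ent V"
  have "?H (site_av f) = (\<Sum>\<sigma>\<in>configs. wt \<sigma> * (site_av f \<sigma> * ln (site_av f \<sigma>)))"
    using norm by (intro cond_ent_verts) (simp add: sum_site_av[OF ne])
  also have "\<dots> \<le> (\<Sum>\<sigma>\<in>configs. wt \<sigma> * ((\<Sum>v\<in>V. av {v} f \<sigma> * ln (av {v} f \<sigma>)) / n))"
  proof (intro sum_mono mult_left_mono)
    fix \<sigma> assume \<sigma>: "\<sigma> \<in> configs"
    define y where "y = site_av f \<sigma>"
    have y: "y > 0" unfolding y_def using f ne \<sigma> by (rule site_av_pos)
    have a: "av {v} f \<sigma> > 0" for v using \<sigma> f by (rule av_pos)
    have ny: "(\<Sum>v\<in>V. av {v} f \<sigma>) = n * y" using n by (simp add: y_def site_av_def n_def)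
    \<comment> \<open>Jensen's inequality, by comparing each term with the mean \<open>y\<close>:
      the linear parts sum to zero.\<close>
    have "(\<Sum>v\<in>V. av {v} f \<sigma> - y) \<le> (\<Sum>v\<in>V. av {v} f \<sigma> * ln (av {v} f \<sigma> / y))"
      using a y by (intro sum_mono mult_ln_div_ge)
    also have "\<dots> = (\<Sum>v\<in>V. av {v} f \<sigma> * ln (av {v} f \<sigma>) - av {v} f \<sigma> * ln y)"
      using a y by (intro sum.cong refl) (simp add: ln_div right_diff_distrib)
    also have "\<dots> = (\<Sum>v\<in>V. av {v} f \<sigma> * ln (av {v} f \<sigma>)) - n * y * ln y"
      by (simp add: sum_subtractf ny flip: sum_distrib_right)
    also have "(\<Sum>v\<in>V. av {v} f \<sigma> - y) = 0" by (simp add: sum_subtractf ny n_def)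
    finally have "n * (y * ln y) \<le> (\<Sum>v\<in>V. av {v} f \<sigma> * ln (av {v} f \<sigma>))" by simp
    then show "site_av f \<sigma> * ln (site_av f \<sigma>) \<le> (\<Sum>v\<in>V. av {v} f \<sigma> * ln (av {v} f \<sigma>)) / n"
      using n by (simp add: y_def field_simps)
  qed auto
  also have "\<dots> = (\<Sum>\<sigma>\<in>configs. \<Sum>v\<in>V. wt \<sigma> * (av {v} f \<sigma> * ln (av {v} f \<sigma>))) / n"
    by (simp add: sum_distrib_left sum_divide_distrib)
  also have "(\<Sum>\<sigma>\<in>configs. \<Sum>v\<in>V. wt \<sigma> * (av {v} f \<sigma> * ln (av {v} f \<sigma>))) =
      (\<Sum>v\<in>V. \<Sum>\<sigma>\<in>configs. wt \<sigma> * (av {v} f \<sigma> * ln (av {v} f \<sigma>)))"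
    by (rule sum.swap)
  also have "\<dots> = (\<Sum>v\<in>V. ?H f - cond_ent {v} f)"
  proof (intro sum.cong refl)
    fix v assume v: "v \<in> V"
    have "?H f = cond_ent {v} f + ?H (av {v} f)"
      using f v by (intro cond_ent_chain) auto
    moreover have "?H (av {v} f) = (\<Sum>\<sigma>\<in>configs. wt \<sigma> * (av {v} f \<sigma> * ln (av {v} f \<sigma>)))"
      using norm by (intro cond_ent_verts) (simp add: sum_av)
    ultimately show "(\<Sum>\<sigma>\<in>configs. wt \<sigma> * (av {v} f \<sigma> * ln (av {v} f \<sigma>))) = ?H f - cond_ent {v} f"
      by simp
  qed
  also have "\<dots> = n * ?H f - (\<Sum>v\<in>V. cond_ent {v} f)" by (simp add: sum_subtractf n_def)
  also have "(n * ?H f - (\<Sum>v\<in>V. cond_ent {v} f)) / n \<le> (1 - 1 / (n * K)) * ?H f"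
  proof -
    have "?H f \<le> K * (\<Sum>v\<in>V. cond_ent {v} f)"
      using K(1) f by (simp add: tensorizes_def sum_distrib_left)
    then have "?H f / K \<le> (\<Sum>v\<in>V. cond_ent {v} f)" using K(2) by (simp add: field_simps)
    then have "(n * ?H f - (\<Sum>v\<in>V. cond_ent {v} f)) / n \<le> (n * ?H f - ?H f / K) / n"
      using n by (intro divide_right_mono) auto
    also have "\<dots> = (1 - 1 / (n * K)) * ?H f" using n K(2) by (simp add: field_simps)
    finally show ?thesis .
  qed
  finally show ?thesis by (simp add: n_def)
qed

text \<open>The threshold is chosen backwards: an entropy of \<open>1 / 256\<close> gives an L1
  deviation of at most \<open>sqrt (4 / 256) = 1 / 8\<close>, which doubles on the way from
  \<open>g\<close> to \<open>f\<close>.\<close>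

lemma glauber_tv_le:
  assumes ne: "V \<noteq> {}" and K: "tensorizes V (\<lambda>_. K)" "K \<ge> 1"
    and s0: "s0 \<in> configs"
    and t: "(1 - 1 / (real (card V) * K)) ^ t * ln (1 / wt s0) \<le> 1 / 256"
  shows "tv_dist (glauber_dist V \<mu>\<^sub>G t s0) \<mu>\<^sub>G \<le> 1 / 4"
proof -
  define n where "n = real (card V)"
  have n: "n \<ge> 1" using ne pair_finite_verts by (simp add: n_def Suc_le_eq card_gt_0_iff)
  define f0 where "f0 = (\<lambda>\<xi>. if \<xi> = s0 then 1 / wt s0 else 0)"
  \<comment> \<open>The density of a point mass vanishes elsewhere, but the entropy inequalities are
    for positive densities. So it is averaged with the stationary density 1; the dynamics preserves
    this relation, and \<open>g t - 1\<close> is half of \<open>f t - 1\<close>.\<close>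
  define g0 where "g0 = (\<lambda>\<xi>. (f0 \<xi> + 1) / 2)"
  define f where "f t = (site_av ^^ t) f0" for t
  define g where "g t = (site_av ^^ t) g0" for t
  have w0: "wt s0 > 0" "wt s0 \<le> 1" using wt_pos[OF s0] pmf_le_1 by auto
  have fg: "g t \<sigma> = (f t \<sigma> + 1) / 2" if "\<sigma> \<in> configs" for t \<sigma>
    using that
  proof (induction t arbitrary: \<sigma>)
    case 0
    then show ?case by (simp add: f_def g_def g0_def)
  next
    case (Suc t)
    have "av {v} (g t) \<sigma> = (av {v} (f t) \<sigma> + 1) / 2" for v
    proof -
      have "av {v} (g t) \<sigma> = av {v} (\<lambda>\<rho>. (1 / 2) * f t \<rho> + 1 / 2) \<sigma>"
        using Suc.IH cl_subset by (intro av_cong) (auto simp: field_simps)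
      also have "\<dots> = (1 / 2) * av {v} (f t) \<sigma> + 1 / 2"
        unfolding av_add av_cmult using Suc.prems by (simp only: av_const)
      finally show ?thesis by simp
    qed
    then have "site_av (g t) \<sigma> = (site_av (f t) \<sigma> + 1) / 2"
      using n ne by (simp add: site_av_def sum.distrib sum_divide_distrib[symmetric] n_def add_divide_distrib)
    then show ?case by (simp add: f_def g_def)
  qed
  have g0pos: "g0 \<xi> > 0" for \<xi> using w0 by (simp add: g0_def f0_def add_pos_nonneg)
  have gpos: "g t \<sigma> > 0" if "\<sigma> \<in> configs" for t \<sigma>
    using that
  proof (induction t arbitrary: \<sigma>)
    case 0
    then show ?case by (simp add: g_def g0pos)
  next
    case (Suc t)
    then have "site_av (g t) \<sigma> > 0" by (intro site_av_pos ne)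
    then show ?case by (simp add: g_def)
  qed
  have g0norm: "(\<Sum>\<sigma>\<in>configs. wt \<sigma> * g0 \<sigma>) = 1"
  proof -
    have "(\<Sum>\<sigma>\<in>configs. wt \<sigma> * f0 \<sigma>) = (\<Sum>\<sigma>\<in>configs. if \<sigma> = s0 then 1 else 0)"
      using w0 by (intro sum.cong) (auto simp: f0_def)
    also have "\<dots> = 1" using s0 finite_conf by simp
    finally have "(\<Sum>\<sigma>\<in>configs. wt \<sigma> * f0 \<sigma>) = 1" .
    moreover have "(\<Sum>\<sigma>\<in>configs. wt \<sigma> * g0 \<sigma>) = ((\<Sum>\<sigma>\<in>configs. wt \<sigma> * f0 \<sigma>) + (\<Sum>\<sigma>\<in>configs. wt \<sigma>)) / 2"
      unfolding sum.distrib[symmetric] sum_divide_distrib by (intro sum.cong) (auto simp: g0_def algebra_simps)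
    ultimately show ?thesis by (simp add: sum_wt)
  qed
  have gnorm: "(\<Sum>\<sigma>\<in>configs. wt \<sigma> * g t \<sigma>) = 1" for t
    by (induction t) (simp_all add: g_def g0norm sum_site_av[OF ne])
  define H where "H t = cond_ent V (g t)" for t
  define x where "x = 1 - 1 / (n * K)"
  have "1 * 1 \<le> n * K" using n K(2) by (intro mult_mono) auto
  then have x: "x \<ge> 0" by (simp add: x_def divide_le_eq)
  have H0: "H 0 \<le> ln (1 / wt s0)"
  proof -
    have "H 0 = (\<Sum>\<sigma>\<in>configs. wt \<sigma> * (g0 \<sigma> * ln (g0 \<sigma>)))"
      unfolding H_def using gnorm[of 0] by (subst cond_ent_verts) (auto simp: g_def)
    also have "\<dots> \<le> (\<Sum>\<sigma>\<in>configs. wt \<sigma> * (g0 \<sigma> * ln (1 / wt s0)))"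
    proof (intro sum_mono mult_left_mono)
      fix \<sigma>
      have "1 \<le> 1 / wt s0" using w0 by simp
      then have "g0 \<sigma> \<le> 1 / wt s0" by (auto simp: g0_def f0_def)
      then show "ln (g0 \<sigma>) \<le> ln (1 / wt s0)" using g0pos[of \<sigma>] by (intro ln_mono) assumption+
    qed (use g0pos in \<open>auto intro: less_imp_le\<close>)
    also have "\<dots> = (\<Sum>\<sigma>\<in>configs. wt \<sigma> * g0 \<sigma>) * ln (1 / wt s0)"
      by (simp only: sum_distrib_right mult.assoc)
    finally show ?thesis by (simp add: g0norm)
  qed
  have Ht: "H t \<le> x ^ t * H 0" for t
  proof (induction t)
    case 0
    then show ?case by simp
  next
    case (Suc t)
    have "H (Suc t) = cond_ent V (site_av (g t))" by (simp add: H_def g_def)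
    also have "\<dots> \<le> x * H t"
      unfolding H_def x_def n_def using gpos gnorm ne K by (intro cond_ent_site_av_le) auto
    also have "\<dots> \<le> x * (x ^ t * H 0)" using Suc.IH x by (intro mult_left_mono)
    finally show ?case by simp
  qed
  have "H t \<le> x ^ t * ln (1 / wt s0)"
    using Ht[of t] mult_left_mono[OF H0, of "x ^ t"] x by simp
  then have H: "H t \<le> 1 / 256" using t unfolding x_def n_def by linarith
  define dev where "dev = (\<Sum>\<sigma>\<in>configs. wt \<sigma> * \<bar>g t \<sigma> - 1\<bar>)"
  have "dev\<^sup>2 \<le> 4 * H t"
  proof -
    have "av V (\<lambda>\<rho>. \<bar>g t \<rho> - av V (g t) \<rho>\<bar>) s0 = dev"
      unfolding dev_def av_verts[OF s0] by (intro sum.cong refl) (simp add: av_verts gnorm)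
    moreover have "av V (\<lambda>\<rho>. g t \<rho> * ln (g t \<rho> / av V (g t) \<rho>)) s0 = H t"
      unfolding H_def cond_ent_def av_verts[OF s0] ..
    moreover have "av V (g t) s0 = 1" by (simp add: av_verts[OF s0] gnorm)
    ultimately show ?thesis
      using abs_dev_power2_le[of "g t" s0 "V"] gpos s0 by simp
  qed
  also have "\<dots> \<le> (1 / 8)\<^sup>2" using H by (simp add: power2_eq_square)
  finally have D: "dev \<le> 1 / 8" by (rule power2_le_imp_le) simp
  let ?p = "glauber_dist V \<mu>\<^sub>G t s0"
  have pmf_p: "pmf ?p \<rho> = wt \<rho> * f t \<rho>" for \<rho>
    unfolding pmf_glauber_dist[OF s0 ne] f_def f0_def ..
  have prob: "measure_pmf.prob q A = (\<Sum>\<sigma>\<in>configs \<inter> A. pmf q \<sigma>)" if "set_pmf q \<subseteq> configs" for q A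
  proof -
    have "measure_pmf.prob q A = measure_pmf.prob q (A \<inter> set_pmf q)" by (simp add: measure_Int_set_pmf)
    also have "\<dots> = measure_pmf.prob q (configs \<inter> A \<inter> set_pmf q)"
      using that by (intro arg_cong[where f = "measure_pmf.prob q"]) auto
    also have "\<dots> = measure_pmf.prob q (configs \<inter> A)" by (simp add: measure_Int_set_pmf)
    also have "\<dots> = (\<Sum>\<sigma>\<in>configs \<inter> A. pmf q \<sigma>)"
      using finite_conf by (intro measure_measure_pmf_finite) auto
    finally show ?thesis .
  qed
  have supp: "set_pmf ?p \<subseteq> configs" using wt_eq_0 by (auto simp: set_pmf_eq pmf_p)
  have "\<bar>measure_pmf.prob ?p A - measure_pmf.prob \<mu>\<^sub>G A\<bar> \<le> 1 / 4" for A
  proof -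
    have "measure_pmf.prob ?p A - measure_pmf.prob \<mu>\<^sub>G A = (\<Sum>\<sigma>\<in>configs \<inter> A. wt \<sigma> * (f t \<sigma> - 1))"
      using prob[OF supp, of A] prob[of \<mu>\<^sub>G A]
      by (simp add: set_pmf_hardcore pmf_p sum_subtractf[symmetric] right_diff_distrib)
    also have "\<bar>\<dots>\<bar> \<le> (\<Sum>\<sigma>\<in>configs \<inter> A. \<bar>wt \<sigma> * (f t \<sigma> - 1)\<bar>)" by (rule sum_abs)
    also have "\<dots> \<le> (\<Sum>\<sigma>\<in>configs. \<bar>wt \<sigma> * (f t \<sigma> - 1)\<bar>)"
      using finite_conf by (intro sum_mono2) auto
    also have "\<dots> = (\<Sum>\<sigma>\<in>configs. 2 * (wt \<sigma> * \<bar>g t \<sigma> - 1\<bar>))"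
    proof (intro sum.cong refl)
      fix \<sigma> assume "\<sigma> \<in> configs"
      then have eq: "f t \<sigma> - 1 = 2 * (g t \<sigma> - 1)" by (simp add: fg)
      show "\<bar>wt \<sigma> * (f t \<sigma> - 1)\<bar> = 2 * (wt \<sigma> * \<bar>g t \<sigma> - 1\<bar>)"
        unfolding eq abs_mult by simp
    qed
    also have "\<dots> = 2 * dev" by (simp add: dev_def sum_distrib_left)
    finally show ?thesis using D by simp
  qed
  then show ?thesis unfolding tv_dist_def by (intro cSUP_least) auto
qed

text \<open>The logarithm bounds the entropy at time 0. The total mass is 1, so
  \<open>class_ratio\<close> for the whole graph bounds every inverse weight.\<close>

lemma ln_inverse_wt_le:
  assumes "\<sigma> \<in> configs"
  shows "ln (1 / wt \<sigma>) \<le> real (card V) * (ln 2 + 2 * ln (max lam (1 / lam)))"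
proof -
  define L where "L = max lam (1 / lam)"
  have L: "L > 0" using lam_pos by (simp add: L_def)
  have "1 \<le> class_ratio (card V) * wt \<sigma>"
    using mass_le_class_ratio[OF pair_finite_verts order_refl cl_refl[OF assms]] mass_verts[OF assms] by simp
  then have "1 / wt \<sigma> \<le> class_ratio (card V)"
    using wt_pos[OF assms] by (simp add: field_simps)
  then have "ln (1 / wt \<sigma>) \<le> ln (class_ratio (card V))"
    using wt_pos[OF assms] by (intro ln_mono) auto
  also have "\<dots> = real (card V) * (ln 2 + 2 * ln L)"
    unfolding class_ratio_def L_def[symmetric] using L
    by (simp add: ln_mult ln_realpow algebra_simps)
  finally show ?thesis by (simp add: L_def)
qed

end

text \<open>Yields at least four vertices in the theorem, so \<open>ln n \<ge> 1\<close> and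
  additive constants can be absorbed.\<close>

lemma (in pair_graph) max_degree_less:
  assumes "max_degree G > 0"
  shows "max_degree G < card (pverts G)"
proof -
  have ne: "pverts G \<noteq> {}" using assms by (auto simp: max_degree_def Sup_nat_def)
  then have pos: "card (pverts G) > 0" using pair_finite_verts by (simp add: card_gt_0_iff)
  have "out_degree (with_proj G) v \<le> card (pverts G) - 1" if v: "v \<in> pverts G" for v
  proof -
    have "out_degree (with_proj G) v = card (snd ` {e \<in> parcs G. fst e = v})"
      unfolding out_degree_def out_arcs_def
      by (subst card_image) (auto simp: inj_on_def prod_eq_iff)
    also have "\<dots> \<le> card (pverts G - {v})"
      using pair_finite_verts by (intro card_mono) (auto dest: in_arcsD2 no_loops')
    also have "\<dots> = card (pverts G) - 1" using v by simp
    finally show ?thesis .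
  qed
  then have "max_degree G \<le> card (pverts G) - 1"
    unfolding max_degree_def by (intro cSUP_least ne)
  then show ?thesis using pos by simp
qed

theorem theorem5p3:
  fixes a d lam C \<delta> :: real and \<Delta> :: nat
  assumes "\<Delta> \<ge> 3" and "a > 0" and "d > 0" and "lam > 0" and "C > 0" and "0 < \<delta>" and "\<delta> < 1"
  shows "\<exists>K>0. \<forall>G :: 'a pair_pre_digraph.
    pair_graph G \<and> max_degree G = \<Delta> \<and> poly_bounded_local_treewidth G a d \<and>
    strong_spatial_mixing G (hardcore G lam) C \<delta> \<longrightarrow>
      ereal_of_enat (glauber_mixing_time (pverts G) (hardcore G lam))
        \<le> ereal (K * (real (card (pverts G)) * ln (real (card (pverts G))) ^ 4))"
proof -
  obtain M where M: "M \<ge> 1" and bound: "\<And>G :: 'a pair_pre_digraph. \<And>T.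
      pair_graph G \<and> max_degree G = \<Delta> \<and> poly_bounded_local_treewidth G a d \<and>
      strong_spatial_mixing G (hardcore G lam) C \<delta> \<Longrightarrow>
      hardcore_ssm.tensor_bound G lam T (M * (real T + 2) ^ 3)"
    using ex_uniform_tensor_bound[of a d lam C \<delta> \<Delta>] assms by blast
  define c where "c = max 1 (ln 2 + 2 * ln (max lam (1 / lam)))"
  have c: "c \<ge> 1" by (simp add: c_def)
  define c' where "c' = ln (256 * c)"
  have c': "c' \<ge> 0" using c by (simp add: c'_def)
  \<comment> \<open>125 is \<open>5 ^ 3\<close> from \<open>real T + 2 \<le> 5 * ln n\<close>, the
    factor \<open>c' + 1\<close> comes from \<open>ln (256 * c * n)\<close>, and the last 1 pays for
    rounding \<open>t\<close>.\<close>
  define K where "K = M * 125 * (c' + 1) + 1"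
  show ?thesis
  proof (intro exI[of _ K] conjI allI impI)
    show "K > 0" using M c' by (simp add: K_def add_nonneg_pos)
    fix G :: "'a pair_pre_digraph"
    assume G: "pair_graph G \<and> max_degree G = \<Delta> \<and> poly_bounded_local_treewidth G a d \<and>
      strong_spatial_mixing G (hardcore G lam) C \<delta>"
    interpret pair_graph G using G by simp
    interpret hardcore_ssm G lam C \<delta> using G assms by unfold_locales auto
    define m where "m = card (pverts G)"
    define n where "n = real m"
    have m4: "m \<ge> 4" using max_degree_less G assms(1) by (simp add: m_def)
    then have ne: "pverts G \<noteq> {}" by (auto simp: m_def)
    have n4: "n \<ge> 4" using m4 by (simp add: n_def)
    have ln4: "ln (4 :: real) = 2 * ln 2" using ln_realpow[of 2 2] by simp
    have ln2: "ln (2 :: real) \<ge> 2 / 3" using ln2_ge_two_thirds by simp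
    have lnn: "ln 4 \<le> ln n" using n4 by simp
    have ln1: "ln n \<ge> 1" using lnn ln4 ln2 by linarith
    obtain T where T: "m + 2 \<le> 2 ^ T" "2 ^ T \<le> 2 * (m + 2)" using ex_log_scale by blast
    define A where "A = M * (real T + 2) ^ 3"
    have A1: "A \<ge> 1"
    proof -
      have "1 * 1 \<le> M * (real T + 2) ^ 3" using M by (intro mult_mono one_le_power) auto
      then show ?thesis by (simp add: A_def)
    qed
    have "tensor_bound T A" unfolding A_def using G by (rule bound)
    then have tens: "tensorizes (pverts G) (\<lambda>_. A)"
      by (rule tensor_boundD) (use T(1) in \<open>auto simp: m_def\<close>)
    have "real T + 2 \<le> 5 * ln n"
    proof -
      have "2 * (m + 2) \<le> 4 * m" using m4 by simp
      with T(2) have "(2 :: nat) ^ T \<le> 4 * m" by (rule order_trans)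
      then have "real (2 ^ T) \<le> real (4 * m)" by (simp only: of_nat_le_iff)
      then have "(2 :: real) ^ T \<le> 4 * n" by (simp add: n_def)
      then have "ln ((2 :: real) ^ T) \<le> ln (4 * n)" using n4 by (intro ln_mono) auto
      then have "real T * ln 2 \<le> ln 4 + ln n" using n4 by (simp add: ln_realpow ln_mult)
      moreover have "real T * (2 / 3) \<le> real T * ln 2" using ln2 by (intro mult_left_mono) auto
      ultimately have "real T \<le> 3 * ln n" using lnn by linarith
      then show ?thesis using ln1 by linarith
    qed
    then have "(real T + 2) ^ 3 \<le> (5 * ln n) ^ 3" by (intro power_mono) auto
    then have "A \<le> M * (5 * ln n) ^ 3" unfolding A_def using M by (intro mult_left_mono) auto
    then have A2: "A \<le> M * 125 * ln n ^ 3" by (simp add: power_mult_distrib)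
    \<comment> \<open>Contraction by \<open>1 - 1 / (n * A)\<close> has to bring the initial
      entropy, at most \<open>n * c\<close>, down to the \<open>1 / 256\<close> of
      \<open>glauber_tv_le\<close>.\<close>
    define t where "t = nat \<lceil>n * A * ln (256 * c * n)\<rceil>"
    have big: "256 * c * n \<ge> 1" using c n4 mult_mono[of 1 "256 * c" 1 n] by simp
    have t_ge: "n * A * ln (256 * c * n) \<le> real t" unfolding t_def by linarith
    have nA: "n * A \<ge> 1" using n4 A1 mult_mono[of 1 n 1 A] by simp
    have "0 \<le> n * A * ln (256 * c * n)" using n4 A1 big by (intro mult_nonneg_nonneg) auto
    then have t_le: "real t \<le> n * A * ln (256 * c * n) + 1" unfolding t_def by linarith
    have decay: "(1 - 1 / (n * A)) ^ t * (n * c) \<le> 1 / 256"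
    proof -
      have "(1 - 1 / (n * A)) ^ t \<le> exp (- (1 / (n * A))) ^ t"
        using nA exp_ge_add_one_self[of "- (1 / (n * A))"] by (intro power_mono) (auto simp: divide_le_eq)
      also have "\<dots> = exp (- (real t / (n * A)))" by (simp flip: exp_of_nat_mult)
      also have "\<dots> \<le> exp (- ln (256 * c * n))"
        using t_ge nA by (simp add: field_simps)
      also have "\<dots> = 1 / (256 * c * n)" using big by (simp add: exp_minus field_simps)
      finally have "(1 - 1 / (n * A)) ^ t * (n * c) \<le> 1 / (256 * c * n) * (n * c)"
        using n4 c by (intro mult_right_mono) auto
      then show ?thesis using n4 c by simp
    qed
    have mix: "tv_dist (glauber_dist (pverts G) (hardcore G lam) t \<sigma>) (hardcore G lam) \<le> 1 / 4"
      if "\<sigma> \<in> set_pmf (hardcore G lam)" for \<sigma>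
    proof -
      have \<sigma>: "\<sigma> \<in> configs" using that by (simp add: set_pmf_hardcore)
      have "ln (1 / wt \<sigma>) \<le> n * c"
      proof -
        have "ln (1 / wt \<sigma>) \<le> n * (ln 2 + 2 * ln (max lam (1 / lam)))"
          using ln_inverse_wt_le[OF \<sigma>] by (simp add: n_def m_def)
        also have "\<dots> \<le> n * c" using n4 by (intro mult_left_mono) (auto simp: c_def)
        finally show ?thesis .
      qed
      then have "(1 - 1 / (n * A)) ^ t * ln (1 / wt \<sigma>) \<le> (1 - 1 / (n * A)) ^ t * (n * c)"
        using nA by (intro mult_left_mono zero_le_power) (auto simp: divide_le_eq)
      then have "(1 - 1 / (n * A)) ^ t * ln (1 / wt \<sigma>) \<le> 1 / 256" using decay by linarith
      then show ?thesis
        using ne tens A1 \<sigma> by (intro glauber_tv_le[of A]) (auto simp: n_def m_def)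
    qed
    then have "glauber_mixing_time (pverts G) (hardcore G lam) \<le> enat t"
      unfolding glauber_mixing_time_def by (intro INF_lower2[of t]) auto
    then have "ereal_of_enat (glauber_mixing_time (pverts G) (hardcore G lam)) \<le> ereal (real t)"
      by (metis ereal_of_enat_le_iff ereal_of_enat_simps(1))
    also have "real t \<le> K * (n * ln n ^ 4)"
    proof -
      have "ln (256 * c * n) = c' + ln n" using c n4 by (simp add: c'_def ln_mult)
      also have "\<dots> \<le> (c' + 1) * ln n"
        using mult_left_mono[OF ln1 c'] by (simp add: algebra_simps)
      finally have l: "ln (256 * c * n) \<le> (c' + 1) * ln n" .
      have "A * ln (256 * c * n) \<le> (M * 125 * ln n ^ 3) * ((c' + 1) * ln n)"
        using A2 l A1 big by (intro mult_mono) auto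
      then have "n * (A * ln (256 * c * n)) \<le> n * ((M * 125 * ln n ^ 3) * ((c' + 1) * ln n))"
        using n4 by (intro mult_left_mono) auto
      moreover have "1 \<le> n * ln n ^ 4"
        using n4 ln1 mult_mono[of 1 n 1 "ln n ^ 4"] by (simp add: one_le_power)
      ultimately have "n * A * ln (256 * c * n) + 1 \<le> n * ((M * 125 * ln n ^ 3) * ((c' + 1) * ln n)) + n * ln n ^ 4"
        by (simp add: mult.assoc)
      also have "\<dots> = K * (n * ln n ^ 4)"
        by (simp add: K_def algebra_simps power3_eq_cube power4_eq_xxxx)
      finally show ?thesis using t_le by linarith
    qed
    finally show "ereal_of_enat (glauber_mixing_time (pverts G) (hardcore G lam))
        \<le> ereal (K * (real (card (pverts G)) * ln (real (card (pverts G))) ^ 4))"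
      by (simp add: n_def m_def)
  qed
qed

end
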